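(* If $\rho$ is a $2$-polymatroid, then $\chi(\rho;x)=s\cdot\chi(G;x)$ for some graph $G$ and some rational number $s$.
   Context: A polymatroid on a finite set $E$ is a function $\rho:2^E\to\mathbb{Z}$ that is normalized ($\rho(\emptyset)=0$), non-decreasing and submodular; it is a $2$-polymatroid if $\rho(\{e\})\le2$ for all $e\in E$. The chromatic polynomial $\chi(\rho;x)$ of $\rho$ is the polynomial in $x$ (it is a polynomial with rational coefficients) whose value at each positive integer $k$ is the number of $k$-tuples $(M_1,\dots,M_k)$ of matroids on $E$ with $\rho=r_{M_1}+\cdots+r_{M_k}$ (pointwise sum of rank functions). $\chi(G;x)$ is the usual chromatic polynomial of the graph $G$. *)

theory Defs
  imports "HOL-Computational_Algebra.Polynomial" "HOL-Library.FuncSet"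
begin

text \<open>Set functions on a finite ground set E are functions on 'a set; only
  their values on subsets of E matter.\<close>

definition polymatroid :: "'a set \<Rightarrow> ('a set \<Rightarrow> int) \<Rightarrow> bool" where
  "polymatroid E \<rho> \<longleftrightarrow> finite E \<and> \<rho> {} = 0
     \<and> (\<forall>X Y. X \<subseteq> Y \<and> Y \<subseteq> E \<longrightarrow> \<rho> X \<le> \<rho> Y)
     \<and> (\<forall>X Y. X \<subseteq> E \<and> Y \<subseteq> E \<longrightarrow> \<rho> (X \<union> Y) + \<rho> (X \<inter> Y) \<le> \<rho> X + \<rho> Y)"

definition two_polymatroid :: "'a set \<Rightarrow> ('a set \<Rightarrow> int) \<Rightarrow> bool" where
  "two_polymatroid E \<rho> \<longleftrightarrow> polymatroid E \<rho> \<and> (\<forall>e\<in>E. \<rho> {e} \<le> 2)"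

text \<open>Matroids on E, represented (bijectively) by their rank functions,
  made extensional: the rank function is 0 outside the subsets of E.\<close>

definition matroid_rank :: "'a set \<Rightarrow> ('a set \<Rightarrow> int) \<Rightarrow> bool" where
  "matroid_rank E r \<longleftrightarrow>
     (\<forall>X. X \<subseteq> E \<longrightarrow> 0 \<le> r X \<and> r X \<le> int (card X))
     \<and> (\<forall>X Y. X \<subseteq> Y \<and> Y \<subseteq> E \<longrightarrow> r X \<le> r Y)
     \<and> (\<forall>X Y. X \<subseteq> E \<and> Y \<subseteq> E \<longrightarrow> r (X \<union> Y) + r (X \<inter> Y) \<le> r X + r Y)
     \<and> (\<forall>X. \<not> X \<subseteq> E \<longrightarrow> r X = 0)"

definition matroid_decomp_count :: "'a set \<Rightarrow> ('a set \<Rightarrow> int) \<Rightarrow> nat \<Rightarrow> nat" where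
  "matroid_decomp_count E \<rho> k = card {Ms. length Ms = k \<and> (\<forall>r\<in>set Ms. matroid_rank E r)
       \<and> (\<forall>X. X \<subseteq> E \<longrightarrow> \<rho> X = (\<Sum>r\<leftarrow>Ms. r X))}"

definition poly_chrom :: "'a set \<Rightarrow> ('a set \<Rightarrow> int) \<Rightarrow> rat poly" where
  "poly_chrom E \<rho> = (THE p. \<forall>k::nat. k \<ge> 1 \<longrightarrow>
       poly p (of_nat k) = of_nat (matroid_decomp_count E \<rho> k))"

definition graph :: "'v set \<Rightarrow> ('v \<Rightarrow> 'v \<Rightarrow> bool) \<Rightarrow> bool" where
  "graph V Adj \<longleftrightarrow> finite V \<and> (\<forall>u v. Adj u v \<longrightarrow> u \<in> V \<and> v \<in> V \<and> Adj v u \<and> u \<noteq> v)"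

definition proper_colourings :: "'v set \<Rightarrow> ('v \<Rightarrow> 'v \<Rightarrow> bool) \<Rightarrow> nat \<Rightarrow> ('v \<Rightarrow> nat) set" where
  "proper_colourings V Adj k = {c \<in> V \<rightarrow>\<^sub>E {..<k}. \<forall>u\<in>V. \<forall>v\<in>V. Adj u v \<longrightarrow> c u \<noteq> c v}"

definition graph_chrom :: "'v set \<Rightarrow> ('v \<Rightarrow> 'v \<Rightarrow> bool) \<Rightarrow> rat poly" where
  "graph_chrom V Adj = (THE p. \<forall>k::nat. k \<ge> 1 \<longrightarrow>
       poly p (of_nat k) = of_nat (card (proper_colourings V Adj k)))"

end

theory Submission
  imports Defs
begin

text \<open>
  Call a matroid with a single connected component besides its loops a block. A \<open>k\<close>-tuple of matroids
  with sum \<open>\<rho>\<close> splits into its blocks, and conversely a decomposition of \<open>\<rho>\<close> into distinct blocks,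
  together with a proper \<open>k\<close>-colouring of the graph \<open>G\<close> of overlapping supports of the blocks, yields such
  a tuple: blocks of one colour are summed. For connected \<open>\<rho>\<close> the count is thus a sum of chromatic
  polynomials, one for each decomposition, plus \<open>k choose 2\<close>, half of an edge, when \<open>\<rho>\<close> is twice a block.

  A separator of \<open>\<rho>\<close> turns the count into a product, that is, \<open>G\<close> into a disjoint union, so assume
  that \<open>\<rho>\<close> is connected. By Lehman's theorem (a connected matroid is determined by its circuits through one
  element) an element of rank 1 makes the decomposition unique. If all elements have rank 2, a
  decomposition either consists of two blocks supported everywhere, with \<open>G\<close> an edge, or is unique, or
  has exactly one rival; in the last case the rival consists of two blocks supported everywhere, at every
  element it is the join and the meet of the two blocks meeting there, and \<open>G\<close> is a triangle or a path
  with three vertices. Triangle plus edge counts as a path, path plus edge as an edge with an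
  isolated vertex, and several edges as a multiple of one edge.
\<close>

section \<open>Circuits through an element\<close>

text \<open>At an element \<open>e\<close>, \<open>\<rho>\<close> shows only how many of the blocks
  there do not yet span \<open>e\<close>. Where two blocks meet, this is the sum of two ports, and
  nothing at \<open>e\<close> alone says how a rival distributes the sets that span \<open>e\<close>
  in exactly one of the blocks. The way out is an element \<open>f\<close> in the support of only
  one of the two blocks: the effect on \<open>f\<close> of elements common to both comes from that
  block alone, and a sum of 0-1 terms with value 1 cannot be split in the rival either. Lehman's
  theorem carries this from \<open>f\<close> back to \<open>e\<close>. Hence each of the two
  families of disputed sets goes over as a whole to one rival block, which leaves only the original
  pair or its join and meet. With equal supports no such \<open>f\<close> exists and no bound on the
  number of rivals is obtained; but then connectivity makes both blocks full, and all full
  decompositions contribute the same graph. Since the join and the meet of a join and a meet are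
  those two again, two rivals cannot both escape the case of equal supports. A factor that is not an
  integer arises only from \<open>k choose 2\<close>.\<close>

text \<open>The sets spanning \<open>e\<close> form the port of the matroid at \<open>e\<close>; \<open>linked\<close> says, in terms of the port only,
  that some circuit contains \<open>e\<close> and \<open>f\<close>.\<close>

definition spans :: "('a set \<Rightarrow> int) \<Rightarrow> 'a \<Rightarrow> 'a set \<Rightarrow> bool" where
  "spans r e Y \<longleftrightarrow> r (insert e Y) = r Y"

definition linked :: "'a set \<Rightarrow> ('a set \<Rightarrow> int) \<Rightarrow> 'a \<Rightarrow> 'a \<Rightarrow> bool" where
  "linked E r e f \<longleftrightarrow> e \<noteq> f \<and> (\<exists>Y \<subseteq> E - {e, f}. spans r e (insert f Y) \<and> \<not> spans r e Y)"

definition cls :: "'a set \<Rightarrow> ('a set \<Rightarrow> int) \<Rightarrow> 'a \<Rightarrow> 'a set" where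
  "cls E r e = insert e {f \<in> E. linked E r e f}"

definition circuit :: "('a set \<Rightarrow> int) \<Rightarrow> 'a set \<Rightarrow> bool" where
  "circuit r Z \<longleftrightarrow> r Z \<noteq> int (card Z) \<and> (\<forall>z\<in>Z. r (Z - {z}) = int (card (Z - {z})))"

text \<open>The set \<open>W\<close> is contracted before restricting to \<open>F\<close>.\<close>

definition minor :: "'a set \<Rightarrow> 'a set \<Rightarrow> ('a set \<Rightarrow> int) \<Rightarrow> 'a set \<Rightarrow> int" where
  "minor F W r X = (if X \<subseteq> F then r (X \<union> W) - r W else 0)"

lemma increments_eq:
  fixes f g :: "'a set \<Rightarrow> int"
  assumes "finite X" "f {} = g {}"
    and "\<And>Y e. \<lbrakk>insert e Y \<subseteq> X; e \<notin> Y\<rbrakk> \<Longrightarrow> f (insert e Y) - f Y = g (insert e Y) - g Y"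
  shows "f X = g X"
proof -
  have "Y \<subseteq> X \<Longrightarrow> f Y = g Y" if "finite Y" for Y
    using that
  proof (induction Y rule: finite_induct)
    case (insert e Y)
    then show ?case using assms(3)[of e Y] by auto
  qed (use assms in auto)
  then show ?thesis using assms(1) by blast
qed

lemma increments_le:
  fixes f g :: "'a set \<Rightarrow> int"
  assumes "finite X" "f {} \<le> g {}"
    and "\<And>Y e. \<lbrakk>insert e Y \<subseteq> X; e \<notin> Y\<rbrakk> \<Longrightarrow> f (insert e Y) - f Y \<le> g (insert e Y) - g Y"
  shows "f X \<le> g X"
proof -
  have "Y \<subseteq> X \<Longrightarrow> f Y \<le> g Y" if "finite Y" for Y
    using that
  proof (induction Y rule: finite_induct)
    case (insert e Y)
    then show ?case using assms(3)[of e Y] by auto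
  qed (use assms in auto)
  then show ?thesis using assms(1) by blast
qed

section \<open>Spanning, independence and circuits\<close>

locale rank_matroid =
  fixes E :: "'a set" and r :: "'a set \<Rightarrow> int"
  assumes fin: "finite E" and mr: "matroid_rank E r"
begin

lemma nonneg: "X \<subseteq> E \<Longrightarrow> 0 \<le> r X"
  and le_card: "X \<subseteq> E \<Longrightarrow> r X \<le> int (card X)"
  and mono: "X \<subseteq> Y \<Longrightarrow> Y \<subseteq> E \<Longrightarrow> r X \<le> r Y"
  and submod: "X \<subseteq> E \<Longrightarrow> Y \<subseteq> E \<Longrightarrow> r (X \<union> Y) + r (X \<inter> Y) \<le> r X + r Y"
  and outside: "\<not> X \<subseteq> E \<Longrightarrow> r X = 0"
  using mr unfolding matroid_rank_def by auto

lemma finite_sub: "X \<subseteq> E \<Longrightarrow> finite X"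
  using fin finite_subset by auto

lemma empty [simp]: "r {} = 0"
  using nonneg[of "{}"] le_card[of "{}"] by simp

lemma Un_le: "X \<subseteq> E \<Longrightarrow> Y \<subseteq> E \<Longrightarrow> r (X \<union> Y) \<le> r X + r Y"
  using submod[of X Y] nonneg[of "X \<inter> Y"] by force

lemma insert_le: "X \<subseteq> E \<Longrightarrow> e \<in> E \<Longrightarrow> r (insert e X) \<le> r X + 1"
  using Un_le[of X "{e}"] le_card[of "{e}"] by simp

lemma insert_ge: "X \<subseteq> E \<Longrightarrow> e \<in> E \<Longrightarrow> r X \<le> r (insert e X)"
  by (rule mono) auto

lemma not_spans: "X \<subseteq> E \<Longrightarrow> e \<in> E \<Longrightarrow> \<not> spans r e X \<Longrightarrow> r (insert e X) = r X + 1"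
  using insert_le[of X e] insert_ge[of X e] unfolding spans_def by linarith

lemma insert_eq: "X \<subseteq> E \<Longrightarrow> e \<in> E \<Longrightarrow> r (insert e X) = r X + (if spans r e X then 0 else 1)"
  using not_spans unfolding spans_def by auto

lemma spans_mono:
  assumes "spans r e X" "X \<subseteq> Y" "Y \<subseteq> E" "e \<in> E"
  shows "spans r e Y"
proof -
  have "r (Y \<union> insert e X) + r (Y \<inter> insert e X) \<le> r Y + r (insert e X)"
    using assms by (intro submod) auto
  moreover have "r X \<le> r (Y \<inter> insert e X)" using assms by (intro mono) auto
  moreover have "Y \<union> insert e X = insert e Y" using assms by auto
  ultimately show ?thesis
    using assms insert_ge[of Y e] unfolding spans_def by simp
qed

lemma spans_cut:
  assumes "spans r t X" "spans r e (insert t X)" "X \<subseteq> E" "t \<in> E" "e \<in> E"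
  shows "spans r e X"
proof -
  have "r (insert e X) \<le> r (insert e (insert t X))" using assms by (intro mono) auto
  then show ?thesis using assms insert_ge[of X e] unfolding spans_def by simp
qed

lemma basis_exists:
  assumes "X \<subseteq> E" shows "\<exists>B\<subseteq>X. r B = int (card B) \<and> r B = r X"
proof -
  have "finite X" using assms finite_sub by auto
  then show ?thesis using assms
  proof (induction X rule: finite_induct)
    case (insert x X)
    then obtain B where B: "B \<subseteq> X" "r B = int (card B)" "r B = r X" by auto
    have fB: "finite B" "x \<notin> B" using B insert finite_subset by auto
    show ?case
    proof (cases "spans r x X")
      case True
      then show ?thesis using B unfolding spans_def by (intro exI[of _ B]) auto
    next
      case False
      then have "\<not> spans r x B" using spans_mono[of x B X] insert B by auto
      then have "r (insert x B) = r B + 1" "r (insert x X) = r X + 1"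
        using not_spans False B insert by auto
      then show ?thesis using B fB by (intro exI[of _ "insert x B"]) auto
    qed
  qed auto
qed

lemma indep_subset:
  assumes "X \<subseteq> E" "r X = int (card X)" "Y \<subseteq> X" shows "r Y = int (card Y)"
proof -
  have "r X \<le> r Y + r (X - Y)" using assms Un_le[of Y "X - Y"]
    by (metis Diff_partition Diff_subset order_trans)
  moreover have "r (X - Y) \<le> int (card (X - Y))" "r Y \<le> int (card Y)" using assms by (auto intro!: le_card)
  moreover have "card X = card Y + card (X - Y)"
    using assms finite_sub by (metis card_Diff_subset card_mono finite_subset le_add_diff_inverse)
  ultimately show ?thesis using assms by linarith
qed

lemma circuit_exists:
  assumes "X \<subseteq> E" "r X \<noteq> int (card X)" shows "\<exists>Z\<subseteq>X. circuit r Z"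
proof -
  have "finite X" using assms finite_sub by auto
  then show ?thesis using assms
  proof (induction X rule: finite_psubset_induct)
    case (psubset X)
    show ?case
    proof (cases "\<exists>z\<in>X. r (X - {z}) \<noteq> int (card (X - {z}))")
      case True
      then obtain z where "z \<in> X" "r (X - {z}) \<noteq> int (card (X - {z}))" by auto
      then show ?thesis using psubset.IH[of "X - {z}"] psubset.prems by blast
    next
      case False
      then show ?thesis using psubset.prems unfolding circuit_def by blast
    qed
  qed
qed

lemma circuit_rank:
  assumes "circuit r Z" "Z \<subseteq> E" shows "r Z = int (card Z) - 1" "Z \<noteq> {}"
proof -
  show "Z \<noteq> {}" using assms unfolding circuit_def by auto
  then obtain z where z: "z \<in> Z" by auto
  have "r (Z - {z}) \<le> r Z" using assms by (intro mono) auto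
  moreover have "r Z \<le> int (card Z)" using assms le_card by auto
  moreover have "r Z \<noteq> int (card Z)" "r (Z - {z}) = int (card (Z - {z}))"
    using assms z unfolding circuit_def by auto
  moreover have "card Z = Suc (card (Z - {z}))" using finite_sub[OF assms(2)] z by (rule card.remove)
  ultimately show "r Z = int (card Z) - 1" by linarith
qed

lemma circuit_spans:
  assumes "circuit r Z" "Z \<subseteq> E" "z \<in> Z" shows "spans r z (Z - {z})"
proof -
  have "card Z = Suc (card (Z - {z}))" using finite_sub[OF assms(2)] assms(3) by (rule card.remove)
  then show ?thesis using circuit_rank[OF assms(1,2)] assms unfolding spans_def circuit_def
    by (simp add: insert_absorb)
qed

text \<open>The elements of \<open>T\<close> are coloops of the restriction to
  \<open>T \<union> Z\<close>, so each of them adds 1 to the rank of any part of this set that it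
  joins.\<close>

lemma skew_rank:
  assumes "T \<subseteq> E" "Z \<subseteq> E" "T \<inter> Z = {}"
    and "\<And>t. t \<in> T \<Longrightarrow> \<not> spans r t ((T - {t}) \<union> Z)"
    and "A \<subseteq> Z" "T' \<subseteq> T"
  shows "r (T' \<union> A) = int (card T') + r A"
proof -
  have "finite T'" using assms finite_sub finite_subset by blast
  then show ?thesis using assms(6)
  proof (induction T' rule: finite_induct)
    case (insert t T')
    have "\<not> spans r t (T' \<union> A)"
    proof
      assume "spans r t (T' \<union> A)"
      moreover have "T' \<union> A \<subseteq> (T - {t}) \<union> Z" using insert assms by auto
      ultimately have "spans r t ((T - {t}) \<union> Z)" using spans_mono assms insert by (metis Diff_subset Un_least insert_subset order_trans subsetD)
      then show False using assms insert by auto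
    qed
    then have "r (insert t (T' \<union> A)) = r (T' \<union> A) + 1"
      using insert assms by (intro not_spans) auto
    then show ?case using insert by simp
  qed auto
qed

text \<open>On subsets of an independent set the rank is the cardinality, so submodularity for
  \<open>insert e X\<close> and \<open>insert e Y\<close> leaves no increment at the intersection.
  The least spanning subset is the fundamental circuit of \<open>e\<close>, without
  \<open>e\<close>.\<close>

lemma spans_Int:
  assumes "I \<subseteq> E" "r I = int (card I)" "X \<subseteq> I" "Y \<subseteq> I" "e \<in> E" "spans r e X" "spans r e Y"
  shows "spans r e (X \<inter> Y)"
proof (cases "e \<in> I")
  case True
  have *: "e \<in> X" if "spans r e X" "X \<subseteq> I" for X
  proof (rule ccontr)
    assume "e \<notin> X"
    then have "card (insert e X) = Suc (card X)"
      using that assms(1) finite_sub finite_subset by (metis card_insert_disjoint order_trans)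
    moreover have "r (insert e X) = int (card (insert e X))" "r X = int (card X)"
      using indep_subset[OF assms(1,2)] that True by auto
    ultimately show False using that unfolding spans_def by simp
  qed
  then have "e \<in> X \<inter> Y" using assms by auto
  then show ?thesis unfolding spans_def by (simp add: insert_absorb)
next
  case False
  have sub: "X \<subseteq> E" "Y \<subseteq> E" using assms by auto
  have fin: "finite X" "finite Y" using sub finite_sub by auto
  have "r (insert e X \<union> insert e Y) + r (insert e X \<inter> insert e Y) \<le> r (insert e X) + r (insert e Y)"
    using sub assms by (intro submod) auto
  moreover have "insert e X \<inter> insert e Y = insert e (X \<inter> Y)" by auto
  moreover have "r (X \<union> Y) \<le> r (insert e X \<union> insert e Y)" using sub assms by (intro mono) auto
  moreover have "r (insert e X) = int (card X)" "r (insert e Y) = int (card Y)"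
    using assms indep_subset[OF assms(1,2)] unfolding spans_def by auto
  moreover have "r (X \<union> Y) = int (card (X \<union> Y))" "r (X \<inter> Y) = int (card (X \<inter> Y))"
    using assms by (auto intro!: indep_subset[OF assms(1,2)])
  moreover have "card (X \<union> Y) + card (X \<inter> Y) = card X + card Y"
    using fin card_Un_Int by metis
  moreover have "r (X \<inter> Y) \<le> r (insert e (X \<inter> Y))" using sub assms by (intro mono) auto
  ultimately show ?thesis unfolding spans_def by simp
qed

text \<open>Intersecting the sets \<open>T \<union> (Z - {z})\<close> inside the independent set
  leaves \<open>T\<close>. This is the contradiction by which knowledge of a port is turned into
  dependence.\<close>

lemma spans_of_indep:
  assumes "T \<union> Z \<subseteq> E" "T \<inter> Z = {}" "r (T \<union> Z) = int (card (T \<union> Z))" "e \<in> E" "Z \<noteq> {}"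
    and sp: "\<And>z. z \<in> Z \<Longrightarrow> spans r e (T \<union> (Z - {z}))"
  shows "spans r e T"
proof -
  let ?I = "T \<union> Z"
  have "spans r e (?I - A)" if "finite A" "A \<noteq> {}" "A \<subseteq> Z" for A
    using that
  proof (induction A rule: finite_ne_induct)
    case (singleton z)
    then have "T \<union> (Z - {z}) = ?I - {z}" using assms(2) by auto
    then show ?case using sp[of z] singleton by simp
  next
    case (insert z A)
    have "T \<union> (Z - {z}) = ?I - {z}" using insert assms(2) by auto
    then have "spans r e ((?I - {z}) \<inter> (?I - A))"
      using insert sp[of z] assms by (intro spans_Int[OF assms(1,3), of "?I - {z}" "?I - A"]) auto
    moreover have "(?I - {z}) \<inter> (?I - A) = ?I - insert z A" by auto
    ultimately show ?case by simp
  qed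
  moreover have "finite Z" using assms finite_sub by auto
  moreover have "?I - Z = T" using assms by auto
  ultimately show ?thesis using assms(5) by fastforce
qed

text \<open>A set \<open>T\<close> of least cardinality such that \<open>T \<union> Z\<close> spans
  \<open>e\<close> and \<open>T\<close> does not: since \<open>Z\<close> is a circuit, each
  \<open>Z - {z}\<close> spans the missing \<open>z\<close>. All properties of \<open>T\<close>
  speak of the port at \<open>e\<close> alone, so they carry over to any matroid with the same
  port.\<close>

lemma linked_circuit_link:
  assumes "circuit r Z" "Z \<subseteq> E - {e}" "z0 \<in> Z" "linked E r e z0" "e \<in> E"
  shows "\<exists>T \<subseteq> E - Z - {e}. \<not> spans r e T \<and> (\<forall>z\<in>Z. spans r e (T \<union> (Z - {z})))
           \<and> (\<forall>t\<in>T. \<not> spans r e ((T - {t}) \<union> Z))"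
proof -
  let ?P = "\<lambda>T. T \<subseteq> E - Z - {e} \<and> spans r e (T \<union> Z) \<and> \<not> spans r e T"
  obtain Y where Y: "Y \<subseteq> E - {e, z0}" "spans r e (insert z0 Y)" "\<not> spans r e Y"
    using assms(4) unfolding linked_def by auto
  have "?P (Y - Z)"
  proof (intro conjI)
    show "spans r e (Y - Z \<union> Z)"
      using Y assms by (intro spans_mono[of e "insert z0 Y" "Y - Z \<union> Z"]) auto
    show "\<not> spans r e (Y - Z)"
      using Y assms spans_mono[of e "Y - Z" Y] by auto
  qed (use Y in auto)
  then obtain T where T: "?P T" and minT: "\<And>T'. ?P T' \<Longrightarrow> card T \<le> card T'"
    using ex_has_least_nat[of ?P "Y - Z" card] by blast
  have fT: "finite T" using T finite_sub by blast
  have *: "\<not> spans r e ((T - {t}) \<union> Z)" if t: "t \<in> T" for t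
  proof
    assume "spans r e ((T - {t}) \<union> Z)"
    moreover have "\<not> spans r e (T - {t})" using T assms(5) spans_mono[of e "T - {t}" T] by blast
    ultimately have "?P (T - {t})" using T by auto
    then show False using minT[of "T - {t}"] t fT by (metis card_Diff1_less linorder_not_less)
  qed
  have "spans r e (T \<union> (Z - {z}))" if z: "z \<in> Z" for z
  proof -
    have "spans r z (Z - {z})" using circuit_spans assms z by auto
    then have "spans r z (T \<union> (Z - {z}))"
      using T assms z by (intro spans_mono[of z "Z - {z}" "T \<union> (Z - {z})"]) auto
    moreover have "insert z (T \<union> (Z - {z})) = T \<union> Z" using z by auto
    ultimately show ?thesis using T assms z spans_cut[of z "T \<union> (Z - {z})" e] by auto
  qed
  then show ?thesis using T * by blast
qed

text \<open>By transitivity of spanning, an element of \<open>T\<close> spanned by the rest could be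
  dropped, against minimality.\<close>

lemma skew_of_minimal:
  assumes "T \<subseteq> E" "Z \<subseteq> E" "e \<in> E" "spans r e (T \<union> Z)"
    and "\<And>t. t \<in> T \<Longrightarrow> \<not> spans r e ((T - {t}) \<union> Z)" and "t \<in> T"
  shows "\<not> spans r t ((T - {t}) \<union> Z)"
proof
  assume "spans r t ((T - {t}) \<union> Z)"
  moreover have "insert t ((T - {t}) \<union> Z) = T \<union> Z" using assms by auto
  ultimately have "spans r e ((T - {t}) \<union> Z)" using assms spans_cut[of t "(T - {t}) \<union> Z" e] by auto
  then show False using assms by auto
qed

section \<open>Components as classes of linked elements\<close>

lemma flip_sym:
  assumes "Y \<subseteq> E - {e, f}" "e \<in> E" "f \<in> E" "e \<noteq> f" "spans r e (insert f Y)" "\<not> spans r e Y"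
  shows "spans r f (insert e Y)" "\<not> spans r f Y"
proof -
  have "r (insert e Y) = r Y + 1" using assms by (intro not_spans) auto
  moreover have "r (insert e Y) \<le> r (insert e (insert f Y))" using assms by (intro mono) auto
  moreover have "r (insert f Y) \<le> r Y + 1" using assms by (intro insert_le) auto
  moreover have "insert f (insert e Y) = insert e (insert f Y)" by auto
  ultimately show "spans r f (insert e Y)" "\<not> spans r f Y" using assms unfolding spans_def by auto
qed

lemma linked_sym:
  assumes "linked E r e f" "e \<in> E" "f \<in> E" shows "linked E r f e"
proof -
  obtain Y where Y: "e \<noteq> f" "Y \<subseteq> E - {e, f}" "spans r e (insert f Y)" "\<not> spans r e Y"
    using assms unfolding linked_def by auto
  then show ?thesis using flip_sym[OF Y(2) assms(2,3) Y(1,3,4)]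
    unfolding linked_def by (auto simp: insert_commute)
qed

lemma cls_sub: "e \<in> E \<Longrightarrow> cls E r e \<subseteq> E"
  unfolding cls_def by auto

text \<open>This plays the role of transitivity for lying on a common circuit. An element
  \<open>g\<close> of \<open>Z\<close> not linked to \<open>e\<close> can be deleted from any set
  avoiding \<open>e\<close> without changing whether it spans \<open>e\<close>. Without
  \<open>g\<close>, what remains of the link through \<open>Z\<close> is independent, and
  \<open>spans_of_indep\<close> makes \<open>T\<close> alone span \<open>e\<close>; when
  \<open>e\<close> lies on \<open>Z\<close> a comparison of cardinalities suffices.\<close>

lemma circuit_sub_cls:
  assumes Z: "circuit r Z" "Z \<subseteq> E" and e: "e \<in> E" and meet: "Z \<inter> cls E r e \<noteq> {}"
  shows "Z \<subseteq> cls E r e"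
proof
  fix g assume g: "g \<in> Z"
  show "g \<in> cls E r e"
  proof (rule ccontr)
    assume ng: "g \<notin> cls E r e"
    then have ge: "g \<noteq> e" and nl: "\<not> linked E r e g" using g Z unfolding cls_def by auto
    have fZ: "finite Z" using Z finite_sub by auto
    have drop: "spans r e (X - {g})" if "spans r e X" "X \<subseteq> E - {e}" for X
    proof (rule ccontr)
      assume n: "\<not> spans r e (X - {g})"
      then have "g \<in> X" using that by (metis Diff_empty Diff_insert0)
      then have "spans r e (insert g (X - {g}))" using that by (simp add: insert_absorb)
      moreover have "X - {g} \<subseteq> E - {e, g}" using that by auto
      ultimately show False using n nl ge unfolding linked_def by blast
    qed
    show False
    proof (cases "e \<in> Z")
      case True
      have "spans r e (Z - {e} - {g})"
        using drop circuit_spans[OF Z True] Z by auto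
      then have "r (insert e (Z - {e} - {g})) = r (Z - {e} - {g})" unfolding spans_def by auto
      moreover have "insert e (Z - {e} - {g}) = Z - {g}" using True ge by auto
      moreover have "r (Z - {g}) = int (card (Z - {g}))" using Z g unfolding circuit_def by auto
      moreover have "r (Z - {e} - {g}) = int (card (Z - {e} - {g}))"
        using Z True unfolding circuit_def by (auto intro: indep_subset[of "Z - {e}" "Z - {e} - {g}"])
      moreover have "card (Z - {e} - {g}) < card (Z - {g})"
        using fZ True ge by (intro psubset_card_mono) auto
      ultimately show False by simp
    next
      case False
      obtain z0 where z0: "z0 \<in> Z" "linked E r e z0" using meet False unfolding cls_def by auto
      have Ze: "Z \<subseteq> E - {e}" using Z False by auto
      obtain T where T: "T \<subseteq> E - Z - {e}" "\<not> spans r e T"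
        "\<And>z. z \<in> Z \<Longrightarrow> spans r e (T \<union> (Z - {z}))"
        "\<And>t. t \<in> T \<Longrightarrow> \<not> spans r e ((T - {t}) \<union> Z)"
        using linked_circuit_link[OF Z(1) Ze z0 e] by auto
      have spTZ: "spans r e (T \<union> Z)" using T(3)[OF g] T(1) Z e
        by (intro spans_mono[of e "T \<union> (Z - {g})" "T \<union> Z"]) auto
      have sk: "\<not> spans r t ((T - {t}) \<union> Z)" if "t \<in> T" for t
        using skew_of_minimal[OF _ Z(2) e spTZ T(4) that] T(1) by blast
      have "r (T \<union> (Z - {g})) = int (card T) + r (Z - {g})"
        using T Z sk by (intro skew_rank[of T Z]) auto
      also have "r (Z - {g}) = int (card (Z - {g}))" using Z g unfolding circuit_def by auto
      also have "int (card T) + int (card (Z - {g})) = int (card (T \<union> (Z - {g})))"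
        using T(1) fZ finite_sub[of T] by (subst card_Un_disjoint) auto
      finally have ind: "r (T \<union> (Z - {g})) = int (card (T \<union> (Z - {g})))" .
      have "spans r e T"
      proof (rule spans_of_indep[OF _ _ ind e])
        show "Z - {g} \<noteq> {}" using z0 nl g by (metis Diff_eq_empty_iff singletonD subsetD)
        fix z assume z: "z \<in> Z - {g}"
        have "spans r e (T \<union> (Z - {z}) - {g})" using z T Z False by (intro drop) auto
        moreover have "T \<union> (Z - {z}) - {g} = T \<union> (Z - {g} - {z})" using T g by auto
        ultimately show "spans r e (T \<union> (Z - {g} - {z}))" by simp
      qed (use T Z in auto)
      then show False using T by auto
    qed
  qed
qed

text \<open>A circuit lies inside the class or outside it, so bases of the two sides have an
  independent union.\<close>

lemma cls_separator:
  assumes "e \<in> E" "X \<subseteq> E"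
  shows "r X = r (X \<inter> cls E r e) + r (X - cls E r e)"
proof -
  let ?K = "cls E r e"
  obtain B1 where B1: "B1 \<subseteq> X \<inter> ?K" "r B1 = int (card B1)" "r B1 = r (X \<inter> ?K)"
    using basis_exists[of "X \<inter> ?K"] assms by (meson Int_lower1 order_trans)
  obtain B2 where B2: "B2 \<subseteq> X - ?K" "r B2 = int (card B2)" "r B2 = r (X - ?K)"
    using basis_exists[of "X - ?K"] assms by (meson Diff_subset order_trans)
  have sub: "B1 \<union> B2 \<subseteq> E" using B1 B2 assms by auto
  have "r (B1 \<union> B2) = int (card (B1 \<union> B2))"
  proof (rule ccontr)
    assume "r (B1 \<union> B2) \<noteq> int (card (B1 \<union> B2))"
    then obtain Z where Z: "Z \<subseteq> B1 \<union> B2" "circuit r Z" using circuit_exists[OF sub] by auto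
    have "Z \<subseteq> B1 \<or> Z \<subseteq> B2" using circuit_sub_cls[OF Z(2) _ assms(1)] Z sub B1 B2 by blast
    then show False
      using indep_subset[of B1 Z] indep_subset[of B2 Z] B1 B2 Z(2) sub unfolding circuit_def by auto
  qed
  moreover have "card (B1 \<union> B2) = card B1 + card B2"
    using B1 B2 sub finite_sub by (intro card_Un_disjoint) auto
  moreover have "r (B1 \<union> B2) \<le> r X" using B1 B2 assms by (intro mono) auto
  moreover have "r ((X \<inter> ?K) \<union> (X - ?K)) \<le> r (X \<inter> ?K) + r (X - ?K)"
    using assms by (intro Un_le) auto
  moreover have "(X \<inter> ?K) \<union> (X - ?K) = X" by auto
  ultimately show ?thesis using B1 B2 by simp
qed

lemma separator_Un:
  assumes sep: "\<And>X. X \<subseteq> E \<Longrightarrow> r X = r (X \<inter> K) + r (X - K)" and "f \<in> K" "f \<in> E" "Y \<subseteq> E"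
  shows "spans r f Y \<longleftrightarrow> spans r f (Y \<inter> K)"
proof -
  have "r (insert f Y) = r (insert f Y \<inter> K) + r (insert f Y - K)" "r Y = r (Y \<inter> K) + r (Y - K)"
    using assms by auto
  moreover have "insert f Y \<inter> K = insert f (Y \<inter> K)" "insert f Y - K = Y - K" using assms by auto
  ultimately show ?thesis unfolding spans_def by auto
qed

lemma separator_not_linked:
  assumes sep: "\<And>X. X \<subseteq> E \<Longrightarrow> r X = r (X \<inter> K) + r (X - K)" and "f \<in> K" "f \<in> E" "g \<notin> K" "g \<in> E"
  shows "\<not> linked E r f g"
proof
  assume "linked E r f g"
  then obtain Y where Y: "Y \<subseteq> E - {f, g}" "spans r f (insert g Y)" "\<not> spans r f Y"
    unfolding linked_def by auto
  have "insert g Y \<inter> K = Y \<inter> K" using assms by auto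
  then show False using separator_Un[of K f "insert g Y"] separator_Un[of K f Y] Y assms by auto
qed

lemma cls_mono_mem:
  assumes "e \<in> E" "f \<in> cls E r e" shows "cls E r f \<subseteq> cls E r e"
proof
  fix g assume g: "g \<in> cls E r f"
  have f: "f \<in> E" using assms cls_sub by auto
  show "g \<in> cls E r e"
  proof (rule ccontr)
    assume "g \<notin> cls E r e"
    then have "\<not> linked E r f g"
      using separator_not_linked[of "cls E r e" f g] cls_separator assms f g cls_sub[OF f] by blast
    then show False using g \<open>g \<notin> cls E r e\<close> assms unfolding cls_def by auto
  qed
qed

lemma cls_eq: "e \<in> E \<Longrightarrow> f \<in> cls E r e \<Longrightarrow> cls E r f = cls E r e"
proof -
  assume e: "e \<in> E" and f: "f \<in> cls E r e"
  have "f \<in> E" using e f cls_sub by auto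
  then have "e \<in> cls E r f" using f linked_sym[of e f] e unfolding cls_def by auto
  then show ?thesis using cls_mono_mem[OF e f] cls_mono_mem[OF \<open>f \<in> E\<close>] by blast
qed

lemma minor_matroid:
  assumes "F \<subseteq> E" "W \<subseteq> E" shows "rank_matroid F (minor F W r)"
proof
  show "finite F" using assms fin finite_subset by auto
  have "r (X \<union> W) - r W \<le> int (card X)" if "X \<subseteq> F" for X
    using that assms Un_le[of X W] le_card[of X] by fastforce
  moreover have "r W \<le> r (X \<union> W)" if "X \<subseteq> F" for X
    using that assms by (intro mono) auto
  moreover have "r (X \<union> W) \<le> r (Y \<union> W)" if "X \<subseteq> Y" "Y \<subseteq> F" for X Y
    using that assms by (intro mono) auto
  moreover have "r (X \<union> Y \<union> W) + r (X \<inter> Y \<union> W) \<le> r (X \<union> W) + r (Y \<union> W)"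
    if "X \<subseteq> F" "Y \<subseteq> F" for X Y
  proof -
    have "X \<union> Y \<union> W = (X \<union> W) \<union> (Y \<union> W)" "X \<inter> Y \<union> W = (X \<union> W) \<inter> (Y \<union> W)" by auto
    then show ?thesis using submod[of "X \<union> W" "Y \<union> W"] that assms by simp
  qed
  ultimately show "matroid_rank F (minor F W r)"
    unfolding matroid_rank_def minor_def by (auto simp: subset_iff)
qed

end

section \<open>Lehman's theorem: the port determines the component\<close>

lemma spans_minor:
  assumes "insert e X \<subseteq> F" shows "spans (minor F W r) e X \<longleftrightarrow> spans r e (X \<union> W)"
  using assms unfolding spans_def minor_def by auto

lemma linked_cong:
  assumes "\<And>Y. Y \<subseteq> E - {e} \<Longrightarrow> spans r e Y = spans r' e Y" "f \<in> E"
  shows "linked E r e f = linked E r' e f"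
proof -
  have "spans r e (insert f Y) = spans r' e (insert f Y) \<and> spans r e Y = spans r' e Y"
    if "e \<noteq> f" "Y \<subseteq> E - {e, f}" for Y
    using that assms by (intro conjI assms(1)) auto
  then show ?thesis unfolding linked_def by blast
qed

lemma cls_cong:
  assumes "\<And>Y. Y \<subseteq> E - {e} \<Longrightarrow> spans r e Y = spans r' e Y"
  shows "cls E r e = cls E r' e"
  using linked_cong[OF assms] unfolding cls_def by auto

text \<open>The circuits avoiding \<open>e\<close> of a connected matroid are forced by the circuits through \<open>e\<close>:
  contracting a minimal set \<open>T\<close> that links \<open>e\<close> to a circuit \<open>Z\<close> puts \<open>e\<close> in the closure of every
  \<open>Z - {z}\<close>, which would make \<open>e\<close> a loop of the contraction if \<open>Z\<close> were independent.\<close>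

lemma dependent_transfer:
  assumes "rank_matroid E r" "rank_matroid E r'" and e: "e \<in> E" and conn: "E \<subseteq> cls E r e"
    and port: "\<And>Y. Y \<subseteq> E - {e} \<Longrightarrow> spans r e Y = spans r' e Y"
    and X: "X \<subseteq> E - {e}" "r X \<noteq> int (card X)"
  shows "r' X \<noteq> int (card X)"
proof
  assume ind': "r' X = int (card X)"
  interpret r: rank_matroid E r by fact
  interpret r': rank_matroid E r' by fact
  obtain Z where Z: "Z \<subseteq> X" "circuit r Z" using r.circuit_exists X by (meson Diff_subset order_trans)
  have ZE: "Z \<subseteq> E - {e}" "Z \<subseteq> E" using Z X by auto
  obtain z0 where z0: "z0 \<in> Z" using r.circuit_rank(2)[OF Z(2) ZE(2)] by auto
  then have lk: "linked E r e z0" using conn ZE unfolding cls_def by auto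
  obtain T where T: "T \<subseteq> E - Z - {e}" "\<not> spans r e T"
    "\<And>z. z \<in> Z \<Longrightarrow> spans r e (T \<union> (Z - {z}))"
    "\<And>t. t \<in> T \<Longrightarrow> \<not> spans r e ((T - {t}) \<union> Z)"
    using r.linked_circuit_link[OF Z(2) ZE(1) z0 lk e] by auto
  have p: "spans r' e Y" if "spans r e Y" "Y \<subseteq> E - {e}" for Y using port that by auto
  have T': "\<not> spans r' e T" "\<And>z. z \<in> Z \<Longrightarrow> spans r' e (T \<union> (Z - {z}))"
    "\<And>t. t \<in> T \<Longrightarrow> \<not> spans r' e ((T - {t}) \<union> Z)"
    subgoal using T(1,2) port[of T] by auto
    subgoal for z using T(1) T(3)[of z] ZE by (intro p) auto
    subgoal for t using T(1) T(4)[of t] ZE port[of "(T - {t}) \<union> Z"] by auto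
    done
  have spTZ: "spans r' e (T \<union> Z)" using T'(2)[OF z0] T(1) ZE e
    by (intro r'.spans_mono[of e "T \<union> (Z - {z0})" "T \<union> Z"]) auto
  have sk: "\<not> spans r' t ((T - {t}) \<union> Z)" if "t \<in> T" for t
    using r'.skew_of_minimal[OF _ ZE(2) e spTZ T'(3) that] T(1) by blast
  have indZ: "r' Z = int (card Z)" using r'.indep_subset[OF _ ind' Z(1)] X by auto
  have "r' (T \<union> Z) = int (card T) + r' Z"
    using T(1) ZE sk by (intro r'.skew_rank[of T Z]) auto
  also have "int (card T) + r' Z = int (card (T \<union> Z))"
    using T(1) ZE r.finite_sub[of T] r.finite_sub[of Z] indZ by (subst card_Un_disjoint) auto
  finally have "spans r' e T"
    using T(1) ZE e z0 T'(2) by (intro r'.spans_of_indep[of T Z]) auto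
  then show False using T' by auto
qed

text \<open>\<open>dependent_transfer\<close> in both directions gives the same independent sets
  avoiding \<open>e\<close>, hence, by bases, the same ranks there. The port supplies the increment
  at \<open>e\<close>.\<close>

lemma connected_port_determines:
  assumes "rank_matroid E r" "rank_matroid E r'" and e: "e \<in> E" and conn: "E \<subseteq> cls E r e"
    and port: "\<And>Y. Y \<subseteq> E - {e} \<Longrightarrow> spans r e Y = spans r' e Y"
    and X: "X \<subseteq> E"
  shows "r X = r' X"
proof -
  interpret r: rank_matroid E r by fact
  interpret r': rank_matroid E r' by fact
  have conn': "E \<subseteq> cls E r' e" using conn cls_cong[OF port] by auto
  have indep: "r Y = int (card Y) \<longleftrightarrow> r' Y = int (card Y)" if "Y \<subseteq> E - {e}" for Y
    using dependent_transfer[OF assms(1,2) e conn port that]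
      dependent_transfer[OF assms(2,1) e conn' port[symmetric] that] by blast
  have eq: "r Y = r' Y" if Y: "Y \<subseteq> E - {e}" for Y
  proof -
    obtain B where B: "B \<subseteq> Y" "r B = int (card B)" "r B = r Y" using r.basis_exists[of Y] Y by (meson Diff_subset order_trans)
    obtain B' where B': "B' \<subseteq> Y" "r' B' = int (card B')" "r' B' = r' Y" using r'.basis_exists[of Y] Y by (meson Diff_subset order_trans)
    have "r' B = r B" "r B' = r' B'" using indep[of B] indep[of B'] B B' Y by auto
    moreover have "r' B \<le> r' Y" "r B' \<le> r Y" using B(1) B'(1) Y r.mono[of B' Y] r'.mono[of B Y] by auto
    ultimately show ?thesis using B B' by simp
  qed
  show ?thesis
  proof (cases "e \<in> X")
    case True
    have "r (insert e (X - {e})) = r' (insert e (X - {e}))"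
      using X e eq[of "X - {e}"] port[of "X - {e}"]
        r.insert_eq[of "X - {e}" e] r'.insert_eq[of "X - {e}" e] by fastforce
    then show ?thesis using True by (simp add: insert_absorb)
  next
    case False
    then show ?thesis using eq X by auto
  qed
qed

text \<open>The class is a separator, so a set linking two of its elements may be intersected with
  it. Thus a component is connected on its own, and the connected case applies to it.\<close>

lemma cls_restrict:
  assumes r: "rank_matroid E r" and e: "e \<in> E"
  shows "cls E r e \<subseteq> cls (cls E r e) (minor (cls E r e) {} r) e"
proof
  interpret r: rank_matroid E r by fact
  let ?K = "cls E r e"
  have K: "?K \<subseteq> E" "e \<in> ?K" using r.cls_sub[OF e] unfolding cls_def by auto
  have sp: "spans (minor ?K {} r) e Y = spans r e Y" if "Y \<subseteq> ?K" for Y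
    using that K spans_minor[of e Y ?K "{}" r] by auto
  fix f assume f: "f \<in> ?K"
  show "f \<in> cls ?K (minor ?K {} r) e"
  proof (cases "f = e")
    case False
    then have "linked E r e f" using f unfolding cls_def by auto
    then obtain Y where Y: "Y \<subseteq> E - {e, f}" "spans r e (insert f Y)" "\<not> spans r e Y"
      unfolding linked_def by auto
    have "insert f Y \<subseteq> E" "Y \<subseteq> E" using Y f K by auto
    then have "spans r e (insert f Y \<inter> ?K)" "\<not> spans r e (Y \<inter> ?K)"
      using r.separator_Un[OF r.cls_separator[OF e] K(2) e] Y by blast+
    moreover have "insert f Y \<inter> ?K = insert f (Y \<inter> ?K)" using f by auto
    ultimately have "linked ?K (minor ?K {} r) e f"
      unfolding linked_def using False Y f by (intro conjI exI[of _ "Y \<inter> ?K"]) (auto simp: sp)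
    then show ?thesis using f unfolding cls_def by auto
  qed (simp add: cls_def)
qed

lemma port_determines:
  assumes r1: "rank_matroid E r" and r2: "rank_matroid E r'" and e: "e \<in> E"
    and port: "\<And>Y. Y \<subseteq> E - {e} \<Longrightarrow> spans r e Y = spans r' e Y"
    and X: "X \<subseteq> cls E r e"
  shows "r X = r' X"
proof -
  interpret r: rank_matroid E r by fact
  interpret r': rank_matroid E r' by fact
  let ?K = "cls E r e"
  have K: "?K \<subseteq> E" "e \<in> ?K" using r.cls_sub[OF e] unfolding cls_def by auto
  have "minor ?K {} r X = minor ?K {} r' X"
  proof (rule connected_port_determines[where E = ?K and e = e])
    show "rank_matroid ?K (minor ?K {} r)" "rank_matroid ?K (minor ?K {} r')"
      using r.minor_matroid r'.minor_matroid K by auto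
    show "?K \<subseteq> cls ?K (minor ?K {} r) e" by (rule cls_restrict[OF r1 e])
    show "spans (minor ?K {} r) e Y = spans (minor ?K {} r') e Y" if "Y \<subseteq> ?K - {e}" for Y
      using that K port[of Y] spans_minor[of e Y ?K "{}" r] spans_minor[of e Y ?K "{}" r'] by auto
  qed (use X K in auto)
  then show ?thesis using X unfolding minor_def by simp
qed

text \<open>Equal ports at \<open>e\<close> give equal ranks on the common component of
  \<open>e\<close>, and elements outside a component do not influence ports inside it. So agreement
  spreads from \<open>e\<close> to every \<open>f\<close> in the component; this is how facts about
  one element are moved to another.\<close>

lemma port_transfer:
  assumes r1: "rank_matroid E r" and r2: "rank_matroid E r'" and e: "e \<in> E"
    and port: "\<And>Y. Y \<subseteq> E - {e} \<Longrightarrow> spans r e Y = spans r' e Y"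
    and f: "f \<in> cls E r e" and Y: "Y \<subseteq> E"
  shows "spans r f Y = spans r' f Y"
proof -
  interpret r: rank_matroid E r by fact
  interpret r': rank_matroid E r' by fact
  let ?K = "cls E r e"
  have K: "?K = cls E r' e" by (rule cls_cong) (rule port)
  have fE: "f \<in> E" using f r.cls_sub[OF e] by auto
  have "spans r f Y = spans r f (Y \<inter> ?K)"
    using r.separator_Un[OF r.cls_separator[OF e] f fE Y] .
  also have "\<dots> = spans r' f (Y \<inter> ?K)"
    using port_determines[OF r1 r2 e port, of "Y \<inter> ?K"] port_determines[OF r1 r2 e port, of "insert f (Y \<inter> ?K)"] f
    unfolding spans_def by auto
  also have "\<dots> = spans r' f Y"
    using r'.separator_Un[of "cls E r' e" f Y] r'.cls_separator[OF e] f fE Y K by auto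
  finally show ?thesis .
qed

section \<open>Decompositions into blocks\<close>

definition supp :: "'a set \<Rightarrow> ('a set \<Rightarrow> int) \<Rightarrow> 'a set" where
  "supp E r = {e \<in> E. r {e} \<noteq> 0}"

text \<open>Loops are allowed, so that blocks with different supports live on the same ground set
  and can be added.\<close>

definition block :: "'a set \<Rightarrow> ('a set \<Rightarrow> int) \<Rightarrow> bool" where
  "block E b \<longleftrightarrow> rank_matroid E b \<and> supp E b \<noteq> {} \<and> (\<forall>e\<in>supp E b. supp E b \<subseteq> cls E b e)"

definition comp :: "'a set \<Rightarrow> ('a set \<Rightarrow> int) \<Rightarrow> 'a \<Rightarrow> 'a set \<Rightarrow> int" where
  "comp E r e X = (if X \<subseteq> E then r (X \<inter> cls E r e) else 0)"

text \<open>A set and not a multiset: a block that occurs twice is treated separately, through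
  \<open>repeats\<close> and \<open>half\<close>.\<close>

definition decomp :: "'a set \<Rightarrow> ('a set \<Rightarrow> int) \<Rightarrow> ('a set \<Rightarrow> int) set \<Rightarrow> bool" where
  "decomp E \<rho> B \<longleftrightarrow> finite E \<and> finite B \<and> (\<forall>b\<in>B. block E b) \<and> (\<forall>X\<subseteq>E. \<rho> X = (\<Sum>b\<in>B. b X))"

definition blocks_at :: "'a set \<Rightarrow> ('a set \<Rightarrow> int) set \<Rightarrow> 'a \<Rightarrow> ('a set \<Rightarrow> int) set" where
  "blocks_at E B e = {b \<in> B. e \<in> supp E b}"

section \<open>Components as blocks\<close>

context rank_matroid
begin

lemma supp_iff: "e \<in> supp E r \<longleftrightarrow> e \<in> E \<and> \<not> spans r e {}"
  unfolding supp_def spans_def by auto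

lemma supp_sub: "supp E r \<subseteq> E"
  unfolding supp_def by auto

lemma supp_rank: "e \<in> supp E r \<Longrightarrow> r {e} = 1"
  using insert_eq[of "{}" e] supp_iff by auto

lemma spans_loop: "e \<in> E \<Longrightarrow> e \<notin> supp E r \<Longrightarrow> Y \<subseteq> E \<Longrightarrow> spans r e Y"
  using spans_mono[of e "{}" Y] supp_iff by auto

lemma restrict_supp:
  assumes "supp E r \<subseteq> S" "X \<subseteq> E" shows "r X = r (X \<inter> S)"
proof -
  have "r (X - S) = 0"
  proof (rule increments_eq[where f = r and g = "\<lambda>_. 0"])
    fix Y e assume "insert e Y \<subseteq> X - S" "e \<notin> Y"
    then show "r (insert e Y) - r Y = 0 - 0"
      using spans_loop[of e Y] assms unfolding spans_def by auto
  qed (use assms finite_sub in auto)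
  moreover have "r (X \<inter> S \<union> (X - S)) \<le> r (X \<inter> S) + r (X - S)" using assms by (intro Un_le) auto
  moreover have "X \<inter> S \<union> (X - S) = X" by auto
  moreover have "r (X \<inter> S) \<le> r X" using assms by (intro mono) auto
  ultimately show ?thesis by simp
qed

lemma spans_restrict_supp:
  assumes "supp E r \<subseteq> S" "Y \<subseteq> E" "e \<in> supp E r"
  shows "spans r e Y \<longleftrightarrow> spans r e (Y \<inter> S)"
proof -
  have "e \<in> S" "e \<in> E" using assms supp_sub by auto
  then have "insert e Y \<inter> S = insert e (Y \<inter> S)" by auto
  then show ?thesis
    using restrict_supp[OF assms(1), of "insert e Y"] restrict_supp[OF assms(1,2)] \<open>e \<in> E\<close> assms(2)
    unfolding spans_def by auto
qed

lemma linked_supp: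
  assumes "linked E r e f" "e \<in> E" "f \<in> E" shows "e \<in> supp E r" "f \<in> supp E r"
proof -
  have *: "e \<in> supp E r" if l: "linked E r e f" "e \<in> E" for e f
  proof (rule ccontr)
    assume "e \<notin> supp E r"
    moreover obtain Y where "Y \<subseteq> E - {e, f}" "\<not> spans r e Y" using l(1) unfolding linked_def by blast
    ultimately show False using spans_loop[of e Y] l(2) by blast
  qed
  show "e \<in> supp E r" "f \<in> supp E r" using * assms linked_sym[OF assms] by auto
qed

lemma cls_sub_supp: "e \<in> supp E r \<Longrightarrow> cls E r e \<subseteq> supp E r"
  using linked_supp(2)[of e] subsetD[OF supp_sub, of e] unfolding cls_def by auto

lemma comp_port:
  assumes "e \<in> E" "f \<in> cls E r e" "Y \<subseteq> E"
  shows "spans (comp E r e) f Y \<longleftrightarrow> spans r f Y"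
proof -
  have fE: "f \<in> E" using assms cls_sub by auto
  have "insert f Y \<inter> cls E r e = insert f (Y \<inter> cls E r e)" using assms by auto
  then have "spans (comp E r e) f Y \<longleftrightarrow> spans r f (Y \<inter> cls E r e)"
    using assms fE unfolding spans_def comp_def by auto
  then show ?thesis using separator_Un[OF cls_separator[OF assms(1)] assms(2) fE assms(3)] by auto
qed

lemma comp_matroid:
  assumes "e \<in> E" shows "rank_matroid E (comp E r e)"
proof
  show "finite E" by (rule fin)
  have sub: "X \<inter> cls E r e \<subseteq> E" if "X \<subseteq> E" for X using that by auto
  have "r (X \<inter> cls E r e) \<le> int (card X)" if "X \<subseteq> E" for X
  proof -
    have "card (X \<inter> cls E r e) \<le> card X" using that finite_sub by (intro card_mono) auto
    then show ?thesis using le_card[OF sub[OF that]] by linarith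
  qed
  moreover have "r (X \<inter> cls E r e) \<le> r (Y \<inter> cls E r e)" if "X \<subseteq> Y" "Y \<subseteq> E" for X Y
    using that by (intro mono) auto
  moreover have "r ((X \<union> Y) \<inter> cls E r e) + r (X \<inter> Y \<inter> cls E r e) \<le> r (X \<inter> cls E r e) + r (Y \<inter> cls E r e)"
    if "X \<subseteq> E" "Y \<subseteq> E" for X Y
  proof -
    have "(X \<union> Y) \<inter> cls E r e = (X \<inter> cls E r e) \<union> (Y \<inter> cls E r e)"
      "X \<inter> Y \<inter> cls E r e = (X \<inter> cls E r e) \<inter> (Y \<inter> cls E r e)" by auto
    then show ?thesis using submod[OF sub sub] that by simp
  qed
  ultimately show "matroid_rank E (comp E r e)"
    unfolding matroid_rank_def comp_def using nonneg[OF sub] by (auto simp: le_supI)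
qed

lemma comp_supp:
  assumes "e \<in> supp E r" shows "supp E (comp E r e) = cls E r e"
proof -
  have e: "e \<in> E" using assms supp_sub by auto
  have "comp E r e {f} = (if f \<in> cls E r e then r {f} else 0)" if "f \<in> E" for f
    using that unfolding comp_def by auto
  moreover have "cls E r e \<subseteq> E" "\<forall>f\<in>cls E r e. r {f} \<noteq> 0"
    using cls_sub[OF e] cls_sub_supp[OF assms] unfolding supp_def by auto
  ultimately show ?thesis unfolding supp_def by (auto split: if_splits)
qed

lemma comp_block:
  assumes "e \<in> supp E r" shows "block E (comp E r e)"
proof -
  have e: "e \<in> E" using assms supp_sub by auto
  have "cls E (comp E r e) f = cls E r e" if f: "f \<in> cls E r e" for f
  proof -
    have "cls E (comp E r e) f = cls E r f"
      by (rule cls_cong) (use comp_port[OF e f] in auto)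
    then show ?thesis using cls_eq[OF e f] by simp
  qed
  then show ?thesis
    unfolding block_def comp_supp[OF assms] using comp_matroid[OF e] by (auto simp: cls_def)
qed

end

lemma blockD:
  assumes "block E b"
  shows "rank_matroid E b" "supp E b \<noteq> {}" "e \<in> supp E b \<Longrightarrow> cls E b e = supp E b"
proof -
  show 1: "rank_matroid E b" "supp E b \<noteq> {}" using assms unfolding block_def by auto
  show "cls E b e = supp E b" if "e \<in> supp E b"
    using assms that rank_matroid.cls_sub_supp[OF 1(1) that] unfolding block_def by auto
qed

lemma supp_subset: "supp E b \<subseteq> E"
  unfolding supp_def by auto

lemma suppD: "e \<in> supp E b \<Longrightarrow> e \<in> E"
  unfolding supp_def by auto

lemma block_eqI:
  assumes b: "block E b" and r: "rank_matroid E r" "supp E r \<subseteq> supp E b" and e: "e \<in> supp E b"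
    and port: "\<And>Y. Y \<subseteq> E - {e} \<Longrightarrow> spans b e Y = spans r e Y"
  shows "b = r"
proof
  fix X
  interpret b: rank_matroid E b by (rule blockD(1)[OF b])
  interpret r: rank_matroid E r by fact
  have eE: "e \<in> E" using e by (rule suppD)
  show "b X = r X"
  proof (cases "X \<subseteq> E")
    case True
    then have "b X = b (X \<inter> supp E b)" "r X = r (X \<inter> supp E b)"
      using b.restrict_supp r.restrict_supp r(2) by auto
    then show ?thesis
      using port_determines[OF b.rank_matroid_axioms r(1) eE port, of "X \<inter> supp E b"] blockD(3)[OF b e] by auto
  qed (use b.outside r.outside in auto)
qed

lemma block_eqI2:
  assumes b: "block E b" and b': "block E b'" and e: "e \<in> supp E b" "e \<in> supp E b'"
    and port: "\<And>Y. Y \<subseteq> E - {e} \<Longrightarrow> spans b e Y = spans b' e Y"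
  shows "b = b'"
proof -
  have "cls E b e = cls E b' e" using port by (rule cls_cong)
  then show ?thesis using block_eqI[OF b _ _ e(1) port] blockD[OF b] blockD[OF b'] e by auto
qed

section \<open>What \<open>\<rho>\<close> reveals about a decomposition at one element\<close>

context
  fixes E :: "'a set" and \<rho> B
  assumes dec: "decomp E \<rho> B"
begin

lemma decomp_finite: "finite E" "finite B"
  using dec unfolding decomp_def by simp_all

lemma decomp_block: "b \<in> B \<Longrightarrow> block E b"
  using dec unfolding decomp_def by simp

lemma decomp_matroid: "b \<in> B \<Longrightarrow> rank_matroid E b"
  by (rule blockD(1)[OF decomp_block])

lemma decomp_sum: "X \<subseteq> E \<Longrightarrow> \<rho> X = (\<Sum>b\<in>B. b X)"
  using dec unfolding decomp_def by simp

lemma at_finite: "finite (blocks_at E B e)"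
  using decomp_finite unfolding blocks_at_def by simp

text \<open>A block grows by 1 exactly where it fails to span, and never at its loops. As
  \<open>Y\<close> varies, these increments amount to the sum of the ports of the blocks at
  \<open>e\<close>.\<close>

lemma decomp_increment:
  assumes "e \<in> E" "Y \<subseteq> E"
  shows "\<rho> (insert e Y) - \<rho> Y = int (card {b \<in> blocks_at E B e. \<not> spans b e Y})"
proof -
  have "\<rho> (insert e Y) - \<rho> Y = (\<Sum>b\<in>B. b (insert e Y) - b Y)"
    using decomp_sum[of "insert e Y"] decomp_sum[of Y] assms by (simp add: sum_subtractf)
  also have "\<dots> = (\<Sum>b\<in>B. if b \<in> {b \<in> blocks_at E B e. \<not> spans b e Y} then 1 else 0)"
  proof (rule sum.cong)
    fix b assume b: "b \<in> B"
    interpret b: rank_matroid E b using decomp_matroid[OF b] .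
    show "b (insert e Y) - b Y = (if b \<in> {b \<in> blocks_at E B e. \<not> spans b e Y} then 1 else 0)"
      using b.insert_eq[of Y e] b.spans_loop[of e Y] assms b unfolding blocks_at_def by auto
  qed simp
  also have "\<dots> = int (card (B \<inter> {b \<in> blocks_at E B e. \<not> spans b e Y}))"
    using decomp_finite by (subst sum.inter_restrict[symmetric]) auto
  also have "B \<inter> {b \<in> blocks_at E B e. \<not> spans b e Y} = {b \<in> blocks_at E B e. \<not> spans b e Y}"
    unfolding blocks_at_def by auto
  finally show ?thesis .
qed

lemma decomp_empty: "\<rho> {} = 0"
proof -
  have "b {} = 0" if "b \<in> B" for b
    using rank_matroid.empty[OF decomp_matroid[OF that]] .
  then have "(\<Sum>b\<in>B. b {}) = 0" by (intro sum.neutral) blast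
  then show ?thesis using decomp_sum[of "{}"] by simp
qed

lemma card_at:
  assumes "e \<in> E" shows "int (card (blocks_at E B e)) = \<rho> {e}"
proof -
  have "{b \<in> blocks_at E B e. \<not> spans b e {}} = blocks_at E B e"
    using rank_matroid.supp_iff[OF decomp_matroid] unfolding blocks_at_def by auto
  then show ?thesis using decomp_increment[OF assms, of "{}"] decomp_empty by auto
qed

lemma increment_single:
  assumes "e \<in> E" "Y \<subseteq> E" "blocks_at E B e = {b}"
  shows "\<rho> (insert e Y) - \<rho> Y = (if spans b e Y then 0 else 1)"
proof -
  have "{c \<in> blocks_at E B e. \<not> spans c e Y} = (if spans b e Y then {} else {b})" using assms(3) by auto
  then show ?thesis using decomp_increment[OF assms(1,2)] by (simp split: if_splits)
qed

lemma increment_pair: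
  assumes "e \<in> E" "Y \<subseteq> E" "blocks_at E B e = {b, c}" "b \<noteq> c"
  shows "\<rho> (insert e Y) - \<rho> Y = (if spans b e Y then 0 else 1) + (if spans c e Y then 0 else 1)"
proof -
  have "{d \<in> blocks_at E B e. \<not> spans d e Y} = (if spans b e Y then {} else {b}) \<union> (if spans c e Y then {} else {c})"
    using assms(3) by auto
  then show ?thesis using decomp_increment[OF assms(1,2)] assms(4) by (simp split: if_splits)
qed

end

lemma atD: "blocks_at E B e = S \<Longrightarrow> b \<in> S \<Longrightarrow> b \<in> B \<and> e \<in> supp E b"
  unfolding blocks_at_def by auto

lemma card_2_other: "card S = 2 \<Longrightarrow> b \<in> S \<Longrightarrow> \<exists>c. S = {b, c} \<and> b \<noteq> c"
  unfolding card_2_iff by auto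

text \<open>With one block at \<open>e\<close>, the increments of \<open>\<rho>\<close> are the port
  of this block, and the port determines the block.\<close>

lemma at_single_eq:
  assumes "decomp E \<rho> B" "decomp E \<rho> B'" "e \<in> E" "blocks_at E B e = {b}" "blocks_at E B' e = {b'}"
  shows "b = b'"
proof (rule block_eqI2)
  show "block E b" "block E b'" "e \<in> supp E b" "e \<in> supp E b'"
    using assms atD decomp_block by (metis insertI1)+
  show "spans b e Y = spans b' e Y" if "Y \<subseteq> E - {e}" for Y
  proof -
    have "Y \<subseteq> E" using that by auto
    then show ?thesis
      using increment_single[OF assms(1,3) _ assms(4), of Y] increment_single[OF assms(2,3) _ assms(5), of Y]
      by (simp split: if_splits)
  qed
qed

text \<open>The shared block cancels from the increments, which leaves the port of the other
  one.\<close>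

lemma at_other_eq:
  assumes "decomp E \<rho> B" "decomp E \<rho> B'" "e \<in> E" "blocks_at E B e = {b, c}" "blocks_at E B' e = {b, c'}" "b \<noteq> c" "b \<noteq> c'"
  shows "c = c'"
proof (rule block_eqI2)
  show "block E c" "block E c'" "e \<in> supp E c" "e \<in> supp E c'"
    using assms atD decomp_block by (metis insertI1 insert_commute)+
  show "spans c e Y = spans c' e Y" if "Y \<subseteq> E - {e}" for Y
  proof -
    have "Y \<subseteq> E" using that by auto
    then show ?thesis
      using increment_pair[OF assms(1,3) _ assms(4,6), of Y] increment_pair[OF assms(2,3) _ assms(5,7), of Y]
      by (simp split: if_splits)
  qed
qed

lemma at_pair_eq:
  assumes B: "decomp E \<rho> B" "decomp E \<rho> B'" and e: "e \<in> E"
    and p: "blocks_at E B e = {b, c}" "blocks_at E B' e = {b', c'}"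
    and ports: "\<And>Y. Y \<subseteq> E - {e} \<Longrightarrow> spans b e Y = spans b' e Y" "\<And>Y. Y \<subseteq> E - {e} \<Longrightarrow> spans c e Y = spans c' e Y"
  shows "blocks_at E B e = blocks_at E B' e"
proof -
  have "block E b" "block E c" "block E b'" "block E c'"
    "e \<in> supp E b" "e \<in> supp E b'" "e \<in> supp E c" "e \<in> supp E c'"
    using atD[OF p(1)] atD[OF p(2)] decomp_block[OF B(1)] decomp_block[OF B(2)] by auto
  then have "b = b'" "c = c'"
    using block_eqI2[of E b b' e, OF _ _ _ _ ports(1)] block_eqI2[of E c c' e, OF _ _ _ _ ports(2)] by simp_all
  then show ?thesis using p by simp
qed

section \<open>Spreading agreement over a connected ground set\<close>

definition conn :: "'a set \<Rightarrow> ('a set \<Rightarrow> int) \<Rightarrow> bool" where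
  "conn E \<rho> \<longleftrightarrow> (\<forall>A\<subseteq>E. (\<forall>X\<subseteq>E. \<rho> X = \<rho> (X \<inter> A) + \<rho> (X - A)) \<longrightarrow> A = {} \<or> A = E)"

lemma saturated_separator:
  assumes dec: "decomp E \<rho> B" and sat: "\<And>b. b \<in> B \<Longrightarrow> supp E b \<subseteq> A \<or> supp E b \<inter> A = {}" and X: "X \<subseteq> E"
  shows "\<rho> X = \<rho> (X \<inter> A) + \<rho> (X - A)"
proof -
  have "b X = b (X \<inter> A) + b (X - A)" if b: "b \<in> B" for b
  proof -
    interpret b: rank_matroid E b using decomp_matroid[OF dec b] .
    have *: "b Y = 0" if "Y \<subseteq> E" "Y \<inter> supp E b = {}" for Y
      using b.restrict_supp[of "supp E b" Y] that by auto
    show ?thesis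
    proof (cases "supp E b \<subseteq> A")
      case True
      then show ?thesis using b.restrict_supp[OF True X] *[of "X - A"] X by auto
    next
      case False
      then have "supp E b \<subseteq> E - A" using sat[OF b] supp_subset[of E b] by blast
      then have "b X = b (X \<inter> (E - A))" using b.restrict_supp X by blast
      moreover have "X \<inter> (E - A) = X - A" using X by auto
      ultimately show ?thesis using *[of "X \<inter> A"] \<open>supp E b \<subseteq> E - A\<close> X by auto
    qed
  qed
  then show ?thesis
    using decomp_sum[OF dec, of X] decomp_sum[OF dec, of "X \<inter> A"] decomp_sum[OF dec, of "X - A"] X
    by (simp add: sum.distrib[symmetric] le_infI1 Diff_subset subset_trans[OF Diff_subset])
qed

text \<open>The elements at which the two decompositions have the same blocks form a union of
  supports: a block shared at \<open>e\<close> is present in both at every \<open>f\<close> of its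
  support, and a second block at \<open>f\<close> is then forced by \<open>at_other_eq\<close>. A
  union of supports is a separator.\<close>

lemma decomp_at_determines:
  assumes conn: "conn E \<rho>" and two: "\<And>e. e \<in> E \<Longrightarrow> \<rho> {e} \<in> {1, 2}"
    and dec: "decomp E \<rho> B" "decomp E \<rho> B'"
    and e0: "e0 \<in> E" "blocks_at E B e0 = blocks_at E B' e0"
  shows "B = B'"
proof -
  let ?A = "{e \<in> E. blocks_at E B e = blocks_at E B' e}"
  have "supp E b \<subseteq> ?A" if b: "b \<in> B" and meet: "supp E b \<inter> ?A \<noteq> {}" for b
  proof
    fix f assume f: "f \<in> supp E b"
    obtain e where e: "e \<in> supp E b" "blocks_at E B e = blocks_at E B' e" using meet by auto
    then have b': "b \<in> B'" using b unfolding blocks_at_def by auto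
    then have bf: "b \<in> blocks_at E B f" "b \<in> blocks_at E B' f" using b f unfolding blocks_at_def by auto
    have fE: "f \<in> E" using f by (rule suppD)
    have c: "card (blocks_at E B f) = card (blocks_at E B' f)" "card (blocks_at E B f) = 1 \<or> card (blocks_at E B f) = 2"
      using card_at[OF dec(1) fE] card_at[OF dec(2) fE] two[OF fE] by auto
    show "f \<in> ?A"
    proof (cases "card (blocks_at E B f) = 1")
      case True
      then have "blocks_at E B f = {b}" "blocks_at E B' f = {b}" using bf c by (metis card_1_singletonE singletonD)+
      then show ?thesis using fE by auto
    next
      case False
      then have "card (blocks_at E B f) = 2" "card (blocks_at E B' f) = 2" using c by auto
      then obtain z z' where z: "blocks_at E B f = {b, z}" "b \<noteq> z" "blocks_at E B' f = {b, z'}" "b \<noteq> z'"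
        using card_2_other[OF _ bf(1)] card_2_other[OF _ bf(2)] by blast
      then have "z = z'" using at_other_eq[OF dec fE] by blast
      then show ?thesis using z fE by auto
    qed
  qed
  then have "\<rho> X = \<rho> (X \<inter> ?A) + \<rho> (X - ?A)" if "X \<subseteq> E" for X
    using saturated_separator[OF dec(1) _ that] by blast
  moreover have "?A \<subseteq> E" "e0 \<in> ?A" using e0 by auto
  ultimately have A: "?A = E" using conn unfolding conn_def by (metis (no_types, lifting) empty_iff)
  have "C \<subseteq> C'" if C: "decomp E \<rho> C" and eq: "\<forall>e\<in>E. blocks_at E C e = blocks_at E C' e" for C C'
  proof
    fix b assume b: "b \<in> C"
    then obtain e where e: "e \<in> supp E b" using blockD(2)[OF decomp_block[OF C b]] by auto
    then have "b \<in> blocks_at E C e" "e \<in> E" using b e suppD[OF e] unfolding blocks_at_def by auto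
    then show "b \<in> C'" using eq unfolding blocks_at_def by auto
  qed
  then show ?thesis using dec A by blast
qed

section \<open>The components of a matroid as its only decomposition\<close>

lemma decomp_comps:
  assumes r: "rank_matroid E r" shows "decomp E r (comp E r ` supp E r)"
proof -
  interpret rank_matroid E r by fact
  let ?B = "comp E r ` supp E r"
  have fB: "finite ?B" using fin finite_sub[OF supp_sub] by auto
  have blk: "\<forall>b\<in>?B. block E b" using comp_block by auto
  have "r X = (\<Sum>b\<in>?B. b X)" if X: "X \<subseteq> E" for X
  proof (rule increments_eq[where f = r and g = "\<lambda>X. \<Sum>b\<in>?B. b X"])
    show "finite X" using X finite_sub by auto
    show "r {} = (\<Sum>b\<in>?B. b {})"
      using rank_matroid.empty[OF blockD(1)] blk by (subst sum.neutral) auto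
    fix Y e assume Y: "insert e Y \<subseteq> X" "e \<notin> Y"
    have inc: "b (insert e Y) - b Y = (if b = comp E r e \<and> e \<in> supp E r then r (insert e Y) - r Y else 0)"
      if b: "b \<in> ?B" for b
    proof -
      obtain f where f: "f \<in> supp E r" "b = comp E r f" using b by auto
      interpret b: rank_matroid E b using blk b blockD(1) by blast
      have fE: "f \<in> E" using f supp_sub by auto
      show ?thesis
      proof (cases "e \<in> cls E r f")
        case True
        then have "comp E r e = b" using f(2) cls_eq[OF fE True] unfolding comp_def by auto
        moreover have "e \<in> supp E r" using True cls_sub_supp[OF f(1)] by auto
        moreover have "b (insert e Y) - b Y = r (insert e Y) - r Y"
        proof -
          have "Y \<subseteq> E" "e \<in> E" using Y X by auto
          then show ?thesis
            using comp_port[OF fE True, of Y] b.insert_eq[of Y e] insert_eq[of Y e] f by simp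
        qed
        ultimately show ?thesis by auto
      next
        case False
        have "\<not> (b = comp E r e \<and> e \<in> supp E r)"
          using comp_supp[of e] comp_supp[of f] f False by (auto simp: cls_def)
        moreover have "b (insert e Y) = b Y"
          using f False Y X unfolding comp_def by auto
        ultimately show ?thesis by auto
      qed
    qed
    have "(\<Sum>b\<in>?B. b (insert e Y)) - (\<Sum>b\<in>?B. b Y) = (\<Sum>b\<in>?B. b (insert e Y) - b Y)"
      by (simp add: sum_subtractf)
    also have "\<dots> = (\<Sum>b\<in>?B. if b = comp E r e \<and> e \<in> supp E r then r (insert e Y) - r Y else 0)"
      by (rule sum.cong) (use inc in auto)
    also have "\<dots> = (if e \<in> supp E r then r (insert e Y) - r Y else 0)"
      using fB by (auto simp: sum.delta)
    also have "\<dots> = r (insert e Y) - r Y"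
      using spans_loop[of e Y] Y X unfolding spans_def by auto
    finally show "r (insert e Y) - r Y = (\<Sum>b\<in>?B. b (insert e Y)) - (\<Sum>b\<in>?B. b Y)" by simp
  qed
  then show ?thesis unfolding decomp_def using fin fB blk by auto
qed

lemma decomp_matroid_unique:
  assumes r: "rank_matroid E r" and B: "decomp E r B" shows "B = comp E r ` supp E r"
proof -
  interpret rank_matroid E r by fact
  have eq: "blocks_at E B e = {comp E r e}" if e: "e \<in> supp E r" for e
  proof -
    have eE: "e \<in> E" using e supp_sub by auto
    have at1: "\<exists>b. blocks_at E C e = {b}" if "decomp E r C" for C
      using card_at[OF that eE] supp_rank[OF e] by (metis card_1_singletonE of_nat_eq_1_iff)
    obtain b where b: "blocks_at E B e = {b}" using at1[OF B] by auto
    obtain c where c: "blocks_at E (comp E r ` supp E r) e = {c}" using at1[OF decomp_comps[OF r]] by auto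
    moreover have "comp E r e \<in> blocks_at E (comp E r ` supp E r) e"
      using e comp_supp[OF e] unfolding blocks_at_def by (auto simp: cls_def)
    ultimately show ?thesis using at_single_eq[OF B decomp_comps[OF r] eE b c] b by auto
  qed
  show ?thesis
  proof
    show "comp E r ` supp E r \<subseteq> B"
    proof
      fix b assume "b \<in> comp E r ` supp E r"
      then obtain e where "b \<in> blocks_at E B e" using eq by blast
      then show "b \<in> B" unfolding blocks_at_def by simp
    qed
    show "B \<subseteq> comp E r ` supp E r"
    proof
      fix b assume b: "b \<in> B"
      then obtain e where e: "e \<in> supp E b" using blockD(2)[OF decomp_block[OF B b]] by auto
      then have b': "b \<in> blocks_at E B e" "e \<in> E" using b e suppD[OF e] unfolding blocks_at_def by auto
      then have "card (blocks_at E B e) \<noteq> 0" using at_finite[OF B] by auto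
      then have "e \<in> supp E r" using card_at[OF B b'(2)] b'(2) unfolding supp_def by auto
      then show "b \<in> comp E r ` supp E r" using eq[of e] b'(1) by blast
    qed
  qed
qed

section \<open>Two decompositions at a common element\<close>

lemma sum_01_eq_1:
  fixes q :: "'b \<Rightarrow> int"
  assumes "finite B" "\<And>b. b \<in> B \<Longrightarrow> q b \<in> {0, 1}" "(\<Sum>b\<in>B. q b) = 1"
  shows "\<exists>c\<in>B. q c = 1 \<and> (\<forall>b\<in>B. b \<noteq> c \<longrightarrow> q b = 0)"
proof -
  obtain c where c: "c \<in> B" "q c \<noteq> 0" using assms(3) by (metis sum.neutral zero_neq_one)
  have q1: "q c = 1" using assms(2)[OF c(1)] c(2) by auto
  have "(\<Sum>b\<in>B - {c}. q b) = 0" using assms(1,3) c(1) q1 by (simp add: sum_diff1)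
  moreover have "\<forall>b\<in>B - {c}. 0 \<le> q b" using assms(2) by force
  ultimately have "\<forall>b\<in>B - {c}. q b = 0" using assms(1) by (subst (asm) sum_nonneg_eq_0_iff) auto
  then show ?thesis using c(1) q1 by auto
qed

text \<open>This mixed second difference is additive over blocks, so its total is the same for any
  two decompositions. In a single matroid it is 0 or 1 and detects whether \<open>X\<close> makes
  \<open>f\<close> spanned over \<open>W\<close>.\<close>

lemma (in rank_matroid) drop_eq:
  assumes "W \<subseteq> E" "X \<subseteq> E" "f \<in> E"
  shows "r (X \<union> W) + r (insert f W) - r (insert f (X \<union> W)) - r W
           = (if \<not> spans r f W \<and> spans r f (X \<union> W) then 1 else 0)"
proof -
  have "spans r f W \<Longrightarrow> spans r f (X \<union> W)" using assms by (intro spans_mono[of f W "X \<union> W"]) auto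
  then show ?thesis using insert_eq[of W f] insert_eq[of "X \<union> W" f] assms by auto
qed

text \<open>The flip of \<open>e\<close> caused by \<open>f\<close> is seen by a single block of \<open>B\<close> on all of \<open>P\<close>, hence by a single
  block of \<open>B'\<close>; after contracting \<open>W\<close> the two blocks have the same circuits through \<open>f\<close> in \<open>P \<union> {f}\<close>
  and therefore agree at \<open>e\<close>.\<close>

lemma flip_transfer:
  assumes B: "decomp E \<rho> B" and B': "decomp E \<rho> B'"
    and P: "P = supp E b1 \<inter> supp E b2" and T: "T = supp E b1 - supp E b2"
    and atP: "\<And>p. p \<in> P \<Longrightarrow> blocks_at E B p = {b1, b2}" and ne: "b1 \<noteq> b2"
    and e: "e \<in> P" and W: "W \<subseteq> T" and f: "f \<in> T - W"
    and X0: "X0 \<subseteq> P - {e}" "\<not> spans b1 e (X0 \<union> W)" "spans b1 e (insert f (X0 \<union> W))"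
  shows "\<exists>c\<in>blocks_at E B' e. \<forall>X\<subseteq>P - {e}. spans b1 e (X \<union> W) = spans c e (X \<union> W)
           \<and> spans b1 e (insert f (X \<union> W)) = spans c e (insert f (X \<union> W))"
proof -
  have sub: "P \<subseteq> E" "T \<subseteq> E" "W \<subseteq> E" "f \<in> E" "e \<in> E" "f \<notin> P" "P \<inter> T = {}" "f \<noteq> e"
    using P T W f e supp_subset[of E] by auto
  have b12: "b1 \<in> B" "b2 \<in> B" using atP[OF e] unfolding blocks_at_def by auto
  define q where "q b X = b (X \<union> W) + b (insert f W) - b (insert f (X \<union> W)) - b W"
    for b :: "'a set \<Rightarrow> int" and X
  interpret b1: rank_matroid E b1 by (rule decomp_matroid[OF B b12(1)])
  have qval: "q b X = (if \<not> spans b f W \<and> spans b f (X \<union> W) then 1 else 0)"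
    if "rank_matroid E b" "X \<subseteq> P" for b X
    using rank_matroid.drop_eq[OF that(1), of W X f] that(2) sub unfolding q_def by auto
  \<comment> \<open>\<open>b2\<close> sees neither \<open>f\<close> nor \<open>W\<close>, and a
    third block has no element in \<open>P\<close>. In both cases the second difference
    collapses.\<close>
  have zero: "q b X = 0" if b: "b \<in> B" "b \<noteq> b1" and X: "X \<subseteq> P" for b X
  proof -
    interpret b: rank_matroid E b by (rule decomp_matroid[OF B b(1)])
    have r: "b Y = b (Y \<inter> supp E b)" if "Y \<subseteq> E" for Y using b.restrict_supp[OF order_refl that] .
    have XE: "X \<union> W \<subseteq> E" "insert f W \<subseteq> E" "insert f (X \<union> W) \<subseteq> E" "W \<subseteq> E" using X sub by auto
    show ?thesis
    proof (cases "b = b2")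
      case True
      have "(X \<union> W) \<inter> supp E b = X \<inter> supp E b" "insert f W \<inter> supp E b = {}" "W \<inter> supp E b = {}"
        "insert f (X \<union> W) \<inter> supp E b = X \<inter> supp E b" using True W f T by auto
      then show ?thesis using r[OF XE(1)] r[OF XE(2)] r[OF XE(3)] r[OF XE(4)] unfolding q_def by simp
    next
      case False
      have "X \<inter> supp E b = {}"
      proof (rule ccontr)
        assume "X \<inter> supp E b \<noteq> {}"
        then obtain p where "p \<in> X" "p \<in> supp E b" by auto
        then have "b \<in> blocks_at E B p" "p \<in> P" using b X unfolding blocks_at_def by auto
        then show False using atP b False by auto
      qed
      then have "(X \<union> W) \<inter> supp E b = W \<inter> supp E b"
        "insert f (X \<union> W) \<inter> supp E b = insert f W \<inter> supp E b" by auto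
      then show ?thesis using r[OF XE(1)] r[OF XE(2)] r[OF XE(3)] r[OF XE(4)] unfolding q_def by simp
    qed
  qed
  have sumq: "(\<Sum>b\<in>C. q b X) = \<rho> (X \<union> W) + \<rho> (insert f W) - \<rho> (insert f (X \<union> W)) - \<rho> W"
    if "decomp E \<rho> C" "X \<subseteq> P" for C X
  proof -
    have "X \<union> W \<subseteq> E" "insert f W \<subseteq> E" "insert f (X \<union> W) \<subseteq> E" "W \<subseteq> E" using that(2) sub by auto
    then show ?thesis
      using decomp_sum[OF that(1)] unfolding q_def by (simp add: sum.distrib sum_subtractf)
  qed
  have sumB: "(\<Sum>b\<in>B. q b X) = q b1 X" if "X \<subseteq> P" for X
  proof -
    have "(\<Sum>b\<in>B. q b X) = q b1 X + (\<Sum>b\<in>B - {b1}. q b X)"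
      using decomp_finite[OF B] b12 by (simp add: sum.remove)
    also have "(\<Sum>b\<in>B - {b1}. q b X) = 0" using zero that by (intro sum.neutral) auto
    finally show ?thesis by simp
  qed
  have X0E: "X0 \<union> W \<subseteq> E - {e, f}" using X0 sub W e f by auto
  have fl: "spans b1 f (insert e (X0 \<union> W))" "\<not> spans b1 f (X0 \<union> W)"
    using b1.flip_sym[OF X0E sub(5,4) sub(8)[symmetric] X0(3,2)] by auto
  have X0W: "X0 \<union> W \<subseteq> E" "insert e (X0 \<union> W) \<subseteq> P \<union> W" "P \<union> W \<subseteq> E" using X0E X0(1) e sub by auto
  have nW: "\<not> spans b1 f W" using fl(2) b1.spans_mono[OF _ _ X0W(1) sub(4), of W] by auto
  have "spans b1 f (P \<union> W)" by (rule b1.spans_mono[OF fl(1) X0W(2,3) sub(4)])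
  then have "q b1 P = 1" using qval[of b1 P] nW b1.rank_matroid_axioms by auto
  then have "(\<Sum>b\<in>B'. q b P) = 1" using sumq[OF B, of P] sumq[OF B', of P] sumB[of P] by simp
  moreover have "q b P \<in> {0, 1}" if "b \<in> B'" for b using qval[OF decomp_matroid[OF B' that], of P] by auto
  ultimately obtain c where c: "c \<in> B'" "q c P = 1" "\<forall>b\<in>B'. b \<noteq> c \<longrightarrow> q b P = 0"
    using sum_01_eq_1[of B' "\<lambda>b. q b P"] decomp_finite[OF B'] by auto
  interpret c: rank_matroid E c by (rule decomp_matroid[OF B' c(1)])
  have nWc: "\<not> spans c f W" using qval[of c P] c(2) c.rank_matroid_axioms by (auto split: if_splits)
  \<comment> \<open>Spanning is monotone, so a term that is 0 at \<open>P\<close> is 0 at every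
    subset of \<open>P\<close>. Hence the same \<open>c\<close> serves for all
    \<open>X\<close>.\<close>
  have "q b X = 0" if b: "b \<in> B'" "b \<noteq> c" and X: "X \<subseteq> P" for b X
  proof -
    interpret b: rank_matroid E b by (rule decomp_matroid[OF B' b(1)])
    have "q b P = 0" using c(3) b by auto
    then have "spans b f W \<or> \<not> spans b f (P \<union> W)" using qval[of b P] b.rank_matroid_axioms by (auto split: if_splits)
    then have "spans b f W \<or> \<not> spans b f (X \<union> W)"
      using b.spans_mono[OF _ _ X0W(3) sub(4), of "X \<union> W"] X by auto
    then show ?thesis using qval[of b X] b.rank_matroid_axioms X by auto
  qed
  then have "(\<Sum>b\<in>B' - {c}. q b X) = 0" if "X \<subseteq> P" for X using that by (intro sum.neutral) auto
  then have "q c X = q b1 X" if "X \<subseteq> P" for X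
    using sumq[OF B that] sumq[OF B' that] sumB[OF that] that decomp_finite[OF B'] c(1)
    by (simp add: sum.remove)
  then have port: "spans b1 f (X \<union> W) = spans c f (X \<union> W)" if "X \<subseteq> P" for X
    using qval[OF b1.rank_matroid_axioms that] qval[OF c.rank_matroid_axioms that] that nW nWc
    by (auto split: if_splits)
  \<comment> \<open>Contracting \<open>W\<close> and restricting to \<open>P\<close> and
    \<open>f\<close> turns the equality at \<open>f\<close> into equal ports of two matroids. The
    flip \<open>X0\<close> shows that \<open>f\<close> and \<open>e\<close> lie in one component
    there.\<close>
  let ?F = "insert f P"
  have FE: "?F \<subseteq> E" using sub by auto
  have m: "rank_matroid ?F (minor ?F W b1)" "rank_matroid ?F (minor ?F W c)"
    using b1.minor_matroid[OF FE sub(3)] c.minor_matroid[OF FE sub(3)] by auto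
  have mport: "spans (minor ?F W b1) f Y = spans (minor ?F W c) f Y" if "Y \<subseteq> ?F - {f}" for Y
  proof -
    have "Y \<subseteq> P" "insert f Y \<subseteq> ?F" using that by auto
    then show ?thesis using spans_minor[of f Y ?F W] port by simp
  qed
  have "linked ?F (minor ?F W b1) f e"
    unfolding linked_def
  proof (intro conjI exI[of _ X0])
    have "spans (minor ?F W b1) f (insert e X0) = spans b1 f (insert e X0 \<union> W)"
      using X0 e by (intro spans_minor) auto
    then show "spans (minor ?F W b1) f (insert e X0)" using fl(1) by simp
    have "spans (minor ?F W b1) f X0 = spans b1 f (X0 \<union> W)"
      using X0 by (intro spans_minor) auto
    then show "\<not> spans (minor ?F W b1) f X0" using fl(2) by simp
    show "f \<noteq> e" "X0 \<subseteq> ?F - {f, e}" using X0 sub by auto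
  qed
  then have ecls: "e \<in> cls ?F (minor ?F W b1) f" using e unfolding cls_def by auto
  have tr: "spans b1 e (Y \<union> W) = spans c e (Y \<union> W)" if "Y \<subseteq> ?F" for Y
    using port_transfer[OF m _ mport ecls that] spans_minor[of e Y ?F W] that e by auto
  show ?thesis
  proof (intro bexI[of _ c] allI impI conjI)
    fix X assume X: "X \<subseteq> P - {e}"
    then show "spans b1 e (X \<union> W) = spans c e (X \<union> W)" by (intro tr) auto
    have "insert f X \<subseteq> ?F" using X by auto
    then show "spans b1 e (insert f (X \<union> W)) = spans c e (insert f (X \<union> W))" using tr[of "insert f X"] by simp
  next
    have "\<not> spans c e (X0 \<union> W)" using tr[of X0] X0 by auto
    then have "e \<in> supp E c" using c.spans_loop[OF sub(5) _ X0W(1)] by auto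
    then show "c \<in> blocks_at E B' e" using c(1) unfolding blocks_at_def by auto
  qed
qed

text \<open>Connectedness of \<open>b1\<close> links \<open>e\<close> to some \<open>t\<close>
  outside the support of \<open>b2\<close>. The linking set is cut down to the common support, and
  all elements private to \<open>b1\<close> are added for the spanning half of the claim.\<close>

lemma flip_exists:
  assumes b: "block E b1" and e: "e \<in> supp E b1 \<inter> supp E b2" and T: "supp E b1 - supp E b2 \<noteq> {}"
  shows "\<exists>X \<subseteq> supp E b1 \<inter> supp E b2 - {e}. spans b1 e (X \<union> (supp E b1 - supp E b2)) \<and> \<not> spans b1 e X"
proof -
  interpret b: rank_matroid E b1 by (rule blockD(1)[OF b])
  obtain t where t: "t \<in> supp E b1" "t \<notin> supp E b2" using T by auto
  have e1: "e \<in> supp E b1" "e \<in> E" "t \<in> E" "t \<noteq> e" using e t suppD by auto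
  then have "linked E b1 e t" using blockD(3)[OF b e1(1)] t unfolding cls_def by auto
  then obtain Y where Y: "Y \<subseteq> E - {e, t}" "spans b1 e (insert t Y)" "\<not> spans b1 e Y"
    unfolding linked_def by auto
  let ?X = "Y \<inter> (supp E b1 \<inter> supp E b2)"
  have "\<not> spans b1 e ?X" using Y e1 b.spans_mono[of e ?X Y] by auto
  moreover have "spans b1 e (insert t Y \<inter> supp E b1)"
    using Y e1 b.spans_restrict_supp[OF order_refl, of "insert t Y" e] by auto
  then have "spans b1 e (?X \<union> (supp E b1 - supp E b2))"
    using Y e1 t supp_subset[of E b1]
    by (intro b.spans_mono[of e "insert t Y \<inter> supp E b1" "?X \<union> (supp E b1 - supp E b2)"]) auto
  ultimately show ?thesis using Y by (intro exI[of _ ?X]) auto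
qed

text \<open>Each \<open>W\<close> defines a level of the port of \<open>e\<close> in
  \<open>b1\<close>, namely the sets spanning \<open>e\<close> together with \<open>W\<close>.
  Levels grow with \<open>W\<close> and are not constant by \<open>flip_exists\<close>, so every
  level is attained at some \<open>W\<close> where one further or one fewer element changes it, and
  there \<open>flip_transfer\<close> supplies \<open>c\<close>. Only \<open>b1\<close> is known to
  have the same level at \<open>W\<close> and \<open>W0\<close>; the comparison with
  \<open>c\<close> is made at \<open>W\<close>.\<close>

lemma level_transfer:
  assumes B: "decomp E \<rho> B" and B': "decomp E \<rho> B'"
    and P: "P = supp E b1 \<inter> supp E b2" and T: "T = supp E b1 - supp E b2"
    and atP: "\<And>p. p \<in> P \<Longrightarrow> blocks_at E B p = {b1, b2}" and ne: "b1 \<noteq> b2"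
    and e: "e \<in> P" and Tne: "T \<noteq> {}" and W0: "W0 \<subseteq> T"
  shows "\<exists>W\<subseteq>T. \<exists>c\<in>blocks_at E B' e. \<forall>X\<subseteq>P - {e}.
           spans b1 e (X \<union> W0) = spans b1 e (X \<union> W) \<and> spans b1 e (X \<union> W) = spans c e (X \<union> W)"
proof -
  have b1: "b1 \<in> B" using atP[OF e] unfolding blocks_at_def by auto
  interpret b1: rank_matroid E b1 by (rule decomp_matroid[OF B b1])
  have sub: "P \<subseteq> E" "T \<subseteq> E" "e \<in> E"
    using P T e supp_subset[of E] by auto
  have fT: "finite T" using sub b1.finite_sub by auto
  define G where "G W = {X. X \<subseteq> P - {e} \<and> spans b1 e (X \<union> W)}" for W
  have Gmono: "G W \<subseteq> G W'" if "W \<subseteq> W'" "W' \<subseteq> T" for W W'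
  proof
    fix X assume "X \<in> G W"
    then have "X \<subseteq> P - {e}" "spans b1 e (X \<union> W)" unfolding G_def by auto
    moreover from this have "spans b1 e (X \<union> W')"
      using that sub by (intro b1.spans_mono[of e "X \<union> W" "X \<union> W'"]) auto
    ultimately show "X \<in> G W'" unfolding G_def by auto
  qed
  have Geq: "G W = G W' \<longleftrightarrow> (\<forall>X\<subseteq>P - {e}. spans b1 e (X \<union> W) = spans b1 e (X \<union> W'))" for W W'
    unfolding G_def by blast
  have step: "\<exists>c\<in>blocks_at E B' e. \<forall>X\<subseteq>P - {e}. spans b1 e (X \<union> W) = spans c e (X \<union> W)
           \<and> spans b1 e (insert f (X \<union> W)) = spans c e (insert f (X \<union> W))"
    if W: "W \<subseteq> T" and f: "f \<in> T - W" and neq: "G W \<noteq> G (insert f W)" for W f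
  proof -
    obtain X0 where X0: "X0 \<in> G (insert f W)" "X0 \<notin> G W"
      using Gmono[of W "insert f W"] W f neq by blast
    show ?thesis
      by (rule flip_transfer[OF B B' P T atP ne e W f, of X0]) (use X0 in \<open>auto simp: G_def\<close>)
  qed
  show ?thesis
  proof (cases "G W0 = G {}")
    case False
    \<comment> \<open>Above the lowest level: shrink \<open>W0\<close> within its level until
      deleting any element lowers the level.\<close>
    let ?Q = "\<lambda>W. W \<subseteq> W0 \<and> G W = G W0"
    obtain W where W: "?Q W" and minW: "\<And>W'. ?Q W' \<Longrightarrow> card W \<le> card W'"
      using ex_has_least_nat[of ?Q W0 card] by blast
    have WT: "W \<subseteq> T" using W W0 by blast
    have fW: "finite W" by (rule finite_subset[OF WT fT])
    have "W \<noteq> {}" using W False by metis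
    then obtain f where f: "f \<in> W" by blast
    have "\<not> ?Q (W - {f})" using minW[of "W - {f}"] f fW by (metis card_Diff1_less linorder_not_less)
    then have neq: "G (W - {f}) \<noteq> G (insert f (W - {f}))" using W f by (auto simp: insert_absorb)
    obtain c where c: "c \<in> blocks_at E B' e"
      "\<forall>X\<subseteq>P - {e}. spans b1 e (insert f (X \<union> (W - {f}))) = spans c e (insert f (X \<union> (W - {f})))"
      using step[OF _ _ neq] WT f by blast
    have "insert f (X \<union> (W - {f})) = X \<union> W" for X using f by auto
    then have "\<forall>X\<subseteq>P - {e}. spans b1 e (X \<union> W) = spans c e (X \<union> W)" using c(2) by simp
    moreover have "\<forall>X\<subseteq>P - {e}. spans b1 e (X \<union> W) = spans b1 e (X \<union> W0)"
      using W Geq[of W W0] by simp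
    ultimately show ?thesis using c(1) WT by (intro exI[of _ W] conjI bexI[of _ c]) simp_all
  next
    case True
    \<comment> \<open>At the lowest level: enlarge \<open>W\<close> within the level as far as
      possible. It stays short of \<open>T\<close>, whose level is higher.\<close>
    let ?Q = "\<lambda>W. W \<subseteq> T \<and> G W = G W0"
    have "\<forall>W. ?Q W \<longrightarrow> card W \<le> card T" using fT card_mono by auto
    moreover have "?Q W0" using W0 by simp
    ultimately have "\<exists>W. ?Q W \<and> (\<forall>W'. ?Q W' \<longrightarrow> card W' \<le> card W)"
      by (intro ex_has_greatest_nat[of ?Q W0 card "Suc (card T)"]) (simp_all add: less_Suc_eq_le)
    then obtain W where W: "?Q W" and maxW: "\<And>W'. ?Q W' \<Longrightarrow> card W' \<le> card W" by metis
    have "\<exists>X \<subseteq> P - {e}. spans b1 e (X \<union> T) \<and> \<not> spans b1 e X"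
      using flip_exists[OF decomp_block[OF B b1], of e b2] e Tne unfolding P T by auto
    then have "G T \<noteq> G {}" unfolding Geq by auto
    then have "W \<noteq> T" using W True by metis
    then obtain f where f: "f \<in> T" "f \<notin> W" using W by blast
    have fW: "finite W" by (rule finite_subset[OF _ fT]) (use W in simp)
    have "\<not> ?Q (insert f W)" using maxW[of "insert f W"] f fW by auto
    then have neq: "G W \<noteq> G (insert f W)" using W f by auto
    have "W \<subseteq> T" "f \<in> T - W" using W f by auto
    from step[OF this neq] obtain c where c: "c \<in> blocks_at E B' e"
      "\<forall>X\<subseteq>P - {e}. spans b1 e (X \<union> W) = spans c e (X \<union> W)" by auto
    moreover have "\<forall>X\<subseteq>P - {e}. spans b1 e (X \<union> W) = spans b1 e (X \<union> W0)"
      using W Geq[of W W0] by simp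
    ultimately show ?thesis using W by (intro exI[of _ W] conjI bexI[of _ c]) simp_all
  qed
qed

section \<open>Where a rival puts the sets on which two ports differ\<close>

context
  fixes E :: "'a set" and \<rho> B B' b1 b2 c1 c2 P T e
  assumes B: "decomp E \<rho> B" and B': "decomp E \<rho> B'"
    and P: "P = supp E b1 \<inter> supp E b2" and T: "T = supp E b1 - supp E b2"
    and atP: "\<And>p. p \<in> P \<Longrightarrow> blocks_at E B p = {b1, b2}" and ne: "b1 \<noteq> b2"
    and e: "e \<in> P" and ate': "blocks_at E B' e = {c1, c2}" and ne': "c1 \<noteq> c2"
begin

lemma port_count:
  assumes "Y \<subseteq> E"
  shows "(if spans b1 e Y then 0 else 1) + (if spans b2 e Y then 0 else (1::int))
           = (if spans c1 e Y then 0 else 1) + (if spans c2 e Y then 0 else 1)"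
proof -
  have "e \<in> E" using e suppD[of e E b1] unfolding P by simp
  then show ?thesis
    using increment_pair[OF B _ assms atP[OF e] ne] increment_pair[OF B' _ assms ate' ne'] by simp
qed

text \<open>The level of all of \<open>T\<close> is used. Adding \<open>T\<close> does not change
  what \<open>b2\<close> spans, so at \<open>Y \<union> T\<close> exactly one of \<open>c1\<close>,
  \<open>c2\<close> spans \<open>e\<close>, and the level tells which. The other one then cannot
  span \<open>e\<close> from the smaller set \<open>Y\<close>, and the count at \<open>Y\<close>
  gives the claim.\<close>

lemma upper_part:
  assumes "T \<noteq> {}"
  shows "\<exists>c\<in>{c1, c2}. \<forall>Y\<subseteq>E - {e}. spans b1 e Y \<and> \<not> spans b2 e Y \<longrightarrow> spans c e Y"
proof -
  have bB: "b1 \<in> B" "b2 \<in> B" "c1 \<in> B'" "c2 \<in> B'" using atP[OF e] ate' unfolding blocks_at_def by auto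
  interpret b1: rank_matroid E b1 by (rule decomp_matroid[OF B bB(1)])
  interpret b2: rank_matroid E b2 by (rule decomp_matroid[OF B bB(2)])
  have sub: "P \<subseteq> E" "T \<subseteq> E" "e \<in> E" "e \<in> supp E b1" "e \<in> supp E b2"
    using P T e supp_subset[of E] by auto
  obtain W c where W: "W \<subseteq> T" and c: "c \<in> {c1, c2}"
    and lev: "\<And>X. X \<subseteq> P - {e} \<Longrightarrow> spans b1 e (X \<union> T) = spans b1 e (X \<union> W) \<and> spans b1 e (X \<union> W) = spans c e (X \<union> W)"
    using level_transfer[OF B B' P T atP ne e assms order_refl] ate' by auto
  define d where "d = (if c = c1 then c2 else c1)"
  have cd: "{c, d} = {c1, c2}" "c \<noteq> d" "c \<in> B'" "d \<in> B'" using c ne' bB unfolding d_def by auto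
  interpret c: rank_matroid E c by (rule decomp_matroid[OF B' cd(3)])
  interpret d: rank_matroid E d by (rule decomp_matroid[OF B' cd(4)])
  have one: "spans c e Y \<longleftrightarrow> \<not> spans d e Y" if "Y \<subseteq> E" "spans b1 e Y" "\<not> spans b2 e Y" for Y
    using port_count[OF that(1)] that cd(1,2) c ne' unfolding d_def by (auto split: if_splits)
  show ?thesis
  proof (intro bexI[of _ c] allI impI)
    fix Y assume Y: "Y \<subseteq> E - {e}" and AY: "spans b1 e Y \<and> \<not> spans b2 e Y"
    let ?X = "Y \<inter> P"
    have XP: "?X \<subseteq> P - {e}" using Y by auto
    have "spans b1 e (Y \<inter> supp E b1)"
      using AY Y sub b1.spans_restrict_supp[OF order_refl, of Y e] by auto
    then have "spans b1 e (?X \<union> T)" using Y sub P T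
      by (intro b1.spans_mono[of e "Y \<inter> supp E b1" "?X \<union> T"]) auto
    then have XW: "spans c e (?X \<union> W)" using lev[OF XP] by auto
    have nb2: "\<not> spans b2 e (Y \<union> T)"
    proof
      assume "spans b2 e (Y \<union> T)"
      then have "spans b2 e ((Y \<union> T) \<inter> supp E b2)"
        using Y sub b2.spans_restrict_supp[OF order_refl, of "Y \<union> T" e] by auto
      then have "spans b2 e Y" using Y sub T
        by (intro b2.spans_mono[of e "(Y \<union> T) \<inter> supp E b2" Y]) auto
      then show False using AY by auto
    qed
    have b1YT: "spans b1 e (Y \<union> T)" using AY Y sub by (intro b1.spans_mono[of e Y "Y \<union> T"]) auto
    have "spans c e (Y \<union> T)" using XW Y sub W by (intro c.spans_mono[of e "?X \<union> W" "Y \<union> T"]) auto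
    then have "\<not> spans d e (Y \<union> T)" using one[OF _ b1YT nb2] Y sub by auto
    then have "\<not> spans d e Y" using d.spans_mono[of e Y "Y \<union> T"] Y sub by auto
    then show "spans c e Y" using one[of Y] AY Y by auto
  qed (use c in auto)
qed

text \<open>With nested supports no element is private to \<open>b2\<close>, so the level of the
  empty set takes over: the block it yields fails to span \<open>e\<close> from the part of
  \<open>Y\<close> in \<open>P\<close>, and the count hands that part to the other block.\<close>

lemma lower_part:
  assumes "T \<noteq> {}" and sub2: "supp E b2 \<subseteq> supp E b1"
  shows "\<exists>c\<in>{c1, c2}. \<forall>Y\<subseteq>E - {e}. spans b2 e Y \<and> \<not> spans b1 e Y \<longrightarrow> spans c e Y"
proof -
  have bB: "b1 \<in> B" "b2 \<in> B" "c1 \<in> B'" "c2 \<in> B'" using atP[OF e] ate' unfolding blocks_at_def by auto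
  interpret b1: rank_matroid E b1 by (rule decomp_matroid[OF B bB(1)])
  interpret b2: rank_matroid E b2 by (rule decomp_matroid[OF B bB(2)])
  have sub: "P \<subseteq> E" "T \<subseteq> E" "e \<in> E" "e \<in> supp E b1" "e \<in> supp E b2" "P = supp E b2"
    using P T e supp_subset[of E] sub2 by auto
  obtain W d where W: "W \<subseteq> T" and d: "d \<in> {c1, c2}"
    and lev: "\<And>X. X \<subseteq> P - {e} \<Longrightarrow> spans b1 e X = spans b1 e (X \<union> W) \<and> spans b1 e (X \<union> W) = spans d e (X \<union> W)"
    using level_transfer[OF B B' P T atP ne e assms(1) empty_subsetI] ate' by auto
  define c where "c = (if d = c1 then c2 else c1)"
  have cd: "{c, d} = {c1, c2}" "c \<noteq> d" "c \<in> B'" "d \<in> B'" using d ne' bB unfolding c_def by auto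
  interpret c: rank_matroid E c by (rule decomp_matroid[OF B' cd(3)])
  interpret d: rank_matroid E d by (rule decomp_matroid[OF B' cd(4)])
  have one: "spans c e Y \<longleftrightarrow> \<not> spans d e Y" if "Y \<subseteq> E" "spans b2 e Y" "\<not> spans b1 e Y" for Y
    using port_count[OF that(1)] that cd(1,2) d ne' unfolding c_def by (auto split: if_splits)
  show ?thesis
  proof (intro bexI[of _ c] allI impI)
    fix Y assume Y: "Y \<subseteq> E - {e}" and AY: "spans b2 e Y \<and> \<not> spans b1 e Y"
    let ?X = "Y \<inter> P"
    have XP: "?X \<subseteq> P - {e}" "?X \<subseteq> E" using Y by auto
    have b2X: "spans b2 e ?X" using AY Y sub b2.spans_restrict_supp[OF order_refl, of Y e] by auto
    have b1X: "\<not> spans b1 e ?X" using AY Y sub b1.spans_mono[of e ?X Y] by auto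
    then have "\<not> spans d e (?X \<union> W)" using lev[OF XP(1)] by auto
    moreover have "?X \<union> W \<subseteq> E" using XP(2) W sub(2) by (meson Un_least order_trans)
    ultimately have "\<not> spans d e ?X" using d.spans_mono[of e ?X "?X \<union> W"] sub(3) by auto
    then have "spans c e ?X" using one[OF XP(2) b2X b1X] by auto
    then show "spans c e Y" using Y sub c.spans_mono[of e ?X Y] by auto
  qed (use cd in auto)
qed

end

definition join_meet :: "'a set \<Rightarrow> 'a \<Rightarrow> ('a set \<Rightarrow> int) \<Rightarrow> ('a set \<Rightarrow> int) \<Rightarrow> ('a set \<Rightarrow> int) \<Rightarrow> ('a set \<Rightarrow> int) \<Rightarrow> bool" where
  "join_meet E e b1 b2 c d \<longleftrightarrow> (\<forall>Y\<subseteq>E - {e}. spans c e Y = (spans b1 e Y \<or> spans b2 e Y)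
      \<and> spans d e Y = (spans b1 e Y \<and> spans b2 e Y))"

text \<open>By \<open>upper_part\<close> and \<open>lower_part\<close>, each of the two families of
  sets that span \<open>e\<close> in exactly one of \<open>b1\<close>, \<open>b2\<close> goes to a
  single block of \<open>B'\<close>. Different receivers reproduce the pair; a common receiver is
  the join, and its companion the meet.\<close>

lemma exchange_at:
  assumes B: "decomp E \<rho> B" and B': "decomp E \<rho> B'" and two: "\<And>p. p \<in> E \<Longrightarrow> \<rho> {p} = 2"
    and e: "e \<in> E" and b: "blocks_at E B e = {b1, b2}" "b1 \<noteq> b2" and S: "supp E b1 \<noteq> supp E b2"
  shows "blocks_at E B e = blocks_at E B' e \<or>
    (\<exists>c d. blocks_at E B' e = {c, d} \<and> c \<noteq> d \<and> join_meet E e b1 b2 c d)"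
proof -
  have bB: "b1 \<in> B" "b2 \<in> B" "e \<in> supp E b1 \<inter> supp E b2" using b unfolding blocks_at_def by auto
  have c2: "card (blocks_at E B p) = 2" "card (blocks_at E B' p) = 2" if "p \<in> E" for p
    using card_at[OF B that] card_at[OF B' that] two[OF that] by auto
  have atP: "blocks_at E B p = {b1, b2}" if "p \<in> supp E b1 \<inter> supp E b2" for p
  proof -
    have "p \<in> E" using that suppD by auto
    have "{b1, b2} \<subseteq> blocks_at E B p" using that bB unfolding blocks_at_def by auto
    moreover have "finite (blocks_at E B p)" by (rule at_finite[OF B])
    moreover have "card {b1, b2} = card (blocks_at E B p)" using c2[OF \<open>p \<in> E\<close>] b(2) by auto
    ultimately show ?thesis by (metis card_subset_eq)
  qed
  then have atP': "blocks_at E B p = {b2, b1}" if "p \<in> supp E b2 \<inter> supp E b1" for p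
    using that by (metis inf_commute insert_commute)
  obtain c1 c2 where c: "blocks_at E B' e = {c1, c2}" "c1 \<noteq> c2"
    using c2(2)[OF e] unfolding card_2_iff by auto
  have bB': "e \<in> supp E b2 \<inter> supp E b1" using bB by auto
  note up = upper_part[OF B B' refl refl atP b(2) bB(3) c]
    and lo = lower_part[OF B B' refl refl atP b(2) bB(3) c]
    and up' = upper_part[OF B B' refl refl atP' b(2)[symmetric] bB' c]
    and lo' = lower_part[OF B B' refl refl atP' b(2)[symmetric] bB' c]
  have "(\<exists>c\<in>{c1, c2}. \<forall>Y\<subseteq>E - {e}. spans b1 e Y \<and> \<not> spans b2 e Y \<longrightarrow> spans c e Y)
      \<and> (\<exists>c\<in>{c1, c2}. \<forall>Y\<subseteq>E - {e}. spans b2 e Y \<and> \<not> spans b1 e Y \<longrightarrow> spans c e Y)"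
  proof (cases "supp E b1 \<subseteq> supp E b2")
    case True
    then have "supp E b2 - supp E b1 \<noteq> {}" using S by auto
    then show ?thesis using up' lo' True by blast
  next
    case n1: False
    then have ne1: "supp E b1 - supp E b2 \<noteq> {}" by auto
    show ?thesis
    proof (cases "supp E b2 \<subseteq> supp E b1")
      case True
      then show ?thesis using up lo ne1 by blast
    next
      case False
      then have "supp E b2 - supp E b1 \<noteq> {}" by auto
      then show ?thesis using up up' ne1 by blast
    qed
  qed
  then obtain x y where x: "x \<in> {c1, c2}" "\<forall>Y\<subseteq>E - {e}. spans b1 e Y \<and> \<not> spans b2 e Y \<longrightarrow> spans x e Y"
    and y: "y \<in> {c1, c2}" "\<forall>Y\<subseteq>E - {e}. spans b2 e Y \<and> \<not> spans b1 e Y \<longrightarrow> spans y e Y"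
    by (elim conjE bexE)
  define d where "d = (if x = c1 then c2 else c1)"
  have xd: "blocks_at E B' e = {x, d}" "x \<noteq> d" using x(1) c unfolding d_def by auto
  have count: "(if spans b1 e Y then 0 else 1) + (if spans b2 e Y then 0 else (1::int))
           = (if spans x e Y then 0 else 1) + (if spans d e Y then 0 else 1)" if "Y \<subseteq> E - {e}" for Y
  proof -
    have "Y \<subseteq> E" using that by auto
    note port_count[OF B B' refl refl atP b(2) bB(3) xd, OF _ this]
    then show ?thesis by simp
  qed
  show ?thesis
  proof (cases "y = x")
    case True
    have "join_meet E e b1 b2 x d"
      unfolding join_meet_def
    proof (intro allI impI)
      fix Y assume Y: "Y \<subseteq> E - {e}"
      show "spans x e Y = (spans b1 e Y \<or> spans b2 e Y) \<and> spans d e Y = (spans b1 e Y \<and> spans b2 e Y)"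
        using count[OF Y] x(2)[rule_format, OF Y] y(2)[rule_format, OF Y] True
        by (cases "spans b1 e Y"; cases "spans b2 e Y"; cases "spans x e Y"; cases "spans d e Y"; simp)
    qed
    then show ?thesis using xd by blast
  next
    case False
    then have yd: "y = d" using y(1) x(1) unfolding d_def by auto
    have "spans b1 e Y = spans x e Y \<and> spans b2 e Y = spans d e Y" if Y: "Y \<subseteq> E - {e}" for Y
      using count[OF Y] x(2)[rule_format, OF Y] y(2)[rule_format, OF Y] yd
      by (cases "spans b1 e Y"; cases "spans b2 e Y"; cases "spans x e Y"; cases "spans d e Y"; simp)
    then have "blocks_at E B e = blocks_at E B' e"
      using at_pair_eq[OF B B' e b(1) xd(1)] by blast
    then show ?thesis by blast
  qed
qed

section \<open>A block supported everywhere together with smaller blocks\<close>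

text \<open>To be applied to the ranks \<open>U\<close> and \<open>V\<close> of the two rival blocks on unions of supports of leaves, with
  \<open>L i\<close> the rank of the leaf \<open>i\<close>; \<open>I1\<close> collects the leaves that agree with the first rival, \<open>I2\<close> those
  that agree with the second one. For \<open>i \<in> I1\<close> and \<open>K \<subseteq> I2\<close> minimal such that \<open>K\<close> lowers the increment of
  \<open>V\<close> at \<open>i\<close> to \<open>L i\<close>, any \<open>j \<in> K\<close> yields the pair.\<close>

lemma two_type_split:
  fixes U V :: "'i set \<Rightarrow> int" and L :: "'i \<Rightarrow> int"
  assumes fin: "finite I" and I: "I = I1 \<union> I2" "I1 \<inter> I2 = {}" "I \<noteq> {}"
    and U0: "U {} = 0" and V0: "V {} = 0"
    and subU: "\<And>J K. J \<subseteq> I \<Longrightarrow> K \<subseteq> I \<Longrightarrow> U (J \<union> K) + U (J \<inter> K) \<le> U J + U K"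
    and subV: "\<And>J K. J \<subseteq> I \<Longrightarrow> K \<subseteq> I \<Longrightarrow> V (J \<union> K) + V (J \<inter> K) \<le> V J + V K"
    and up1: "\<And>i J. i \<in> I1 \<Longrightarrow> J \<subseteq> I - {i} \<Longrightarrow> U (insert i J) \<le> U J + L i"
    and lo1: "\<And>i J. i \<in> I1 \<Longrightarrow> J \<subseteq> I - {i} \<Longrightarrow> V J + L i \<le> V (insert i J)"
    and up2: "\<And>i J. i \<in> I2 \<Longrightarrow> J \<subseteq> I - {i} \<Longrightarrow> V (insert i J) \<le> V J + L i"
    and lo2: "\<And>i J. i \<in> I2 \<Longrightarrow> J \<subseteq> I - {i} \<Longrightarrow> U J + L i \<le> U (insert i J)"
    and st1: "\<And>i. i \<in> I1 \<Longrightarrow> U I < U (I - {i}) + L i" "\<And>i. i \<in> I1 \<Longrightarrow> L i < V {i}"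
    and st2: "\<And>i. i \<in> I2 \<Longrightarrow> V I < V (I - {i}) + L i" "\<And>i. i \<in> I2 \<Longrightarrow> L i < U {i}"
    and alt1: "\<And>i B K. i \<in> I1 \<Longrightarrow> B \<subseteq> I1 - {i} \<Longrightarrow> K \<subseteq> I2 \<Longrightarrow>
        U (insert i (B \<union> K)) = U (B \<union> K) + L i \<or> V (insert i K) = V K + L i"
    and alt2: "\<And>i B K. i \<in> I2 \<Longrightarrow> B \<subseteq> I2 - {i} \<Longrightarrow> K \<subseteq> I1 \<Longrightarrow>
        V (insert i (B \<union> K)) = V (B \<union> K) + L i \<or> U (insert i K) = U K + L i"
  shows "\<exists>i\<in>I1. \<exists>j\<in>I2. U I = U {i, j} + U (I - {i, j})"
proof -
  have dec: "F (insert i K) - F K \<le> F (insert i J) - F J"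
    if sub: "\<And>J K. J \<subseteq> I \<Longrightarrow> K \<subseteq> I \<Longrightarrow> F (J \<union> K) + F (J \<inter> K) \<le> F J + F K"
      and "J \<subseteq> K" "K \<subseteq> I - {i}" "i \<in> I" for F :: "'i set \<Rightarrow> int" and i J K
  proof -
    have "insert i J \<union> K = insert i K" "insert i J \<inter> K = J" using that by auto
    moreover have "J \<subseteq> I" "K \<subseteq> I" "insert i J \<subseteq> I" using that(2-4) by blast+
    ultimately show ?thesis using sub[of "insert i J" K] by simp
  qed
  \<comment> \<open>\<open>U\<close> is additive on \<open>I1\<close>. At the largest set the
    alternative with empty \<open>K\<close> falls on \<open>U\<close>, since \<open>V {i}\<close>
    exceeds \<open>L i\<close>; smaller sets have larger increments, and \<open>L i\<close> is an
    upper bound.\<close>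
  have U1: "U (insert i J) = U J + L i" if i: "i \<in> I1" and J: "J \<subseteq> I1 - {i}" for i J
  proof -
    have "U (insert i (I1 - {i})) = U (I1 - {i}) + L i"
      using alt1[OF i order_refl, of "{}"] st1(2)[OF i] V0 by auto
    moreover have "J \<subseteq> I - {i}" "I1 - {i} \<subseteq> I - {i}" "i \<in> I" using i J I by blast+
    ultimately show ?thesis using up1[OF i, of J] dec[OF subU J, of i] by simp
  qed
  have V2: "V (insert i J) = V J + L i" if i: "i \<in> I2" and J: "J \<subseteq> I2 - {i}" for i J
  proof -
    have "V (insert i (I2 - {i})) = V (I2 - {i}) + L i"
      using alt2[OF i order_refl, of "{}"] st2(2)[OF i] U0 by auto
    moreover have "J \<subseteq> I - {i}" "I2 - {i} \<subseteq> I - {i}" "i \<in> I" using i J I by blast+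
    ultimately show ?thesis using up2[OF i, of J] dec[OF subV J, of i] by simp
  qed
  have V1: "V (insert i I2) = V I2 + L i" if i: "i \<in> I1" for i
  proof -
    have *: "I1 - {i} \<union> I2 = I - {i}" "insert i (I - {i}) = I" using i I by auto
    show ?thesis using alt1[OF i order_refl order_refl] st1(1)[OF i] unfolding * by auto
  qed
  have U2: "U (insert i I1) = U I1 + L i" if i: "i \<in> I2" for i
  proof -
    have *: "I2 - {i} \<union> I1 = I - {i}" "insert i (I - {i}) = I" using i I by auto
    show ?thesis using alt2[OF i order_refl order_refl] st2(1)[OF i] unfolding * by auto
  qed
  have "I1 \<noteq> {}" using U2 st2(2) U0 I by fastforce
  then obtain i where i: "i \<in> I1" by auto
  have fI2: "finite I2" using fin I by auto
  let ?Q = "\<lambda>K. K \<subseteq> I2 \<and> V (insert i K) = V K + L i"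
  have "?Q I2" using V1[OF i] by simp
  then obtain K where K: "?Q K" and minK: "\<And>K'. ?Q K' \<Longrightarrow> card K \<le> card K'"
    using ex_has_least_nat[of ?Q I2 card] by blast
  have "K \<noteq> {}" using K st1(2)[OF i] V0 by auto
  then obtain j where jK: "j \<in> K" by auto
  then have j: "j \<in> I2" using K by auto
  have ij: "i \<noteq> j" "i \<notin> I2" "j \<notin> I1" using i j I by auto
  let ?K' = "K - {j}"
  have "\<not> ?Q ?K'" using minK[of ?K'] jK finite_subset[OF _ fI2, of K] K
    by (metis card_Diff1_less linorder_not_less)
  then have nK': "V (insert i ?K') \<noteq> V ?K' + L i" using K by auto
  have K'2: "?K' \<subseteq> I2 - {j}" "?K' \<subseteq> I - {i}" "insert j ?K' = K" using K jK i I by auto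
  have gt: "V (insert i ?K') > V ?K' + L i" using lo1[OF i K'2(2)] nK' by linarith
  have VK: "V K = V ?K' + L j" using V2[OF j K'2(1)] K'2(3) by simp
  \<comment> \<open>Adding \<open>j\<close> lowers the increment of \<open>V\<close> at
    \<open>i\<close> from above \<open>L i\<close> to \<open>L i\<close>. Hence, over
    \<open>?K'\<close> and \<open>i\<close>, the increment of \<open>V\<close> at \<open>j\<close>
    is below \<open>L j\<close>, and the alternative for \<open>j\<close> falls on
    \<open>U\<close>.\<close>
  have Uij: "U (insert j {i}) = U {i} + L j"
  proof -
    have e: "?K' \<union> {i} = insert i ?K'" "insert j (insert i ?K') = insert i K" using jK by auto
    have "V (insert j (?K' \<union> {i})) \<noteq> V (?K' \<union> {i}) + L j" unfolding e using K VK gt by linarith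
    then show ?thesis using alt2[OF j K'2(1), of "{i}"] i by auto
  qed
  have Ui: "U {i} = L i" using U1[OF i, of "{}"] U0 by simp
  have Vj: "V {j} = L j" using V2[OF j, of "{}"] V0 by simp
  \<comment> \<open>\<open>U {j}\<close> exceeds \<open>L j\<close>, so the increment of
    \<open>U\<close> at \<open>i\<close> over \<open>{j}\<close> is below \<open>L i\<close> and the
    alternative falls on \<open>V\<close>.\<close>
  have Vij: "V (insert i {j}) = V {j} + L i"
  proof -
    have "insert i {j} = insert j {i}" by auto
    then have "U (insert i {j}) \<noteq> U {j} + L i" using Uij Ui st2(2)[OF j] by simp
    then show ?thesis using alt1[OF i, of "{}" "{j}"] j by auto
  qed
  let ?R = "I1 - {i}" and ?R2 = "I2 - {j}"
  \<comment> \<open>Otherwise submodularity of \<open>V\<close> for \<open>{i, j}\<close> and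
    \<open>insert i ?R2\<close> would bound \<open>V {i}\<close> by \<open>L i\<close>.\<close>
  have "V (insert i ?R2) \<noteq> V ?R2 + L i"
  proof -
    have e: "{i, j} \<union> insert i ?R2 = insert i I2" "{i, j} \<inter> insert i ?R2 = {i}" using ij j by auto
    have "V (insert i I2) + V {i} \<le> V {i, j} + V (insert i ?R2)"
      using subV[of "{i, j}" "insert i ?R2"] i j I unfolding e by auto
    moreover have "V I2 = V ?R2 + L j" using V2[OF j order_refl] j by (simp add: insert_absorb)
    moreover have "V {i, j} = L j + L i" using Vij Vj by simp
    ultimately show ?thesis using V1[OF i] st1(2)[OF i] by simp
  qed
  then have "U (insert i (?R \<union> ?R2)) = U (?R \<union> ?R2) + L i"
    using alt1[OF i order_refl, of ?R2] by auto
  moreover have "?R \<union> ?R2 = I - {i, j}" "insert i (I - {i, j}) = I - {j}" "insert j (I - {j}) = I"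
    using i j ij I by auto
  moreover have "U (insert j (I - {j})) = U (I - {j}) + L j"
  proof -
    have "I1 \<subseteq> I - {j}" using ij I by auto
    then have "U (insert j (I - {j})) \<le> U (I - {j}) + L j" using dec[OF subU, of I1 "I - {j}" j] U2[OF j] j I by auto
    then show ?thesis using lo2[OF j order_refl] by simp
  qed
  moreover have "U {i, j} = L i + L j" using Uij Ui by (simp add: insert_commute)
  ultimately show ?thesis using i j by (intro bexI[of _ i] bexI[of _ j]) simp_all
qed

section \<open>Tight sets\<close>

context rank_matroid
begin

lemma spans_all:
  assumes "Y \<subseteq> E" "A \<subseteq> E" "\<And>a. a \<in> A \<Longrightarrow> spans r a Y" shows "r (Y \<union> A) = r Y"
proof -
  have "finite A" using assms(2) finite_sub by auto
  then show ?thesis using assms(2,3)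
  proof (induction A rule: finite_induct)
    case (insert a A)
    then have "spans r a (Y \<union> A)" using assms(1) by (intro spans_mono[of a Y "Y \<union> A"]) auto
    then show ?case using insert unfolding spans_def by auto
  qed simp
qed

lemma tight_separator:
  assumes "A \<subseteq> E" "r E = r A + r (E - A)" "X \<subseteq> E" shows "r X = r (X \<inter> A) + r (X - A)"
proof -
  have "r (A \<union> X) + r (A \<inter> X) \<le> r A + r X" using assms by (intro submod) auto
  moreover have "r ((E - A) \<union> (A \<union> X)) + r ((E - A) \<inter> (A \<union> X)) \<le> r (E - A) + r (A \<union> X)"
    using assms by (intro submod) auto
  moreover have "(E - A) \<union> (A \<union> X) = E" "(E - A) \<inter> (A \<union> X) = X - A" "A \<inter> X = X \<inter> A" using assms by auto
  moreover have "r ((X \<inter> A) \<union> (X - A)) \<le> r (X \<inter> A) + r (X - A)" using assms by (intro Un_le) auto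
  moreover have "(X \<inter> A) \<union> (X - A) = X" by auto
  ultimately show ?thesis using assms(2) by simp
qed

end

text \<open>Additivity at \<open>E\<close> makes \<open>A\<close> a separator, and a separator cuts
  no linked pair, whereas any two distinct elements of a full block are linked.\<close>

lemma block_tight:
  assumes "block E b" "supp E b = E" "A \<subseteq> E" "A \<noteq> {}" "b E = b A + b (E - A)" shows "A = E"
proof (rule ccontr)
  assume "A \<noteq> E"
  interpret b: rank_matroid E b by (rule blockD(1)[OF assms(1)])
  obtain f g where fg: "f \<in> A" "g \<in> E - A" using assms \<open>A \<noteq> E\<close> by auto
  then have "g \<in> cls E b f" "f \<noteq> g"
    using blockD(3)[OF assms(1), of f] assms(2,3) by auto
  then have "linked E b f g" unfolding cls_def by simp
  then show False
    using b.separator_not_linked[of A f g] b.tight_separator[OF assms(3,5)] assms(3) fg by auto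
qed

lemma join_meet_ports_eq:
  assumes "join_meet E e b1 b2 p q" "join_meet E e b1 b2 p' q'" "Y \<subseteq> E - {e}"
  shows "spans p e Y = spans p' e Y" "spans q e Y = spans q' e Y"
  using assms unfolding join_meet_def by auto

text \<open>Since \<open>c\<close> uses up half of the rank of every element, the other blocks of \<open>B\<close>, the leaves, have
  disjoint supports: \<open>c\<close> is the centre of a star.\<close>

locale star =
  fixes E :: "'a set" and \<rho> B B' c
  assumes B: "decomp E \<rho> B" and B': "decomp E \<rho> B'" and two: "\<And>e. e \<in> E \<Longrightarrow> \<rho> {e} = 2"
    and conn: "conn E \<rho>" and neq: "B \<noteq> B'" and Ene: "E \<noteq> {}"
    and c: "c \<in> B" "supp E c = E" and k2: "\<And>b. b \<in> B' \<Longrightarrow> supp E b = E"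
    and leaf_ne: "\<And>l. l \<in> B - {c} \<Longrightarrow> supp E l \<noteq> E"
begin

lemma at_c: "l \<in> B - {c} \<Longrightarrow> e \<in> supp E l \<Longrightarrow> blocks_at E B e = {c, l}"
proof -
  assume l: "l \<in> B - {c}" and e: "e \<in> supp E l"
  have eE: "e \<in> E" using e by (rule suppD)
  have "{c, l} \<subseteq> blocks_at E B e" using l e c eE unfolding blocks_at_def by auto
  moreover have "card (blocks_at E B e) = card {c, l}" using card_at[OF B eE] two[OF eE] l by auto
  ultimately show ?thesis using at_finite[OF B, of e] by (metis card_subset_eq)
qed

lemma leaf_exists: "e \<in> E \<Longrightarrow> \<exists>l\<in>B - {c}. e \<in> supp E l"
proof -
  assume e: "e \<in> E"
  have "c \<in> blocks_at E B e" using c e unfolding blocks_at_def by auto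
  moreover have "card (blocks_at E B e) = 2" using card_at[OF B e] two[OF e] by simp
  ultimately obtain l where "blocks_at E B e = {c, l}" "c \<noteq> l" using card_2_other by metis
  then show ?thesis unfolding blocks_at_def by blast
qed

lemma leaf_disjoint: "l \<in> B - {c} \<Longrightarrow> l' \<in> B - {c} \<Longrightarrow> l \<noteq> l' \<Longrightarrow> supp E l \<inter> supp E l' = {}"
proof (rule ccontr)
  assume l: "l \<in> B - {c}" "l' \<in> B - {c}" "l \<noteq> l'" and "supp E l \<inter> supp E l' \<noteq> {}"
  then obtain e where "e \<in> supp E l" "e \<in> supp E l'" by auto
  then have "{c, l} = {c, l'}" using at_c[OF l(1)] at_c[OF l(2)] by metis
  then show False using l by (simp add: doubleton_eq_iff)
qed

lemma at_B': "e \<in> E \<Longrightarrow> blocks_at E B' e = B'"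
  using k2 unfolding blocks_at_def by auto

lemma at_neq: "e \<in> E \<Longrightarrow> blocks_at E B e \<noteq> blocks_at E B' e"
proof
  assume e: "e \<in> E" and eq: "blocks_at E B e = blocks_at E B' e"
  have "\<rho> {x} \<in> {1, 2}" if "x \<in> E" for x using two[OF that] by simp
  then show False using decomp_at_determines[OF conn _ B B' e eq] neq by blast
qed

lemma matroid_of: "b \<in> B \<union> B' \<Longrightarrow> rank_matroid E b"
  using decomp_matroid[OF B] decomp_matroid[OF B'] by blast

text \<open>At this stage the choice of the join among \<open>p\<close> and \<open>q\<close> may
  depend on \<open>l\<close> and on \<open>e\<close>.\<close>

lemma jm:
  assumes "l \<in> B - {c}" "e \<in> supp E l" "B' = {p, q}"
  shows "join_meet E e c l p q \<or> join_meet E e c l q p"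
proof -
  have e: "e \<in> E" using assms(2) by (rule suppD)
  have "c \<noteq> l" "supp E c \<noteq> supp E l" using assms(1) c leaf_ne by auto
  then obtain x y where "blocks_at E B' e = {x, y}" "x \<noteq> y" "join_meet E e c l x y"
    using exchange_at[OF B B' two e at_c[OF assms(1,2)]] at_neq[OF e] by auto
  then show ?thesis using at_B'[OF e] assms(3) by (metis doubleton_eq_iff)
qed

lemma restrict_leaf:
  assumes "l \<in> B - {c}" "e \<in> supp E l" "Y \<subseteq> E"
  shows "spans l e Y = spans l e (Y \<inter> supp E l)"
  using rank_matroid.spans_restrict_supp[OF matroid_of order_refl assms(3,2)] assms(1) by auto

text \<open>If one port at \<open>e\<close> contained the other, join and meet would be the two
  ports themselves, and the two decompositions would have the same blocks at
  \<open>e\<close>.\<close>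

lemma incomparable:
  assumes l: "l \<in> B - {c}" and e: "e \<in> supp E l" and pq: "B' = {p, q}"
  shows "\<exists>Y\<subseteq>E - {e}. spans l e Y \<and> \<not> spans c e Y" "\<exists>Y\<subseteq>E - {e}. spans c e Y \<and> \<not> spans l e Y"
proof -
  have eE: "e \<in> E" using e by (rule suppD)
  obtain x y where xy: "B' = {x, y}" "join_meet E e c l x y" using jm[OF l e pq] pq by blast
  have b: "blocks_at E B e = {l, c}" "blocks_at E B' e = {x, y}" "blocks_at E B e = {c, l}"
    using at_c[OF l e] at_B'[OF eE] xy by auto
  show "\<exists>Y\<subseteq>E - {e}. spans l e Y \<and> \<not> spans c e Y"
  proof (rule ccontr)
    assume "\<not> ?thesis"
    then have "blocks_at E B e = blocks_at E B' e"
      using xy(2) unfolding join_meet_def by (intro at_pair_eq[OF B B' eE b(3,2)]) blast+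
    then show False using at_neq[OF eE] by blast
  qed
  show "\<exists>Y\<subseteq>E - {e}. spans c e Y \<and> \<not> spans l e Y"
  proof (rule ccontr)
    assume "\<not> ?thesis"
    then have "blocks_at E B e = blocks_at E B' e"
      using xy(2) unfolding join_meet_def by (intro at_pair_eq[OF B B' eE b(1,2)]) blast+
    then show False using at_neq[OF eE] by blast
  qed
qed

text \<open>By \<open>level_transfer\<close>, some \<open>W'\<close> has the same level of
  \<open>c\<close> as \<open>W\<close>, and there it is the level of the join or of the meet. In the
  first case it contains the port of \<open>l\<close>, in the second it is contained in it. Hence at
  \<open>W\<close> the meet or the join, respectively, has exactly the port of \<open>l\<close>, and
  Lehman's theorem lifts this to ranks.\<close>

lemma level_rank:
  assumes l: "l \<in> B - {c}" and pq: "B' = {p, q}" and W: "W \<subseteq> E - supp E l"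
  shows "\<exists>d\<in>{p, q}. \<forall>X\<subseteq>supp E l. d (X \<union> W) - d W = l X"
proof -
  let ?S = "supp E l"
  have blk: "block E l" using decomp_block[OF B] l by auto
  obtain e where e: "e \<in> ?S" using blockD(2)[OF blk] by auto
  have eE: "e \<in> E" using e by (rule suppD)
  have SE: "?S \<subseteq> E" by (rule supp_subset)
  interpret l: rank_matroid E l by (rule blockD(1)[OF blk])
  obtain x y where xy: "B' = {x, y}" "join_meet E e c l x y" using jm[OF l e pq] pq by blast
  have P: "?S = supp E c \<inter> supp E l" "E - ?S = supp E c - supp E l" using c SE by auto
  have Tne: "E - ?S \<noteq> {}" using leaf_ne[OF l] SE by auto
  have atP: "blocks_at E B p = {c, l}" if "p \<in> ?S" for p using at_c[OF l that] .
  have cl: "c \<noteq> l" using l by auto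
  obtain W' d where W': "W' \<subseteq> E - ?S" and d: "d \<in> blocks_at E B' e"
    and lev': "\<forall>X\<subseteq>?S - {e}. spans c e (X \<union> W) = spans c e (X \<union> W') \<and> spans c e (X \<union> W') = spans d e (X \<union> W')"
  proof -
    obtain W' where W': "W' \<subseteq> E - ?S" and ex: "\<exists>d\<in>blocks_at E B' e. \<forall>X\<subseteq>?S - {e}.
        spans c e (X \<union> W) = spans c e (X \<union> W') \<and> spans c e (X \<union> W') = spans d e (X \<union> W')"
      using level_transfer[OF B B' P atP cl e Tne W] by metis
    from ex obtain d where "d \<in> blocks_at E B' e" "\<forall>X\<subseteq>?S - {e}.
        spans c e (X \<union> W) = spans c e (X \<union> W') \<and> spans c e (X \<union> W') = spans d e (X \<union> W')" ..
    then show thesis using that W' by simp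
  qed
  have lev: "spans c e (X \<union> W) = spans c e (X \<union> W')" "spans c e (X \<union> W') = spans d e (X \<union> W')"
    if "X \<subseteq> ?S - {e}" for X using lev'[rule_format, OF that] by simp_all
  have dxy: "d = x \<or> d = y" using d at_B'[OF eE] xy by auto
  have lX: "spans l e (X \<union> Z) = spans l e X" if "X \<subseteq> ?S - {e}" "Z \<subseteq> E - ?S" for X Z
  proof -
    have "(X \<union> Z) \<inter> ?S = X" "X \<union> Z \<subseteq> E" using that SE by auto
    then show ?thesis using restrict_leaf[OF l e, of "X \<union> Z"] by simp
  qed
  have jmX: "spans x e (X \<union> Z) = (spans c e (X \<union> Z) \<or> spans l e X)"
    "spans y e (X \<union> Z) = (spans c e (X \<union> Z) \<and> spans l e X)"
    if "X \<subseteq> ?S - {e}" "Z \<subseteq> E - ?S" for X Z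
  proof -
    have "X \<union> Z \<subseteq> E - {e}" using that SE e by auto
    then show "spans x e (X \<union> Z) = (spans c e (X \<union> Z) \<or> spans l e X)"
      "spans y e (X \<union> Z) = (spans c e (X \<union> Z) \<and> spans l e X)"
      using xy(2) lX[OF that] unfolding join_meet_def by auto
  qed
  have "\<exists>z\<in>{p, q}. \<forall>X\<subseteq>?S - {e}. spans z e (X \<union> W) = spans l e X"
  proof (cases "d = x")
    case True
    have "spans y e (X \<union> W) = spans l e X" if "X \<subseteq> ?S - {e}" for X
      using jmX[OF that W] jmX[OF that W'] lev[OF that] unfolding True by blast
    then show ?thesis using xy(1) pq by auto
  next
    case False
    have "spans x e (X \<union> W) = spans l e X" if "X \<subseteq> ?S - {e}" for X
      using jmX[OF that W] jmX[OF that W'] lev[OF that] dxy False by blast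
    then show ?thesis using xy(1) pq by auto
  qed
  then obtain z where z: "z \<in> {p, q}" "\<And>X. X \<subseteq> ?S - {e} \<Longrightarrow> spans z e (X \<union> W) = spans l e X" by auto
  interpret z: rank_matroid E z using matroid_of[of z] z(1) pq by auto
  have WE: "W \<subseteq> E" using W by auto
  have Scls: "?S \<subseteq> cls ?S (minor ?S {} l) e"
    using cls_restrict[OF l.rank_matroid_axioms eE] blockD(3)[OF blk e] by simp
  have "l X = z (X \<union> W) - z W" if X: "X \<subseteq> ?S" for X
  proof -
    have "minor ?S {} l X = minor ?S W z X"
    proof (rule port_determines[OF l.minor_matroid[OF SE] z.minor_matroid[OF SE WE] e])
      show "spans (minor ?S {} l) e Y = spans (minor ?S W z) e Y" if "Y \<subseteq> ?S - {e}" for Y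
      proof -
        have "insert e Y \<subseteq> ?S" using that e by auto
        then show ?thesis using spans_minor[of e Y ?S] z(2)[OF that] by simp
      qed
      show "X \<subseteq> cls ?S (minor ?S {} l) e" using X Scls by (rule order_trans)
    qed simp
    then show ?thesis using X unfolding minor_def by simp
  qed
  then show ?thesis using z(1) by (intro bexI[of _ z]) auto
qed

text \<open>The case of empty \<open>W\<close> in \<open>level_rank\<close>. It sorts the leaves
  into two types, one for each rival block.\<close>

definition agrees :: "('a set \<Rightarrow> int) \<Rightarrow> ('a set \<Rightarrow> int) \<Rightarrow> bool" where
  "agrees p l \<longleftrightarrow> l \<in> B - {c} \<and> (\<forall>X\<subseteq>supp E l. p X = l X)"

lemma agrees_total:
  assumes "l \<in> B - {c}" "B' = {p, q}" shows "agrees p l \<or> agrees q l"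
proof -
  obtain d where d: "d \<in> {p, q}" "\<And>X. X \<subseteq> supp E l \<Longrightarrow> d (X \<union> {}) - d {} = l X"
    using level_rank[OF assms, of "{}"] by auto
  have "d {} = 0" using rank_matroid.empty[OF matroid_of[of d]] d(1) assms by auto
  then have "agrees d l" using d(2) assms(1) unfolding agrees_def by auto
  then show ?thesis using d(1) by auto
qed

text \<open>This fixes the orientation on the whole leaf: were \<open>p\<close> the meet at
  \<open>e\<close>, every set spanning \<open>e\<close> in \<open>l\<close> would span it in
  \<open>c\<close> too, against \<open>incomparable\<close>.\<close>

lemma agrees_jm:
  assumes t: "agrees p l" and e: "e \<in> supp E l" and pq: "B' = {p, q}"
  shows "join_meet E e c l p q"
proof (rule ccontr)
  assume n: "\<not> ?thesis"
  have l: "l \<in> B - {c}" using t unfolding agrees_def by auto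
  then have jmq: "join_meet E e c l q p" using jm[OF l e pq] n by blast
  obtain Y where Y: "Y \<subseteq> E - {e}" "spans l e Y" "\<not> spans c e Y" using incomparable(1)[OF l e pq] by auto
  let ?X = "Y \<inter> supp E l"
  have X: "?X \<subseteq> E - {e}" "?X \<subseteq> supp E l" "insert e ?X \<subseteq> supp E l" using Y e by auto
  have "spans l e ?X" using restrict_leaf[OF l e] Y by auto
  then have "spans p e ?X" using t X unfolding agrees_def spans_def by auto
  then have "spans c e ?X" using jmq X unfolding join_meet_def by auto
  then have "spans c e Y" using rank_matroid.spans_mono[OF matroid_of, of c e ?X Y] c Y suppD[OF e] by auto
  then show False using Y by auto
qed

lemma agrees_excl:
  assumes t: "agrees p l" "agrees q l" and pq: "B' = {p, q}" shows False
proof -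
  have l: "l \<in> B - {c}" using t unfolding agrees_def by auto
  obtain e where e: "e \<in> supp E l" using blockD(2)[OF decomp_block[OF B]] l by blast
  have qp: "B' = {q, p}" using pq by auto
  obtain Y where Y: "Y \<subseteq> E - {e}" "spans l e Y" "\<not> spans c e Y" using incomparable(1)[OF l e pq] by auto
  have "spans p e Y" using agrees_jm[OF t(1) e pq] Y unfolding join_meet_def by simp
  moreover have "\<not> spans p e Y" using agrees_jm[OF t(2) e qp] Y unfolding join_meet_def by simp
  ultimately show False by simp
qed

end

lemma increment_mono:
  fixes f g :: "'a set \<Rightarrow> int"
  assumes "finite S" "A \<subseteq> A'" "A' \<subseteq> S"
    and "\<And>Y e. insert e Y \<subseteq> S \<Longrightarrow> e \<notin> Y \<Longrightarrow> f (insert e Y) - f Y \<le> g (insert e Y) - g Y"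
  shows "f A' - f A \<le> g A' - g A"
proof -
  have "f (A \<union> (A' - A)) - f A \<le> g (A \<union> (A' - A)) - g A"
  proof (rule increments_le[where f = "\<lambda>X. f (A \<union> X) - f A" and g = "\<lambda>X. g (A \<union> X) - g A"])
    show "finite (A' - A)" using assms finite_subset by blast
    fix Y e assume "insert e Y \<subseteq> A' - A" "e \<notin> Y"
    then have "insert e (A \<union> Y) \<subseteq> S" "e \<notin> A \<union> Y" using assms(2,3) by auto
    then show "f (A \<union> insert e Y) - f A - (f (A \<union> Y) - f A) \<le> g (A \<union> insert e Y) - g A - (g (A \<union> Y) - g A)"
      using assms(4)[of e "A \<union> Y"] by simp
  qed simp
  moreover have "A \<union> (A' - A) = A'" using assms(2) by auto
  ultimately show ?thesis by simp
qed

section \<open>Ranks of the two rival blocks along a leaf\<close>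

locale star_pair = star E \<rho> B B' c for E :: "'a set" and \<rho> B B' c +
  fixes p q :: "'a set \<Rightarrow> int"
  assumes pq: "B' = {p, q}"
begin

lemma rp: "rank_matroid E p" and rq: "rank_matroid E q"
  using matroid_of pq by auto

lemma agrees_ports:
  assumes "agrees p l" "e \<in> supp E l" "Y \<subseteq> E - {e}"
  shows "spans p e Y = (spans c e Y \<or> spans l e Y)" "spans q e Y = (spans c e Y \<and> spans l e Y)"
  using agrees_jm[OF assms(1,2) pq] assms(3) unfolding join_meet_def by simp_all

text \<open>The meet spans no more than \<open>l\<close> does, so a set independent in
  \<open>l\<close> keeps its full rank in \<open>q\<close> over anything outside the support of
  \<open>l\<close>.\<close>

lemma q_basis_free:
  assumes t: "agrees p l" and W: "W \<subseteq> supp E l" "l W = int (card W)" and Y: "Y \<subseteq> E - supp E l"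
  shows "q (Y \<union> W) = q Y + int (card W)"
proof -
  have l: "l \<in> B - {c}" using t unfolding agrees_def by auto
  interpret l: rank_matroid E l using matroid_of l by auto
  interpret q: rank_matroid E q by (rule rq)
  have SE: "supp E l \<subseteq> E" by (rule supp_subset)
  have WE: "W \<subseteq> E" using W SE by auto
  then have "finite W" using l.finite_sub by auto
  then show ?thesis using W
  proof (induction W rule: finite_induct)
    case (insert x W)
    have xl: "x \<in> supp E l" "x \<in> E" "insert x W \<subseteq> E" using insert.prems(1) SE by auto
    have lW: "l W = int (card W)" using l.indep_subset[OF xl(3) insert.prems(2)] by auto
    have "\<not> spans l x W" using insert.prems(2) lW insert.hyps unfolding spans_def by simp
    moreover have "(Y \<union> W) \<inter> supp E l = W" using Y insert.prems(1) by auto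
    ultimately have "\<not> spans l x (Y \<union> W)"
      using restrict_leaf[OF l xl(1), of "Y \<union> W"] xl(3) Y by auto
    moreover have "Y \<union> W \<subseteq> E - {x}" using Y xl insert.hyps(2) by auto
    ultimately have "\<not> spans q x (Y \<union> W)" using agrees_ports(2)[OF t xl(1)] by auto
    then have "q (insert x (Y \<union> W)) = q (Y \<union> W) + 1"
      using xl Y by (intro q.not_spans) auto
    then show ?case using insert.IH insert.prems(1) lW insert.hyps by simp
  qed simp
qed

text \<open>The join spans at least what \<open>l\<close> spans, so a set of full rank in the leaf
  spans the whole leaf in \<open>p\<close>.\<close>

lemma p_spanned:
  assumes t: "agrees p l" and W: "W \<subseteq> supp E l" "l W = l (supp E l)" and x: "x \<in> supp E l" and Y: "W \<subseteq> Y" "Y \<subseteq> E"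
  shows "spans p x Y"
proof (cases "x \<in> Y")
  case True
  then show ?thesis unfolding spans_def by (simp add: insert_absorb)
next
  case False
  have l: "l \<in> B - {c}" using t unfolding agrees_def by auto
  interpret l: rank_matroid E l using matroid_of l by auto
  have SE: "supp E l \<subseteq> E" by (rule supp_subset)
  have "l (insert x W) \<le> l (supp E l)" using W x SE by (intro l.mono) auto
  moreover have "l W \<le> l (insert x W)" using W x SE by (intro l.mono) auto
  ultimately have "spans l x W" using W unfolding spans_def by simp
  then have "spans l x Y" using Y suppD[OF x] by (intro l.spans_mono[of x W Y]) auto
  then show ?thesis using agrees_ports(1)[OF t x, of Y] Y False by auto
qed

lemma p_upper:
  assumes t: "agrees p l" and Y: "Y \<subseteq> E - supp E l"
  shows "p (Y \<union> supp E l) \<le> p Y + l (supp E l)"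
proof -
  have l: "l \<in> B - {c}" using t unfolding agrees_def by auto
  interpret l: rank_matroid E l using matroid_of l by auto
  interpret p: rank_matroid E p by (rule rp)
  have SE: "supp E l \<subseteq> E" by (rule supp_subset)
  obtain W where W: "W \<subseteq> supp E l" "l W = int (card W)" "l W = l (supp E l)"
    using l.basis_exists[OF SE] by auto
  have YW: "Y \<union> W \<subseteq> E" using Y W SE by blast
  have "p ((Y \<union> W) \<union> supp E l) = p (Y \<union> W)"
    using YW SE p_spanned[OF t W(1,3), of _ "Y \<union> W"] by (intro p.spans_all) auto
  moreover have "(Y \<union> W) \<union> supp E l = Y \<union> supp E l" using W by auto
  moreover have "p (Y \<union> W) \<le> p Y + p W" using Y W SE by (intro p.Un_le) auto
  moreover have "p W \<le> int (card W)" using W SE by (intro p.le_card) auto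
  ultimately show ?thesis using W by simp
qed

lemma q_lower:
  assumes t: "agrees p l" and Y: "Y \<subseteq> E - supp E l"
  shows "q Y + l (supp E l) \<le> q (Y \<union> supp E l)"
proof -
  have l: "l \<in> B - {c}" using t unfolding agrees_def by auto
  interpret l: rank_matroid E l using matroid_of l by auto
  interpret q: rank_matroid E q by (rule rq)
  have SE: "supp E l \<subseteq> E" by (rule supp_subset)
  obtain W where W: "W \<subseteq> supp E l" "l W = int (card W)" "l W = l (supp E l)"
    using l.basis_exists[OF SE] by auto
  have "q (Y \<union> W) \<le> q (Y \<union> supp E l)" using W Y SE by (intro q.mono) auto
  then show ?thesis using q_basis_free[OF t W(1,2) Y] W by simp
qed

text \<open>On the leaf the increments of \<open>q\<close> are at least those of \<open>l\<close>.
  They differ where \<open>l\<close> spans \<open>e\<close> and \<open>c\<close> does not.\<close>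

lemma q_strict:
  assumes t: "agrees p l" shows "l (supp E l) < q (supp E l)"
proof -
  let ?S = "supp E l"
  have l: "l \<in> B - {c}" using t unfolding agrees_def by auto
  interpret l: rank_matroid E l using matroid_of l by auto
  interpret q: rank_matroid E q by (rule rq)
  have SE: "?S \<subseteq> E" by (rule supp_subset)
  have fS: "finite ?S" using SE l.finite_sub by auto
  have inc: "l (insert x Y) - l Y \<le> q (insert x Y) - q Y" if "insert x Y \<subseteq> ?S" "x \<notin> Y" for x Y
  proof -
    have "Y \<subseteq> E" "x \<in> E" "Y \<subseteq> E - {x}" using that SE by auto
    then show ?thesis
      using agrees_ports(2)[OF t, of x Y] that l.insert_eq[of Y x] q.insert_eq[of Y x] by auto
  qed
  obtain e where e: "e \<in> ?S" using blockD(2)[OF decomp_block[OF B]] l by blast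
  obtain Y where Y: "Y \<subseteq> E - {e}" "spans l e Y" "\<not> spans c e Y" using incomparable(1)[OF l e pq] by auto
  let ?X = "Y \<inter> ?S"
  have X: "?X \<subseteq> E - {e}" "?X \<subseteq> ?S" "insert e ?X \<subseteq> ?S" "?X \<subseteq> E" "e \<in> E" using Y e SE by auto
  have lX: "spans l e ?X" using restrict_leaf[OF l e] Y by auto
  have "\<not> spans c e ?X" using rank_matroid.spans_mono[OF matroid_of, of c e ?X Y] c Y X(5) by auto
  then have "\<not> spans q e ?X" using agrees_ports(2)[OF t e X(1)] by auto
  then have "q (insert e ?X) = q ?X + 1" using q.not_spans X by auto
  moreover have "l ?X - l {} \<le> q ?X - q {}" using increment_mono[OF fS _ X(2) inc, of "{}"] by auto
  moreover have "l ?S - l (insert e ?X) \<le> q ?S - q (insert e ?X)"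
    using increment_mono[OF fS X(3) order_refl inc] by auto
  ultimately show ?thesis using lX unfolding spans_def by simp
qed

text \<open>Over the complement of the leaf the increments of \<open>p\<close> are at most those of
  \<open>l\<close>. They differ where \<open>c\<close> spans \<open>e\<close> and \<open>l\<close>
  does not.\<close>

lemma p_strict:
  assumes t: "agrees p l" shows "p E < p (E - supp E l) + l (supp E l)"
proof -
  let ?S = "supp E l"
  let ?T = "E - ?S"
  let ?f = "\<lambda>A. p (A \<union> ?T)"
  have l: "l \<in> B - {c}" using t unfolding agrees_def by auto
  interpret l: rank_matroid E l using matroid_of l by auto
  interpret p: rank_matroid E p by (rule rp)
  have SE: "?S \<subseteq> E" by (rule supp_subset)
  have fS: "finite ?S" using SE l.finite_sub by auto
  have inc: "?f (insert x Y) - ?f Y \<le> l (insert x Y) - l Y" if "insert x Y \<subseteq> ?S" "x \<notin> Y" for x Y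
  proof -
    have Y: "Y \<subseteq> E" "x \<in> E" "Y \<union> ?T \<subseteq> E - {x}" "Y \<union> ?T \<subseteq> E" "x \<in> ?S" using that SE by auto
    have "spans p x (Y \<union> ?T)" if "spans l x Y"
    proof -
      have "spans l x (Y \<union> ?T)" using that Y by (intro l.spans_mono[of x Y "Y \<union> ?T"]) auto
      then show ?thesis using agrees_ports(1)[OF t Y(5,3)] by auto
    qed
    then show ?thesis using l.insert_eq[OF Y(1,2)] p.insert_eq[OF Y(4,2)] by auto
  qed
  obtain e where e: "e \<in> ?S" using blockD(2)[OF decomp_block[OF B]] l by blast
  obtain Y where Y: "Y \<subseteq> E - {e}" "spans c e Y" "\<not> spans l e Y" using incomparable(2)[OF l e pq] by auto
  let ?X = "Y \<inter> ?S"
  have X: "?X \<subseteq> ?S" "insert e ?X \<subseteq> ?S" "?X \<subseteq> E" "e \<in> E" "?X \<union> ?T \<subseteq> E - {e}" using Y e SE by auto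
  have "\<not> spans l e ?X" using restrict_leaf[OF l e] Y by auto
  then have lX: "l (insert e ?X) = l ?X + 1" using l.not_spans X by auto
  have "spans c e (?X \<union> ?T)" using rank_matroid.spans_mono[OF matroid_of, of c e Y "?X \<union> ?T"] c Y X by auto
  then have "spans p e (?X \<union> ?T)" using agrees_ports(1)[OF t e X(5)] by auto
  then have "?f (insert e ?X) = ?f ?X" unfolding spans_def by simp
  moreover have "?f ?X - ?f {} \<le> l ?X - l {}" using increment_mono[OF fS _ X(1), of "{}" ?f l] inc by simp
  moreover have "?f ?S - ?f (insert e ?X) \<le> l ?S - l (insert e ?X)"
    using increment_mono[OF fS X(2) order_refl, of ?f l] inc by simp
  moreover have "?S \<union> ?T = E" using SE by auto
  ultimately show ?thesis using lX by simp
qed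

definition U :: "('a set \<Rightarrow> int) \<Rightarrow> ('a set \<Rightarrow> int) set \<Rightarrow> int" where
  "U d J = d (\<Union>l\<in>J. supp E l)"

lemma Un_supp_sub: "(\<Union>l\<in>J. supp E l) \<subseteq> E"
  by (rule UN_least) (rule supp_subset)

text \<open>\<open>level_rank\<close> is applied over the whole supports of the leaves in
  \<open>K\<close> but only over bases of the leaves in \<open>J\<close>. If it answers with
  \<open>p\<close>, the bases span their leaves and may be replaced by them; if it answers with
  \<open>q\<close>, the bases are free and cancel. One set \<open>W\<close> thus fits both
  answers.\<close>

lemma alternative:
  assumes l: "agrees p l" and J: "J \<subseteq> {l. agrees p l} - {l}" and K: "K \<subseteq> {l. agrees q l}"
  shows "U p (insert l (J \<union> K)) = U p (J \<union> K) + l (supp E l) \<or> U q (insert l K) = U q K + l (supp E l)"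
proof -
  have leaf: "k \<in> B - {c}" if "k \<in> insert l (J \<union> K)" for k using that l J K unfolding agrees_def by auto
  have Jt: "agrees p k" if "k \<in> J" for k using that J by auto
  interpret p: rank_matroid E p by (rule rp)
  interpret q: rank_matroid E q by (rule rq)
  have "\<forall>k\<in>J. \<exists>W\<subseteq>supp E k. k W = int (card W) \<and> k W = k (supp E k)"
    using rank_matroid.basis_exists[OF matroid_of supp_subset] leaf by auto
  then obtain bs where bs: "\<And>k. k \<in> J \<Longrightarrow> bs k \<subseteq> supp E k \<and> k (bs k) = int (card (bs k)) \<and> k (bs k) = k (supp E k)"
    by metis
  let ?SK = "\<Union>k\<in>K. supp E k" and ?SJ = "\<Union>k\<in>J. supp E k" and ?S = "supp E l"
  let ?BJ = "\<Union>k\<in>J. bs k"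
  have lnJK: "l \<notin> J" "l \<notin> K" "J \<inter> K = {}" using J K l agrees_excl[OF _ _ pq] by auto
  have disj: "?S \<inter> supp E k = {}" if "k \<in> J \<union> K" for k
    using leaf_disjoint[of l k] leaf that lnJK by auto
  have BJ: "?BJ \<subseteq> ?SJ" using bs by blast
  have sE: "?S \<subseteq> E" "?SJ \<subseteq> E" "?SK \<subseteq> E" "?BJ \<subseteq> E" 
    by (rule supp_subset, rule Un_supp_sub, rule Un_supp_sub, rule order_trans[OF BJ Un_supp_sub])
  have SJK: "?S \<inter> ?SJ = {}" "?S \<inter> ?SK = {}" using disj by (simp_all add: Int_UN_distrib)
  have disj_sub: "BJ \<subseteq> SJ \<Longrightarrow> S \<inter> SJ = {} \<Longrightarrow> S \<inter> SK = {} \<Longrightarrow> BJ \<subseteq> E \<Longrightarrow> SK \<subseteq> E \<Longrightarrow> BJ \<union> SK \<subseteq> E - S"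
    for S SJ SK BJ :: "'a set" by blast
  have disj_sub2: "S \<subseteq> SJ \<Longrightarrow> BJ' \<subseteq> BJ \<Longrightarrow> Y \<subseteq> E - SJ \<Longrightarrow> S \<inter> BJ' = {} \<Longrightarrow> BJ \<subseteq> E \<Longrightarrow> Y \<union> BJ' \<subseteq> E - S"
    for S SJ BJ BJ' Y :: "'a set" by blast
  have W: "?BJ \<union> ?SK \<subseteq> E - ?S" by (rule disj_sub[OF BJ SJK sE(4,3)])
  have pfull: "p (Y \<union> ?BJ \<union> ?SJ) = p (Y \<union> ?BJ)" if "Y \<subseteq> E" for Y
  proof (rule p.spans_all)
    show "spans p a (Y \<union> ?BJ)" if a: "a \<in> ?SJ" for a
    proof -
      obtain k where k: "k \<in> J" "a \<in> supp E k" using a by (rule UN_E)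
      have "bs k \<subseteq> ?BJ" using k(1) by (rule UN_upper)
      then have "bs k \<subseteq> Y \<union> ?BJ" by (rule le_supI2)
      moreover have "Y \<union> ?BJ \<subseteq> E" using \<open>Y \<subseteq> E\<close> sE(4) by (rule Un_least)
      ultimately show ?thesis using p_spanned[OF Jt[OF k(1)] _ _ k(2), of "bs k" "Y \<union> ?BJ"] bs[OF k(1)] by simp
    qed
  qed (use that sE in simp_all)
  have "k \<in> B" if "k \<in> J" for k using leaf[of k] that by simp
  then have "J \<subseteq> B" by (rule subsetI)
  then have fJ: "finite J" by (rule finite_subset[OF _ decomp_finite(2)[OF B]])
  have qfree: "q (Y \<union> (\<Union>k\<in>J'. bs k)) = q Y + (\<Sum>k\<in>J'. int (card (bs k)))"
    if "J' \<subseteq> J" "Y \<subseteq> E - ?SJ" for J' Y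
  proof -
    have "finite J'" by (rule finite_subset[OF that(1) fJ])
    then show ?thesis using that(1)
    proof (induction J' rule: finite_induct)
      case (insert k J')
      let ?Y = "Y \<union> (\<Union>k\<in>J'. bs k)"
      have kJ: "k \<in> J" "J' \<subseteq> J" using insert.prems by auto
      have "supp E k \<inter> bs k' = {}" if k': "k' \<in> J'" for k'
      proof -
        have "k' \<in> J" "k \<noteq> k'" using k' kJ insert.hyps by auto
        then have "supp E k \<inter> supp E k' = {}" "bs k' \<subseteq> supp E k'"
          using leaf_disjoint[of k k'] leaf[of k] leaf[of k'] kJ(1) bs[of k'] by simp_all
        then show ?thesis by blast
      qed
      then have d: "supp E k \<inter> (\<Union>k\<in>J'. bs k) = {}" by (simp add: Int_UN_distrib)
      have "supp E k \<subseteq> ?SJ" using kJ(1) by (rule UN_upper)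
      moreover have "(\<Union>k\<in>J'. bs k) \<subseteq> ?BJ" using kJ(2) by (rule UN_mono) simp
      ultimately have "?Y \<subseteq> E - supp E k"
        using that(2) d sE(4) by (rule disj_sub2)
      then have "q (?Y \<union> bs k) = q ?Y + int (card (bs k))"
        using q_basis_free[OF Jt, of k "bs k" ?Y] bs insert.prems by auto
      moreover have "Y \<union> (\<Union>k\<in>insert k J'. bs k) = ?Y \<union> bs k" by auto
      ultimately show ?case using insert by simp
    qed simp
  qed
  have KJ: "?SK \<subseteq> E - ?SJ" "?S \<union> ?SK \<subseteq> E - ?SJ"
  proof -
    have "supp E k \<inter> supp E j = {}" if "k \<in> K" "j \<in> J" for k j
    proof (rule leaf_disjoint)
      show "k \<in> B - {c}" "j \<in> B - {c}" using leaf that by simp_all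
      show "k \<noteq> j" using lnJK(3) that by auto
    qed
    then have d: "?SK \<inter> ?SJ = {}" by (simp add: Int_UN_distrib2)
    have gen: "A \<subseteq> E \<Longrightarrow> A \<inter> C = {} \<Longrightarrow> A \<subseteq> E - C" for A C by blast
    show "?SK \<subseteq> E - ?SJ" by (rule gen[OF sE(3) d])
    then show "?S \<union> ?SK \<subseteq> E - ?SJ" by (rule Un_least[OF gen[OF sE(1) SJK(1)]])
  qed
  have "l \<in> B - {c}" using leaf[of l] by simp
  from level_rank[OF this pq W] obtain d where d: "d \<in> {p, q}"
    "\<forall>X\<subseteq>?S. d (X \<union> (?BJ \<union> ?SK)) - d (?BJ \<union> ?SK) = l X" ..
  have dS: "d (?S \<union> (?BJ \<union> ?SK)) = d (?BJ \<union> ?SK) + l ?S" using d(2)[rule_format, OF order_refl] by simp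
  consider "d = p" | "d = q" using d(1) by auto
  then show ?thesis
  proof cases
    case 1
    have "(?S \<union> ?SK) \<union> ?BJ \<union> ?SJ = (\<Union>k\<in>insert l (J \<union> K). supp E k)" "?SK \<union> ?BJ \<union> ?SJ = (\<Union>k\<in>J \<union> K. supp E k)"
      using BJ by auto
    moreover have "?S \<union> (?BJ \<union> ?SK) = (?S \<union> ?SK) \<union> ?BJ" "?BJ \<union> ?SK = ?SK \<union> ?BJ" by auto
    ultimately have "U p (insert l (J \<union> K)) = U p (J \<union> K) + l ?S"
      using dS pfull[of "?S \<union> ?SK"] pfull[of ?SK] sE unfolding 1 U_def by simp
    then show ?thesis ..
  next
    case 2
    have e: "?S \<union> (?BJ \<union> ?SK) = (?S \<union> ?SK) \<union> ?BJ" "?BJ \<union> ?SK = ?SK \<union> ?BJ" by auto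
    have "q (?S \<union> ?SK) = q ?SK + l ?S"
      using dS qfree[OF order_refl KJ(1)] qfree[OF order_refl KJ(2)] unfolding 2 e by (simp add: Un_assoc)
    then show ?thesis unfolding U_def by simp
  qed
qed

end

section \<open>The centre has exactly two leaves\<close>

context star
begin

text \<open>\<open>two_type_split\<close> yields leaves \<open>i\<close> and \<open>j\<close> whose
  supports have a union that is tight in \<open>u\<close>. As \<open>u\<close> is a full block, this
  union is \<open>E\<close>, and disjointness leaves no room for a third leaf.\<close>

lemma star_two_leaves:
  assumes uv: "B' = {u, v}"
  shows "\<exists>i j. i \<noteq> j \<and> B - {c} = {i, j}"
proof -
  let ?I1 = "{l. agrees u l}" and ?I2 = "{l. agrees v l}" and ?I = "B - {c}"
  interpret uv: star_pair E \<rho> B B' c u v by standard (rule uv)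
  interpret vu: star_pair E \<rho> B B' c v u by standard (use uv in auto)
  interpret u: rank_matroid E u by (rule uv.rp)
  interpret v: rank_matroid E v by (rule uv.rq)
  have leaf: "agrees u l \<Longrightarrow> l \<in> ?I" "agrees v l \<Longrightarrow> l \<in> ?I" for l unfolding agrees_def by auto
  have split: "(\<Union>k\<in>insert l J. supp E k) = (\<Union>k\<in>J. supp E k) \<union> supp E l" for l J by auto
  have offl: "(\<Union>k\<in>J. supp E k) \<subseteq> E - supp E l" if "l \<in> ?I" "J \<subseteq> ?I - {l}" for l J
    using that leaf_disjoint[of l] supp_subset[of E] by blast
  have sub: "F ((\<Union>k\<in>J \<union> K. supp E k)) + F (\<Union>k\<in>J \<inter> K. supp E k) \<le> F (\<Union>k\<in>J. supp E k) + F (\<Union>k\<in>K. supp E k)"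
    if "rank_matroid E F" "J \<subseteq> ?I" "K \<subseteq> ?I" for F J K
  proof -
    interpret F: rank_matroid E F by fact
    have "(\<Union>k\<in>J \<union> K. supp E k) = (\<Union>k\<in>J. supp E k) \<union> (\<Union>k\<in>K. supp E k)" by auto
    moreover have "(\<Union>k\<in>J \<inter> K. supp E k) = (\<Union>k\<in>J. supp E k) \<inter> (\<Union>k\<in>K. supp E k)"
    proof
      show "(\<Union>k\<in>J. supp E k) \<inter> (\<Union>k\<in>K. supp E k) \<subseteq> (\<Union>k\<in>J \<inter> K. supp E k)"
      proof
        fix x assume "x \<in> (\<Union>k\<in>J. supp E k) \<inter> (\<Union>k\<in>K. supp E k)"
        then obtain j k where jk: "j \<in> J" "x \<in> supp E j" "k \<in> K" "x \<in> supp E k" by blast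
        then have "j = k" using leaf_disjoint[of j k] that(2,3) by blast
        then show "x \<in> (\<Union>k\<in>J \<inter> K. supp E k)" using jk by blast
      qed
    qed auto
    ultimately show ?thesis using F.submod[OF uv.Un_supp_sub uv.Un_supp_sub] by simp
  qed
  have all: "(\<Union>k\<in>?I. supp E k) = E" using leaf_exists uv.Un_supp_sub by blast
  have Ine: "?I \<noteq> {}" using all Ene by auto
  have rest: "(\<Union>k\<in>?I - {l}. supp E k) = E - supp E l" if "l \<in> ?I" for l
    using offl[OF that order_refl] all by blast
  have "\<exists>i\<in>?I1. \<exists>j\<in>?I2. uv.U u ?I = uv.U u {i, j} + uv.U u (?I - {i, j})"
  proof (rule two_type_split[where V = "uv.U v" and L = "\<lambda>l. l (supp E l)"])
    show "finite ?I" using decomp_finite[OF B] by simp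
    show "?I = ?I1 \<union> ?I2" using agrees_total[OF _ uv] leaf by auto
    show "?I1 \<inter> ?I2 = {}" using agrees_excl[OF _ _ uv] by auto
    show "uv.U u {} = 0" "uv.U v {} = 0" unfolding uv.U_def by auto
    show "uv.U u (J \<union> K) + uv.U u (J \<inter> K) \<le> uv.U u J + uv.U u K" if "J \<subseteq> ?I" "K \<subseteq> ?I" for J K
      using sub[OF uv.rp that] unfolding uv.U_def .
    show "uv.U v (J \<union> K) + uv.U v (J \<inter> K) \<le> uv.U v J + uv.U v K" if "J \<subseteq> ?I" "K \<subseteq> ?I" for J K
      using sub[OF uv.rq that] unfolding uv.U_def .
    show "uv.U u (insert i J) \<le> uv.U u J + i (supp E i)" "uv.U v J + i (supp E i) \<le> uv.U v (insert i J)"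
      if "i \<in> ?I1" "J \<subseteq> ?I - {i}" for i J
      using uv.p_upper[of i] uv.q_lower[of i] offl[of i J] that leaf unfolding uv.U_def split by auto
    show "uv.U v (insert i J) \<le> uv.U v J + i (supp E i)" "uv.U u J + i (supp E i) \<le> uv.U u (insert i J)"
      if "i \<in> ?I2" "J \<subseteq> ?I - {i}" for i J
      using vu.p_upper[of i] vu.q_lower[of i] offl[of i J] that leaf unfolding uv.U_def split by auto
    show "uv.U u ?I < uv.U u (?I - {i}) + i (supp E i)" "i (supp E i) < uv.U v {i}" if "i \<in> ?I1" for i
      using uv.p_strict[of i] uv.q_strict[of i] that rest[of i] leaf(1)[of i] all unfolding uv.U_def by auto
    show "uv.U v ?I < uv.U v (?I - {i}) + i (supp E i)" "i (supp E i) < uv.U u {i}" if "i \<in> ?I2" for i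
      using vu.p_strict[of i] vu.q_strict[of i] that rest[of i] leaf(2)[of i] all unfolding uv.U_def by auto
    show "uv.U u (insert i (J \<union> K)) = uv.U u (J \<union> K) + i (supp E i) \<or> uv.U v (insert i K) = uv.U v K + i (supp E i)"
      if "i \<in> ?I1" "J \<subseteq> ?I1 - {i}" "K \<subseteq> ?I2" for i J K
      using uv.alternative[of i J K] that by simp
    show "uv.U v (insert i (J \<union> K)) = uv.U v (J \<union> K) + i (supp E i) \<or> uv.U u (insert i K) = uv.U u K + i (supp E i)"
      if "i \<in> ?I2" "J \<subseteq> ?I2 - {i}" "K \<subseteq> ?I1" for i J K
      using vu.alternative[of i J K] that by simp
  qed (rule Ine)
  then obtain i j where ij: "agrees u i" "agrees v j" "uv.U u ?I = uv.U u {i, j} + uv.U u (?I - {i, j})" by blast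
  have leafij: "i \<in> ?I" "j \<in> ?I" using ij leaf by auto
  have nij: "i \<noteq> j" using ij agrees_excl[OF _ _ uv] by auto
  let ?A = "supp E i \<union> supp E j"
  have A: "(\<Union>k\<in>{i, j}. supp E k) = ?A" by auto
  have AE: "?A \<subseteq> E" using supp_subset[of E] by blast
  have "(\<Union>k\<in>?I - {i, j}. supp E k) = E - ?A"
  proof
    have gen: "X \<subseteq> E - S \<Longrightarrow> X \<subseteq> E - S' \<Longrightarrow> X \<subseteq> E - (S \<union> S')" for X S S' by blast
    show "(\<Union>k\<in>?I - {i, j}. supp E k) \<subseteq> E - ?A"
      using offl[OF leafij(1), of "?I - {i, j}"] offl[OF leafij(2), of "?I - {i, j}"]
      by (intro gen) (simp_all add: Diff_mono)
    show "E - ?A \<subseteq> (\<Union>k\<in>?I - {i, j}. supp E k)"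
    proof
      fix x assume x: "x \<in> E - ?A"
      then have "x \<in> (\<Union>k\<in>?I. supp E k)" using all by simp
      then obtain k where "k \<in> ?I" "x \<in> supp E k" by (rule UN_E)
      then show "x \<in> (\<Union>k\<in>?I - {i, j}. supp E k)" using x by auto
    qed
  qed
  then have "u E = u ?A + u (E - ?A)" using ij(3) all A unfolding uv.U_def by simp
  moreover have "block E u" using decomp_block[OF B'] uv by auto
  moreover have "supp E i \<noteq> {}" using blockD(2)[OF decomp_block[OF B]] leafij by blast
  ultimately have AeqE: "?A = E" using block_tight[of E u ?A] k2[of u] uv AE by auto
  have "k = i \<or> k = j" if k: "k \<in> ?I" for k
  proof (rule ccontr)
    assume "\<not> ?thesis"
    then have "supp E k \<inter> ?A = {}"
      using leaf_disjoint[OF k leafij(1)] leaf_disjoint[OF k leafij(2)] by (simp add: Int_Un_distrib)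
    moreover have "supp E k \<noteq> {}" using blockD(2)[OF decomp_block[OF B]] k by blast
    ultimately show False using AeqE supp_subset[of E k] by blast
  qed
  then have "?I = {i, j}" using leafij by blast
  then show ?thesis using nij by blast
qed

end

section \<open>Classification of the decompositions\<close>

definition meets :: "'a set \<Rightarrow> ('a set \<Rightarrow> int) set \<Rightarrow> ('a set \<Rightarrow> int) \<Rightarrow> ('a set \<Rightarrow> int) \<Rightarrow> bool" where
  "meets E B b b' \<longleftrightarrow> b \<in> B \<and> b' \<in> B \<and> b \<noteq> b' \<and> supp E b \<inter> supp E b' \<noteq> {}"

definition full :: "'a set \<Rightarrow> ('a set \<Rightarrow> int) set \<Rightarrow> bool" where
  "full E B \<longleftrightarrow> (\<forall>b\<in>B. supp E b = E)"

lemma decomp_unique_of_rank_one: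
  assumes conn: "conn E \<rho>" and two: "\<And>e. e \<in> E \<Longrightarrow> \<rho> {e} \<in> {1, 2}"
    and B: "decomp E \<rho> B" "decomp E \<rho> B'" and e: "e \<in> E" "\<rho> {e} = 1"
  shows "B = B'"
proof -
  have "\<exists>b. blocks_at E C e = {b}" if "decomp E \<rho> C" for C
    using card_at[OF that e(1)] e(2) by (metis card_1_singletonE of_nat_eq_1_iff)
  then obtain b b' where b: "blocks_at E B e = {b}" "blocks_at E B' e = {b'}" using B by metis
  then have "blocks_at E B e = blocks_at E B' e" using at_single_eq[OF B e(1) b] by simp
  then show ?thesis using decomp_at_determines[OF conn two B e(1)] by blast
qed

section \<open>All elements of rank 2\<close>

locale tight_decomp =
  fixes E :: "'a set" and \<rho>
  assumes conn: "conn E \<rho>" and two: "\<And>e. e \<in> E \<Longrightarrow> \<rho> {e} = 2" and Ene: "E \<noteq> {}"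
begin

lemma two': "e \<in> E \<Longrightarrow> \<rho> {e} \<in> {1, 2}"
  using two by simp

lemma at_pair: "decomp E \<rho> B \<Longrightarrow> e \<in> E \<Longrightarrow> \<exists>b c. blocks_at E B e = {b, c} \<and> b \<noteq> c"
proof -
  assume "decomp E \<rho> B" "e \<in> E"
  then have "card (blocks_at E B e) = 2" using card_at[of E \<rho> B e] two[of e] by simp
  then show ?thesis unfolding card_2_iff .
qed

text \<open>The two blocks exhaust the rank 2 on their common support, so no other block enters it.
  It is therefore a separator, hence \<open>E\<close>.\<close>

lemma parallel_full:
  assumes B: "decomp E \<rho> B" and e: "e \<in> E" and b: "blocks_at E B e = {b1, b2}" "b1 \<noteq> b2"
    and S: "supp E b1 = supp E b2"
  shows "full E B"
proof -
  let ?A = "supp E b1"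
  have eA: "e \<in> ?A" "b1 \<in> B" "b2 \<in> B" using b unfolding blocks_at_def by auto
  have other: "supp E b \<inter> ?A = {}" if b3: "b \<in> B" "b \<noteq> b1" "b \<noteq> b2" for b
  proof (rule ccontr)
    assume "supp E b \<inter> ?A \<noteq> {}"
    then obtain p where p: "p \<in> supp E b" "p \<in> ?A" by auto
    have pE: "p \<in> E" using p(1) by (rule suppD)
    have "{b, b1, b2} \<subseteq> blocks_at E B p" using p S eA b3 unfolding blocks_at_def by auto
    then have "card {b, b1, b2} \<le> card (blocks_at E B p)" using at_finite[OF B] by (rule card_mono[rotated])
    then show False using card_at[OF B pE] two[OF pE] b3 b(2) by simp
  qed
  have "supp E b \<subseteq> ?A \<or> supp E b \<inter> ?A = {}" if "b \<in> B" for b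
    using other[OF that] S by (cases "b = b1 \<or> b = b2") auto
  then have "\<forall>X\<subseteq>E. \<rho> X = \<rho> (X \<inter> ?A) + \<rho> (X - ?A)" using saturated_separator[OF B] by blast
  then have A: "?A = E" using conn supp_subset[of E b1] eA unfolding conn_def by blast
  show ?thesis
    unfolding full_def
  proof
    fix b assume bB: "b \<in> B"
    show "supp E b = E"
    proof (cases "b = b1 \<or> b = b2")
      case False
      then have "supp E b \<inter> E = {}" using other[OF bB] A by auto
      then show ?thesis using blockD(2)[OF decomp_block[OF B bB]] supp_subset[of E b] by blast
    qed (use A S in auto)
  qed
qed

lemma exchange:
  assumes B: "decomp E \<rho> B" "decomp E \<rho> B'" and nf: "\<not> full E B" and ne: "B \<noteq> B'" and e: "e \<in> E"
    and b: "blocks_at E B e = {b1, b2}" "b1 \<noteq> b2"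
  shows "\<exists>c d. blocks_at E B' e = {c, d} \<and> c \<noteq> d \<and> join_meet E e b1 b2 c d"
proof -
  have "supp E b1 \<noteq> supp E b2" using parallel_full[OF B(1) e b] nf by auto
  moreover have "blocks_at E B e \<noteq> blocks_at E B' e"
    using decomp_at_determines[OF conn two' B e] ne by blast
  ultimately show ?thesis using exchange_at[OF B two e b] by blast
qed

text \<open>If neither decomposition were full, the exchange could be applied twice. Join and meet
  of a join and a meet are those two again, so both decompositions would have the same blocks at
  \<open>e\<close>.\<close>

lemma other_full:
  assumes B: "decomp E \<rho> B" "decomp E \<rho> B'" and nf: "\<not> full E B" and ne: "B \<noteq> B'"
  shows "full E B'"
proof (rule ccontr)
  assume nf': "\<not> full E B'"
  obtain e where e: "e \<in> E" using Ene by auto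
  obtain b1 b2 where b: "blocks_at E B e = {b1, b2}" "b1 \<noteq> b2" using at_pair[OF B(1) e] by auto
  obtain c d where c: "blocks_at E B' e = {c, d}" "c \<noteq> d" "join_meet E e b1 b2 c d"
    using exchange[OF B nf ne e b] by auto
  obtain x y where x: "blocks_at E B e = {x, y}" "x \<noteq> y" "join_meet E e c d x y"
    using exchange[OF B(2,1) nf' ne[symmetric] e c(1,2)] by auto
  have "spans x e Y = spans c e Y" "spans y e Y = spans d e Y" if "Y \<subseteq> E - {e}" for Y
    using c(3) x(3) that unfolding join_meet_def by blast+
  then have "blocks_at E B e = blocks_at E B' e" by (intro at_pair_eq[OF B e x(1) c(1)]) simp_all
  then show False using decomp_at_determines[OF conn two' B e] ne by blast
qed

text \<open>The ports of any rival at \<open>e\<close> are computed from \<open>B\<close>, as join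
  and meet.\<close>

lemma other_unique:
  assumes B: "decomp E \<rho> B" "decomp E \<rho> B'" "decomp E \<rho> B''" and nf: "\<not> full E B" and ne: "B \<noteq> B'" "B \<noteq> B''"
  shows "B' = B''"
proof -
  obtain e where e: "e \<in> E" using Ene by auto
  obtain b1 b2 where b: "blocks_at E B e = {b1, b2}" "b1 \<noteq> b2" using at_pair[OF B(1) e] by auto
  obtain c d where c: "blocks_at E B' e = {c, d}" "c \<noteq> d" "join_meet E e b1 b2 c d"
    using exchange[OF B(1,2) nf ne(1) e b] by auto
  obtain x y where x: "blocks_at E B'' e = {x, y}" "x \<noteq> y" "join_meet E e b1 b2 x y"
    using exchange[OF B(1,3) nf ne(2) e b] by auto
  have "blocks_at E B' e = blocks_at E B'' e"
    by (rule at_pair_eq[OF B(2,3) e c(1) x(1)]) (rule join_meet_ports_eq[OF c(3) x(3)], simp)+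
  then show ?thesis using decomp_at_determines[OF conn two' B(2,3) e] by blast
qed

text \<open>A full block of \<open>B'\<close> through \<open>e\<close> has a flip of
  \<open>e\<close> caused by \<open>f\<close>. So adding \<open>f\<close> lowers an increment of
  \<open>\<rho>\<close> at \<open>e\<close>, which some block of \<open>B\<close> at
  \<open>e\<close> has to account for by containing \<open>f\<close>.\<close>

lemma share_block:
  assumes B: "decomp E \<rho> B" "decomp E \<rho> B'" and full: "full E B'" and e: "e \<in> E" and f: "f \<in> E"
  shows "\<exists>b\<in>B. e \<in> supp E b \<and> f \<in> supp E b"
proof (cases "e = f")
  case True
  obtain b c where "blocks_at E B e = {b, c}" using at_pair[OF B(1) e] by auto
  then show ?thesis using True unfolding blocks_at_def by auto
next
  case False
  show ?thesis
  proof (rule ccontr)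
    assume none: "\<not> ?thesis"
    obtain u v where uv: "blocks_at E B' e = {u, v}" "u \<noteq> v" using at_pair[OF B(2) e] by auto
    then have u: "u \<in> B'" "e \<in> supp E u" unfolding blocks_at_def by auto
    have "cls E u e = E" using blockD(3)[OF decomp_block[OF B(2) u(1)] u(2)] full u(1) unfolding full_def by auto
    then have "linked E u e f" using f False unfolding cls_def by auto
    then obtain Y where Y: "Y \<subseteq> E - {e, f}" "spans u e (insert f Y)" "\<not> spans u e Y"
      unfolding linked_def by auto
    have YE: "Y \<subseteq> E" "insert f Y \<subseteq> E" using Y f by auto
    have "spans b e (insert f Y) = spans b e Y" if b: "b \<in> blocks_at E B e" for b
    proof -
      have bB: "b \<in> B" "e \<in> supp E b" using b unfolding blocks_at_def by auto
      interpret b: rank_matroid E b by (rule decomp_matroid[OF B(1) bB(1)])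
      have "f \<notin> supp E b" using none bB by auto
      then have "insert f Y \<inter> supp E b = Y \<inter> supp E b" by auto
      then show ?thesis
        using b.spans_restrict_supp[OF order_refl YE(1) bB(2)] b.spans_restrict_supp[OF order_refl YE(2) bB(2)] by simp
    qed
    then have "{b \<in> blocks_at E B e. \<not> spans b e (insert f Y)} = {b \<in> blocks_at E B e. \<not> spans b e Y}" by auto
    then have eq: "\<rho> (insert e (insert f Y)) - \<rho> (insert f Y) = \<rho> (insert e Y) - \<rho> Y"
      using decomp_increment[OF B(1) e YE(1)] decomp_increment[OF B(1) e YE(2)] by simp
    have "{b \<in> blocks_at E B' e. \<not> spans b e (insert f Y)} \<subset> {b \<in> blocks_at E B' e. \<not> spans b e Y}"
    proof
      show "{b \<in> blocks_at E B' e. \<not> spans b e (insert f Y)} \<subseteq> {b \<in> blocks_at E B' e. \<not> spans b e Y}"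
      proof
        fix b assume b: "b \<in> {b \<in> blocks_at E B' e. \<not> spans b e (insert f Y)}"
        then have "b \<in> B'" unfolding blocks_at_def by auto
        then interpret b: rank_matroid E b by (rule decomp_matroid[OF B(2)])
        show "b \<in> {b \<in> blocks_at E B' e. \<not> spans b e Y}"
          using b b.spans_mono[of e Y "insert f Y"] YE e by auto
      qed
      show "{b \<in> blocks_at E B' e. \<not> spans b e (insert f Y)} \<noteq> {b \<in> blocks_at E B' e. \<not> spans b e Y}"
        using uv Y(2,3) by blast
    qed
    then have "card {b \<in> blocks_at E B' e. \<not> spans b e (insert f Y)} < card {b \<in> blocks_at E B' e. \<not> spans b e Y}"
      using at_finite[OF B(2)] by (intro psubset_card_mono) auto
    then show False
      using eq decomp_increment[OF B(2) e YE(1)] decomp_increment[OF B(2) e YE(2)] by simp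
  qed
qed

definition triangle :: "('a set \<Rightarrow> int) set \<Rightarrow> bool" where
  "triangle B \<longleftrightarrow> (\<exists>x y z. B = {x, y, z} \<and> meets E B x y \<and> meets E B y z \<and> meets E B x z)"

definition path3 :: "('a set \<Rightarrow> int) set \<Rightarrow> bool" where
  "path3 B \<longleftrightarrow> (\<exists>x y z. B = {x, y, z} \<and> y \<noteq> z \<and> meets E B x y \<and> meets E B x z \<and> \<not> meets E B y z)"

text \<open>A block supported everywhere makes \<open>B\<close> a star. Otherwise any two elements
  share a block, while each lies in only two: \<open>e\<close> in \<open>x\<close> and
  \<open>y\<close>, \<open>f\<close> in \<open>y\<close> and \<open>z\<close>, \<open>g\<close> in
  \<open>x\<close> and \<open>z\<close>. A fourth block is impossible, since the second block at one
  of its elements would have to belong to all three pairs.\<close>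

lemma triangle_or_path:
  assumes B: "decomp E \<rho> B" "decomp E \<rho> B'" and nf: "\<not> full E B" and ne: "B \<noteq> B'"
  shows "triangle B \<or> path3 B"
proof (cases "\<exists>c\<in>B. supp E c = E")
  case True
  then obtain c where c: "c \<in> B" "supp E c = E" by auto
  have full: "full E B'" by (rule other_full[OF B nf ne])
  have lne: "supp E l \<noteq> E" if l: "l \<in> B - {c}" for l
  proof
    assume lE: "supp E l = E"
    obtain e where e: "e \<in> E" using Ene by auto
    have "{c, l} \<subseteq> blocks_at E B e" using c l lE e unfolding blocks_at_def by auto
    moreover have "card (blocks_at E B e) = card {c, l}" using card_at[OF B(1) e] two[OF e] l by auto
    ultimately have "blocks_at E B e = {c, l}" using at_finite[OF B(1), of e] by (metis card_subset_eq)
    then have "full E B" using parallel_full[OF B(1) e] c l lE by auto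
    then show False using nf by simp
  qed
  interpret s: star E \<rho> B B' c
  proof
    show "supp E b = E" if "b \<in> B'" for b using full that unfolding full_def by auto
  qed (use B two conn ne Ene c lne in auto)
  obtain e where e: "e \<in> E" using Ene by auto
  obtain u v where "blocks_at E B' e = {u, v}" using at_pair[OF B(2) e] by auto
  then have "B' = {u, v}" using s.at_B'[OF e] by simp
  then obtain i j where ij: "i \<noteq> j" "B - {c} = {i, j}" using s.star_two_leaves by blast
  then have l: "i \<in> B - {c}" "j \<in> B - {c}" "B = {c, i, j}" using c by auto
  have "supp E b \<noteq> {}" "supp E b \<subseteq> E" if "b \<in> B" for b
    using blockD(2)[OF decomp_block[OF B(1) that]] supp_subset[of E b] by auto
  then have "meets E B c i" "meets E B c j" using l c unfolding meets_def by blast+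
  moreover have "\<not> meets E B i j" using s.leaf_disjoint[OF l(1,2) ij(1)] unfolding meets_def by simp
  ultimately show ?thesis using l(3) ij(1) unfolding path3_def by blast
next
  case False
  have full: "full E B'" by (rule other_full[OF B nf ne])
  have share: "\<exists>b\<in>B. e \<in> supp E b \<and> f \<in> supp E b" if "e \<in> E" "f \<in> E" for e f
    using share_block[OF B full that] .
  have pair: "\<exists>c. blocks_at E B e = {b, c} \<and> b \<noteq> c" if "b \<in> B" "e \<in> supp E b" for b e
  proof -
    have e: "e \<in> E" using that(2) by (rule suppD)
    have "b \<in> blocks_at E B e" using that unfolding blocks_at_def by simp
    moreover have "card (blocks_at E B e) = 2" using card_at[OF B(1) e] two[OF e] by simp
    ultimately show ?thesis using card_2_other by metis
  qed
  have only: "b \<in> S" if "b \<in> B" "e \<in> supp E b" "blocks_at E B e = S" for b e S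
    using that(1,2) unfolding that(3)[symmetric] blocks_at_def by simp
  obtain e where e: "e \<in> E" using Ene by auto
  obtain x y where xy: "blocks_at E B e = {x, y}" "x \<noteq> y" using at_pair[OF B(1) e] by auto
  have x: "x \<in> B" "e \<in> supp E x" and y: "y \<in> B" "e \<in> supp E y" using xy unfolding blocks_at_def by auto
  obtain f where f: "f \<in> E" "f \<notin> supp E x" using False x supp_subset[of E x] by blast
  have fy: "f \<in> supp E y"
  proof -
    obtain b where b: "b \<in> B" "e \<in> supp E b" "f \<in> supp E b" using share[OF e f(1)] by auto
    then have "b \<in> {x, y}" using only[OF b(1,2) xy(1)] by simp
    then show ?thesis using b f by auto
  qed
  obtain z where z: "blocks_at E B f = {y, z}" "y \<noteq> z" using pair[OF y(1) fy] by auto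
  have zB: "z \<in> B" "f \<in> supp E z" "z \<noteq> x" using z f unfolding blocks_at_def by auto
  obtain g where g: "g \<in> E" "g \<notin> supp E y" using False y supp_subset[of E y] by blast
  have gx: "g \<in> supp E x"
  proof -
    obtain b where b: "b \<in> B" "e \<in> supp E b" "g \<in> supp E b" using share[OF e g(1)] by auto
    then have "b \<in> {x, y}" using only[OF b(1,2) xy(1)] by simp
    then show ?thesis using b g by auto
  qed
  have gz: "g \<in> supp E z"
  proof -
    obtain b where b: "b \<in> B" "f \<in> supp E b" "g \<in> supp E b" using share[OF f(1) g(1)] by auto
    then have "b \<in> {y, z}" using only[OF b(1,2) z(1)] by simp
    then show ?thesis using b g by auto
  qed
  have "b \<in> {x, y, z}" if bB: "b \<in> B" for b
  proof (rule ccontr)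
    assume nb: "b \<notin> {x, y, z}"
    obtain h where h: "h \<in> supp E b" using blockD(2)[OF decomp_block[OF B(1) bB]] by auto
    have hE: "h \<in> E" using h by (rule suppD)
    obtain b1 where b1: "b1 \<in> B" "e \<in> supp E b1" "h \<in> supp E b1" using share[OF e hE] by auto
    obtain b2 where b2: "b2 \<in> B" "f \<in> supp E b2" "h \<in> supp E b2" using share[OF f(1) hE] by auto
    obtain b3 where b3: "b3 \<in> B" "g \<in> supp E b3" "h \<in> supp E b3" using share[OF g(1) hE] by auto
    have gat: "blocks_at E B g = {x, z}"
    proof -
      obtain w where "blocks_at E B g = {x, w}" using pair[OF x(1) gx] by auto
      moreover have "z \<in> blocks_at E B g" using zB gz unfolding blocks_at_def by auto
      ultimately show ?thesis using zB(3) by auto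
    qed
    have "b1 \<in> {x, y}" "b2 \<in> {y, z}" "b3 \<in> {x, z}"
      using only[OF b1(1,2) xy(1)] only[OF b2(1,2) z(1)] only[OF b3(1,2) gat] by simp_all
    moreover obtain w where w: "blocks_at E B h = {b, w}" using pair[OF bB h] by auto
    moreover have "b1 \<in> {b, w}" "b2 \<in> {b, w}" "b3 \<in> {b, w}"
      using only[OF b1(1,3) w] only[OF b2(1,3) w] only[OF b3(1,3) w] by simp_all
    ultimately show False using nb xy(2) z(2) zB(3) by auto
  qed
  then have "B = {x, y, z}" using x y zB by auto
  moreover have "meets E B x y" "meets E B y z" "meets E B x z"
    unfolding meets_def using x y zB xy(2) z(2) fy gx gz by auto
  ultimately show ?thesis unfolding triangle_def by blast
qed

lemma full_pair:
  assumes B: "decomp E \<rho> B" and "full E B"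
  shows "\<exists>x y. B = {x, y} \<and> meets E B x y"
proof -
  obtain e where e: "e \<in> E" using Ene by auto
  obtain u v where uv: "blocks_at E B e = {u, v}" "u \<noteq> v" using at_pair[OF B e] by auto
  moreover have "blocks_at E B e = B" using assms(2) e unfolding full_def blocks_at_def by auto
  ultimately have "B = {u, v}" by simp
  moreover have "meets E B u v" using uv assms(2) Ene \<open>B = {u, v}\<close> unfolding meets_def full_def by auto
  ultimately show ?thesis by blast
qed

text \<open>The first case includes the absence of decompositions.\<close>

lemma decomp_cases:
  obtains "\<And>B. decomp E \<rho> B \<Longrightarrow> full E B"
  | B where "decomp E \<rho> B" "\<And>B'. decomp E \<rho> B' \<Longrightarrow> B' = B"
  | B B' where "decomp E \<rho> B" "decomp E \<rho> B'" "B \<noteq> B'" "full E B'" "triangle B \<or> path3 B"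
      "\<And>B''. decomp E \<rho> B'' \<Longrightarrow> B'' = B \<or> B'' = B'"
proof (cases "\<exists>B. decomp E \<rho> B \<and> \<not> full E B")
  case False
  then show ?thesis using that(1) by blast
next
  case True
  then obtain B where B: "decomp E \<rho> B" "\<not> full E B" by auto
  show ?thesis
  proof (cases "\<exists>B'. decomp E \<rho> B' \<and> B' \<noteq> B")
    case False
    then show ?thesis using that(2)[OF B(1)] by blast
  next
    case True
    then obtain B' where B': "decomp E \<rho> B'" "B \<noteq> B'" by auto
    have "B'' = B \<or> B'' = B'" if "decomp E \<rho> B''" for B''
      using other_unique[OF B(1) B'(1) that B(2) B'(2)] by auto
    then show ?thesis
      using that(3)[OF B(1) B' other_full[OF B(1) B'(1) B(2) B'(2)] triangle_or_path[OF B(1) B'(1) B(2) B'(2)]] by blast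
  qed
qed

end

section \<open>Counting tuples of matroids\<close>

text \<open>Functions in place of lists, so that an index can serve as a colour.\<close>

definition tuples :: "'a set \<Rightarrow> ('a set \<Rightarrow> int) \<Rightarrow> nat \<Rightarrow> (nat \<Rightarrow> 'a set \<Rightarrow> int) set" where
  "tuples E \<rho> k = {f \<in> {..<k} \<rightarrow>\<^sub>E {r. matroid_rank E r}. \<forall>X\<subseteq>E. \<rho> X = (\<Sum>i<k. f i X)}"

lemma decomp_count_tuples: "matroid_decomp_count E \<rho> k = card (tuples E \<rho> k)"
proof -
  let ?L = "{Ms. length Ms = k \<and> (\<forall>r\<in>set Ms. matroid_rank E r) \<and> (\<forall>X. X \<subseteq> E \<longrightarrow> \<rho> X = (\<Sum>r\<leftarrow>Ms. r X))}"
  have sum_nth: "(\<Sum>r\<leftarrow>Ms. r X) = (\<Sum>i<k. (Ms ! i) X)" if "length Ms = k" for Ms :: "('a set \<Rightarrow> int) list" and X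
    using that by (simp add: sum_list_sum_nth atLeast0LessThan)
  have "bij_betw (\<lambda>Ms. \<lambda>i\<in>{..<k}. Ms ! i) ?L (tuples E \<rho> k)"
  proof (rule bij_betw_byWitness[where f' = "\<lambda>f. map f [0..<k]"])
    show "\<forall>Ms\<in>?L. map (\<lambda>i\<in>{..<k}. Ms ! i) [0..<k] = Ms"
      by (auto intro!: nth_equalityI)
    show "\<forall>f\<in>tuples E \<rho> k. (\<lambda>i\<in>{..<k}. map f [0..<k] ! i) = f"
      unfolding tuples_def by (auto simp: fun_eq_iff PiE_def extensional_def restrict_def)
    show "(\<lambda>Ms. \<lambda>i\<in>{..<k}. Ms ! i) ` ?L \<subseteq> tuples E \<rho> k"
    proof
      fix f assume "f \<in> (\<lambda>Ms. \<lambda>i\<in>{..<k}. Ms ! i) ` ?L"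
      then obtain Ms where Ms: "Ms \<in> ?L" "f = (\<lambda>i\<in>{..<k}. Ms ! i)" by auto
      then have len: "length Ms = k" by simp
      have "f \<in> {..<k} \<rightarrow>\<^sub>E {r. matroid_rank E r}" using Ms by auto
      moreover have "\<rho> X = (\<Sum>i<k. f i X)" if "X \<subseteq> E" for X
        using Ms that sum_nth[OF len, of X] by simp
      ultimately show "f \<in> tuples E \<rho> k" unfolding tuples_def by simp
    qed
    show "(\<lambda>f. map f [0..<k]) ` tuples E \<rho> k \<subseteq> ?L"
    proof
      fix Ms assume "Ms \<in> (\<lambda>f. map f [0..<k]) ` tuples E \<rho> k"
      then obtain f where f: "f \<in> tuples E \<rho> k" "Ms = map f [0..<k]" by auto
      then have len: "length Ms = k" by simp
      have "(\<Sum>r\<leftarrow>Ms. r X) = (\<Sum>i<k. f i X)" for X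
        unfolding sum_nth[OF len] using f(2) by simp
      then show "Ms \<in> ?L" using f len unfolding tuples_def by (auto simp: PiE_def Pi_def)
    qed
  qed
  then have "card ?L = card (tuples E \<rho> k)" by (rule bij_betw_same_card)
  then show ?thesis unfolding matroid_decomp_count_def .
qed

lemma finite_matroids: "finite E \<Longrightarrow> finite {r. matroid_rank E r}"
proof -
  assume E: "finite E"
  let ?F = "Pow E \<rightarrow>\<^sub>E {0..int (card E)}"
  have "inj_on (\<lambda>r. restrict r (Pow E)) {r. matroid_rank E r}"
  proof (rule inj_onI)
    fix r s assume "r \<in> {r. matroid_rank E r}" "s \<in> {r. matroid_rank E r}"
      and eq: "restrict r (Pow E) = restrict s (Pow E)"
    then have out: "\<not> X \<subseteq> E \<Longrightarrow> r X = 0 \<and> s X = 0" for X unfolding matroid_rank_def by simp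
    show "r = s"
    proof
      fix X show "r X = s X"
        using fun_cong[OF eq, of X] out[of X] by (cases "X \<subseteq> E") auto
    qed
  qed
  moreover have "(\<lambda>r. restrict r (Pow E)) ` {r. matroid_rank E r} \<subseteq> ?F"
  proof
    fix g assume "g \<in> (\<lambda>r. restrict r (Pow E)) ` {r. matroid_rank E r}"
    then obtain r where r: "matroid_rank E r" "g = restrict r (Pow E)" by auto
    have "r X \<in> {0..int (card E)}" if "X \<subseteq> E" for X
    proof -
      have "0 \<le> r X" "r X \<le> int (card X)" using r(1) that unfolding matroid_rank_def by auto
      moreover have "card X \<le> card E" using card_mono[OF E that] .
      ultimately show ?thesis by simp
    qed
    then show "g \<in> ?F" unfolding r(2) by auto
  qed
  moreover have "finite ?F" using E by (intro finite_PiE) auto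
  ultimately show ?thesis by (meson finite_imageD finite_subset)
qed

lemma finite_tuples: "finite E \<Longrightarrow> finite (tuples E \<rho> k)"
proof -
  assume "finite E"
  then have "finite ({..<k} \<rightarrow>\<^sub>E {r. matroid_rank E r})" by (intro finite_PiE finite_matroids) simp_all
  then show ?thesis unfolding tuples_def by (rule finite_subset[rotated]) auto
qed

lemma block_outside: "block E b \<Longrightarrow> \<not> X \<subseteq> E \<Longrightarrow> b X = 0"
  using rank_matroid.outside[OF blockD(1)] by blast

section \<open>Merging the components of the matroids in a tuple\<close>

definition comps :: "'a set \<Rightarrow> ('a set \<Rightarrow> int) \<Rightarrow> ('a set \<Rightarrow> int) set" where
  "comps E r = comp E r ` supp E r"

lemma comps_decomp: "rank_matroid E r \<Longrightarrow> decomp E r (comps E r)"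
  unfolding comps_def by (rule decomp_comps)

lemma comps_unique: "rank_matroid E r \<Longrightarrow> decomp E r B \<Longrightarrow> comps E r = B"
  unfolding comps_def using decomp_matroid_unique by metis

lemma comps_disjoint:
  assumes r: "rank_matroid E r" and b: "b \<in> comps E r" "b' \<in> comps E r" "b \<noteq> b'"
  shows "supp E b \<inter> supp E b' = {}"
proof (rule ccontr)
  assume "supp E b \<inter> supp E b' \<noteq> {}"
  then obtain e where e: "e \<in> supp E b" "e \<in> supp E b'" by auto
  have eE: "e \<in> E" using e(1) by (rule suppD)
  have "{b, b'} \<subseteq> blocks_at E (comps E r) e" using e b unfolding blocks_at_def by auto
  then have "card {b, b'} \<le> card (blocks_at E (comps E r) e)"
    using at_finite[OF comps_decomp[OF r]] by (rule card_mono[rotated])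
  then show False
    using card_at[OF comps_decomp[OF r] eE] rank_matroid.le_card[OF r, of "{e}"] eE b(3) by simp
qed

lemma comps_sum:
  assumes r: "rank_matroid E r" shows "r X = (\<Sum>b\<in>comps E r. b X)"
proof (cases "X \<subseteq> E")
  case True
  then show ?thesis using decomp_sum[OF comps_decomp[OF r]] by simp
next
  case False
  then have "(\<Sum>b\<in>comps E r. b X) = 0"
    using block_outside[OF decomp_block[OF comps_decomp[OF r]]] by (intro sum.neutral) blast
  then show ?thesis using rank_matroid.outside[OF r False] by simp
qed

text \<open>The bound by the cardinality is the only matroid axiom that a sum can violate. Disjoint
  supports preserve it.\<close>

lemma sum_disjoint_blocks:
  assumes E: "finite E" and B: "finite B" "\<And>b. b \<in> B \<Longrightarrow> block E b"
    and disj: "\<And>b b'. b \<in> B \<Longrightarrow> b' \<in> B \<Longrightarrow> b \<noteq> b' \<Longrightarrow> supp E b \<inter> supp E b' = {}"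
  shows "rank_matroid E (\<lambda>X. \<Sum>b\<in>B. b X)"
proof
  have m: "rank_matroid E b" if "b \<in> B" for b using blockD(1)[OF B(2)[OF that]] .
  have "(\<Sum>b\<in>B. b X) \<le> int (card X)" if X: "X \<subseteq> E" for X
  proof -
    have "b X \<le> int (card (X \<inter> supp E b))" if b: "b \<in> B" for b
    proof -
      interpret b: rank_matroid E b by (rule m[OF b])
      show ?thesis using b.restrict_supp[OF order_refl X] b.le_card[of "X \<inter> supp E b"] X by auto
    qed
    then have "(\<Sum>b\<in>B. b X) \<le> (\<Sum>b\<in>B. int (card (X \<inter> supp E b)))" by (rule sum_mono)
    also have "\<dots> = int (card (\<Union>b\<in>B. X \<inter> supp E b))"
    proof (subst card_UN_disjoint)
      show "\<forall>b\<in>B. finite (X \<inter> supp E b)" using finite_subset[OF X E] by simp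
      show "\<forall>b\<in>B. \<forall>b'\<in>B. b \<noteq> b' \<longrightarrow> (X \<inter> supp E b) \<inter> (X \<inter> supp E b') = {}"
        using disj by blast
    qed (use B in simp_all)
    also have "\<dots> \<le> int (card X)" using finite_subset[OF X E] by (simp add: card_mono UN_least)
    finally show ?thesis .
  qed
  moreover have "0 \<le> (\<Sum>b\<in>B. b X)" if "X \<subseteq> E" for X
    using rank_matroid.nonneg[OF m that] by (rule sum_nonneg)
  moreover have "(\<Sum>b\<in>B. b X) \<le> (\<Sum>b\<in>B. b Y)" if "X \<subseteq> Y" "Y \<subseteq> E" for X Y
    using rank_matroid.mono[OF m that] by (rule sum_mono)
  moreover have "(\<Sum>b\<in>B. b (X \<union> Y)) + (\<Sum>b\<in>B. b (X \<inter> Y)) \<le> (\<Sum>b\<in>B. b X) + (\<Sum>b\<in>B. b Y)"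
    if "X \<subseteq> E" "Y \<subseteq> E" for X Y
    unfolding sum.distrib[symmetric] using rank_matroid.submod[OF m that] by (rule sum_mono)
  moreover have "(\<Sum>b\<in>B. b X) = 0" if "\<not> X \<subseteq> E" for X
    using block_outside[OF B(2) that] by (intro sum.neutral) blast
  ultimately show "matroid_rank E (\<lambda>X. \<Sum>b\<in>B. b X)" unfolding matroid_rank_def by blast
qed (rule E)

text \<open>The tuples for which the union of the components would lose a block.\<close>

definition repeats :: "'a set \<Rightarrow> nat \<Rightarrow> (nat \<Rightarrow> 'a set \<Rightarrow> int) \<Rightarrow> bool" where
  "repeats E k f \<longleftrightarrow> (\<exists>i<k. \<exists>j<k. i \<noteq> j \<and> comps E (f i) \<inter> comps E (f j) \<noteq> {})"

lemma tuples_matroid: "finite E \<Longrightarrow> f \<in> tuples E \<rho> k \<Longrightarrow> i < k \<Longrightarrow> rank_matroid E (f i)"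
  unfolding tuples_def rank_matroid_def by (auto simp: PiE_def Pi_def)

lemma tuples_sum: "f \<in> tuples E \<rho> k \<Longrightarrow> X \<subseteq> E \<Longrightarrow> \<rho> X = (\<Sum>i<k. f i X)"
  unfolding tuples_def by simp

lemma merged_decomp:
  assumes E: "finite E" and f: "f \<in> tuples E \<rho> k" and nr: "\<not> repeats E k f"
  shows "decomp E \<rho> (\<Union>i<k. comps E (f i))"
proof -
  have d: "decomp E (f i) (comps E (f i))" if "i < k" for i
    using comps_decomp[OF tuples_matroid[OF E f that]] .
  have "(\<Sum>b\<in>(\<Union>i<k. comps E (f i)). b X) = (\<Sum>i<k. \<Sum>b\<in>comps E (f i). b X)" for X
    using decomp_finite(2)[OF d] nr unfolding repeats_def by (intro sum.UNION_disjoint) auto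
  moreover have "(\<Sum>b\<in>comps E (f i). b X) = f i X" if "i < k" for i X
    using comps_sum[OF tuples_matroid[OF E f that]] by simp
  ultimately have "\<rho> X = (\<Sum>b\<in>(\<Union>i<k. comps E (f i)). b X)" if "X \<subseteq> E" for X
    using tuples_sum[OF f that] by simp
  moreover have "block E b" if "b \<in> (\<Union>i<k. comps E (f i))" for b
    using that decomp_block[OF d] by auto
  ultimately show ?thesis unfolding decomp_def using E decomp_finite(2)[OF d] by auto
qed

text \<open>The colour of a block is the index of the matroid that has it as a component.\<close>

lemma colouring_bij:
  assumes dec: "decomp E \<rho> B"
  shows "card {f \<in> tuples E \<rho> k. \<not> repeats E k f \<and> (\<Union>i<k. comps E (f i)) = B}
           = card (proper_colourings B (meets E B) k)"
proof -
  have E: "finite E" and B: "finite B" using decomp_finite[OF dec] by auto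
  let ?T = "{f \<in> tuples E \<rho> k. \<not> repeats E k f \<and> (\<Union>i<k. comps E (f i)) = B}"
  let ?C = "proper_colourings B (meets E B) k"
  let ?\<Phi> = "\<lambda>c. \<lambda>j\<in>{..<k}. \<lambda>X. \<Sum>b\<in>{b \<in> B. c b = j}. b X"
  let ?\<Psi> = "\<lambda>f. \<lambda>b\<in>B. THE i. i < k \<and> b \<in> comps E (f i)"
  have \<Phi>m: "rank_matroid E (?\<Phi> c j)" "comps E (?\<Phi> c j) = {b \<in> B. c b = j}" if c: "c \<in> ?C" and j: "j < k" for c j
  proof -
    have blk: "block E b" if "b \<in> {b \<in> B. c b = j}" for b using decomp_block[OF dec] that by simp
    have "supp E b \<inter> supp E b' = {}" if "b \<in> {b \<in> B. c b = j}" "b' \<in> {b \<in> B. c b = j}" "b \<noteq> b'" for b b'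
      using that c unfolding proper_colourings_def meets_def by force
    then have m: "rank_matroid E (\<lambda>X. \<Sum>b\<in>{b \<in> B. c b = j}. b X)"
      using B blk by (intro sum_disjoint_blocks[OF E]) auto
    then show "rank_matroid E (?\<Phi> c j)" using j by simp
    have "decomp E (\<lambda>X. \<Sum>b\<in>{b \<in> B. c b = j}. b X) {b \<in> B. c b = j}"
      unfolding decomp_def using E B blk by simp
    then show "comps E (?\<Phi> c j) = {b \<in> B. c b = j}" using comps_unique[OF m] j by simp
  qed
  have range: "c b < k" if "c \<in> ?C" "b \<in> B" for c b
    using that unfolding proper_colourings_def by (auto simp: PiE_def Pi_def)
  have "bij_betw ?\<Phi> ?C ?T"
  proof (rule bij_betw_byWitness[where f' = ?\<Psi>])
    show "\<forall>c\<in>?C. ?\<Psi> (?\<Phi> c) = c"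
    proof
      fix c assume c: "c \<in> ?C"
      show "?\<Psi> (?\<Phi> c) = c"
      proof
        fix b
        show "?\<Psi> (?\<Phi> c) b = c b"
        proof (cases "b \<in> B")
          case True
          have "(THE i. i < k \<and> b \<in> comps E (?\<Phi> c i)) = c b"
            using \<Phi>m(2)[OF c] range[OF c True] True by (intro the_equality) auto
          then show ?thesis using True by simp
        next
          case False
          then show ?thesis using c unfolding proper_colourings_def by (auto simp: PiE_def extensional_def)
        qed
      qed
    qed
    show "?\<Phi> ` ?C \<subseteq> ?T"
    proof
      fix f assume "f \<in> ?\<Phi> ` ?C"
      then obtain c where c: "c \<in> ?C" "f = ?\<Phi> c" by blast
      have cf: "comps E (f i) = {b \<in> B. c b = i}" "matroid_rank E (f i)" if "i < k" for i
        using \<Phi>m[OF c(1) that] unfolding c(2) rank_matroid_def by simp_all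
      have "\<rho> X = (\<Sum>i<k. f i X)" if X: "X \<subseteq> E" for X
      proof -
        have "(\<Sum>i<k. f i X) = (\<Sum>i<k. \<Sum>b\<in>{b \<in> B. c b = i}. b X)" unfolding c(2) by simp
        also have "\<dots> = (\<Sum>b\<in>B. b X)"
          using B range[OF c(1)] by (intro sum.group) auto
        finally show ?thesis using decomp_sum[OF dec X] by simp
      qed
      moreover have "f \<in> {..<k} \<rightarrow>\<^sub>E {r. matroid_rank E r}"
        using cf(2) unfolding c(2) by (intro PiE_I) simp_all
      ultimately have "f \<in> tuples E \<rho> k" unfolding tuples_def by simp
      moreover have "\<not> repeats E k f" using cf(1) unfolding repeats_def by auto
      moreover have "(\<Union>i<k. comps E (f i)) = B" using cf(1) range[OF c(1)] by auto
      ultimately show "f \<in> ?T" by simp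
    qed
    have col: "?\<Psi> f \<in> ?C" "?\<Phi> (?\<Psi> f) = f" if fT: "f \<in> ?T" for f
    proof -
      have f: "f \<in> tuples E \<rho> k" "\<not> repeats E k f" "(\<Union>i<k. comps E (f i)) = B" using fT by simp_all
      have the: "?\<Psi> f b = i" if "i < k" "b \<in> comps E (f i)" for b i
      proof -
        have "b \<in> B" using f(3) that by blast
        moreover have "(THE i. i < k \<and> b \<in> comps E (f i)) = i"
          using that f(2) unfolding repeats_def by (intro the_equality) auto
        ultimately show ?thesis by simp
      qed
      have ex: "\<exists>i<k. b \<in> comps E (f i) \<and> ?\<Psi> f b = i" if "b \<in> B" for b
        using that f(3) the by blast
      have m: "rank_matroid E (f i)" if "i < k" for i using tuples_matroid[OF E f(1) that] .
      show "?\<Psi> f \<in> ?C"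
        unfolding proper_colourings_def
      proof (intro CollectI conjI ballI impI)
        show "?\<Psi> f \<in> B \<rightarrow>\<^sub>E {..<k}"
        proof (rule PiE_I)
          show "?\<Psi> f b \<in> {..<k}" if "b \<in> B" for b using ex[OF that] by auto
        qed simp
        fix b b' assume b: "b \<in> B" "b' \<in> B" "meets E B b b'"
        obtain i where i: "i < k" "b \<in> comps E (f i)" "?\<Psi> f b = i" using ex[OF b(1)] by blast
        obtain j where j: "j < k" "b' \<in> comps E (f j)" "?\<Psi> f b' = j" using ex[OF b(2)] by blast
        have "i \<noteq> j" using comps_disjoint[OF m[OF i(1)] i(2), of b'] j b(3) unfolding meets_def by auto
        then show "?\<Psi> f b \<noteq> ?\<Psi> f b'" unfolding i(3) j(3) .
      qed
      show "?\<Phi> (?\<Psi> f) = f"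
      proof
        fix j
        show "?\<Phi> (?\<Psi> f) j = f j"
        proof (cases "j < k")
          case True
          have "{b \<in> B. ?\<Psi> f b = j} = comps E (f j)"
          proof
            show "{b \<in> B. ?\<Psi> f b = j} \<subseteq> comps E (f j)" using ex by fastforce
            show "comps E (f j) \<subseteq> {b \<in> B. ?\<Psi> f b = j}" using the[OF True] f(3) True by blast
          qed
          then have "?\<Phi> (?\<Psi> f) j = (\<lambda>X. \<Sum>b\<in>comps E (f j). b X)" using True by simp
          also have "\<dots> = f j" using comps_sum[OF m[OF True]] by (intro ext) simp
          finally show ?thesis .
        next
          case False
          then show ?thesis using f(1) unfolding tuples_def by (auto simp: PiE_def extensional_def)
        qed
      qed
    qed
    show "\<forall>f\<in>?T. ?\<Phi> (?\<Psi> f) = f" using col(2) by blast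
    show "?\<Psi> ` ?T \<subseteq> ?C" using col(1) by blast
  qed
  then show ?thesis by (rule bij_betw_same_card[symmetric])
qed

lemma finite_decomps: "finite E \<Longrightarrow> finite {B. decomp E \<rho> B}"
proof -
  assume E: "finite E"
  have "{B. decomp E \<rho> B} \<subseteq> Pow {r. matroid_rank E r}"
    using decomp_matroid unfolding rank_matroid_def by blast
  then show ?thesis by (rule finite_subset) (simp add: finite_matroids[OF E])
qed

lemma card_without_repeats:
  assumes E: "finite E"
  shows "card {f \<in> tuples E \<rho> k. \<not> repeats E k f}
           = (\<Sum>B | decomp E \<rho> B. card (proper_colourings B (meets E B) k))"
proof -
  let ?S = "\<lambda>B. {f \<in> tuples E \<rho> k. \<not> repeats E k f \<and> (\<Union>i<k. comps E (f i)) = B}"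
  have "{f \<in> tuples E \<rho> k. \<not> repeats E k f} = (\<Union>B\<in>{B. decomp E \<rho> B}. ?S B)"
    using merged_decomp[OF E] by auto
  also have "card \<dots> = (\<Sum>B | decomp E \<rho> B. card (?S B))"
    using finite_decomps[OF E] finite_tuples[OF E, of \<rho> k] by (intro card_UN_disjoint) auto
  also have "\<dots> = (\<Sum>B | decomp E \<rho> B. card (proper_colourings B (meets E B) k))"
    using colouring_bij by (intro sum.cong) auto
  finally show ?thesis .
qed

text \<open>The only tuples whose matroids share a block: \<open>\<rho>\<close> is twice that block.\<close>

definition half :: "'a set \<Rightarrow> ('a set \<Rightarrow> int) \<Rightarrow> ('a set \<Rightarrow> int) \<Rightarrow> bool" where
  "half E \<rho> C \<longleftrightarrow> block E C \<and> supp E C = E \<and> (\<forall>X\<subseteq>E. \<rho> X = 2 * C X)"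

text \<open>The shared block uses up the rank 2 on its support, so the other matroids vanish there.
  The support thus separates every matroid of the tuple, hence \<open>\<rho>\<close>, and is
  \<open>E\<close> by connectivity.\<close>

lemma repeats_half:
  assumes E: "finite E" and conn: "conn E \<rho>" and two: "\<And>e. e \<in> E \<Longrightarrow> \<rho> {e} \<le> 2"
    and f: "f \<in> tuples E \<rho> k" and ij: "i < k" "j < k" "i \<noteq> j" and b: "b \<in> comps E (f i)" "b \<in> comps E (f j)"
  shows "half E \<rho> b \<and> f = (\<lambda>m\<in>{..<k}. if m \<in> {i, j} then b else (\<lambda>_. 0))"
proof -
  have m: "rank_matroid E (f l)" if "l < k" for l using tuples_matroid[OF E f that] .
  have d: "decomp E (f l) (comps E (f l))" if "l < k" for l using comps_decomp[OF m[OF that]] .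
  have blk: "block E b" using decomp_block[OF d[OF ij(1)] b(1)] .
  interpret b: rank_matroid E b by (rule blockD(1)[OF blk])
  let ?S = "supp E b"
  have SE: "?S \<subseteq> E" by (rule supp_subset)
  have one: "f l {e} = 1" if l: "l \<in> {i, j}" and e: "e \<in> ?S" for l e
  proof -
    have lk: "l < k" "b \<in> comps E (f l)" using l ij b by auto
    have eE: "e \<in> E" using e by (rule suppD)
    have "b \<in> blocks_at E (comps E (f l)) e" using lk e unfolding blocks_at_def by simp
    then have "card (blocks_at E (comps E (f l)) e) \<noteq> 0" using at_finite[OF d[OF lk(1)]] by auto
    then have "f l {e} \<noteq> 0" using card_at[OF d[OF lk(1)] eE] by auto
    then show ?thesis
      using rank_matroid.le_card[OF m[OF lk(1)], of "{e}"] rank_matroid.nonneg[OF m[OF lk(1)], of "{e}"] eE by simp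
  qed
  have zero: "f l {e} = 0" if l: "l < k" "l \<notin> {i, j}" and e: "e \<in> ?S" for l e
  proof -
    have eE: "e \<in> E" using e by (rule suppD)
    have ge: "0 \<le> f m {e}" if "m < k" for m using rank_matroid.nonneg[OF m[OF that], of "{e}"] eE by simp
    have "(\<Sum>m\<in>{i, j, l}. f m {e}) \<le> (\<Sum>m<k. f m {e})"
      using l ij ge by (intro sum_mono2) auto
    also have "\<dots> \<le> 2" using tuples_sum[OF f, of "{e}"] two[OF eE] eE by simp
    finally have "f l {e} \<le> 0" using l ij one[OF _ e] by simp
    then show ?thesis using ge[OF l(1)] by simp
  qed
  have sep: "f l X = f l (X \<inter> ?S) + f l (X - ?S)" if l: "l < k" and X: "X \<subseteq> E" for l X
  proof (cases "l \<in> {i, j}")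
    case True
    then have bl: "b \<in> comps E (f l)" using b by auto
    show ?thesis
    proof (rule saturated_separator[OF d[OF l] _ X])
      show "supp E b' \<subseteq> ?S \<or> supp E b' \<inter> ?S = {}" if "b' \<in> comps E (f l)" for b'
        using comps_disjoint[OF m[OF l] that bl] by (cases "b' = b") auto
    qed
  next
    case False
    interpret l: rank_matroid E "f l" by (rule m[OF l])
    have "supp E (f l) \<subseteq> E - ?S" using zero[OF l False] unfolding supp_def[of E "f l"] by auto
    then have r: "f l Y = f l (Y \<inter> (E - ?S))" if "Y \<subseteq> E" for Y using l.restrict_supp that by blast
    have "X \<inter> (E - ?S) = X - ?S" "(X \<inter> ?S) \<inter> (E - ?S) = {}" using X by auto
    then show ?thesis using r[OF X] r[of "X \<inter> ?S"] X by auto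
  qed
  have "\<rho> X = \<rho> (X \<inter> ?S) + \<rho> (X - ?S)" if X: "X \<subseteq> E" for X
  proof -
    have XS: "X \<inter> ?S \<subseteq> E" "X - ?S \<subseteq> E" using X by auto
    have "\<rho> X = (\<Sum>l<k. f l (X \<inter> ?S) + f l (X - ?S))"
      unfolding tuples_sum[OF f X] using sep[OF _ X] by (intro sum.cong) auto
    then show ?thesis
      using tuples_sum[OF f XS(1)] tuples_sum[OF f XS(2)] by (simp add: sum.distrib)
  qed
  then have S: "?S = E" using conn SE blockD(2)[OF blk] unfolding conn_def by blast
  have fb: "f l = b" if l: "l \<in> {i, j}" for l
  proof -
    have lk: "l < k" "b \<in> comps E (f l)" using l ij b by auto
    have "b' = b" if b': "b' \<in> comps E (f l)" for b'
    proof (rule ccontr)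
      assume "b' \<noteq> b"
      then have "supp E b' \<inter> E = {}" using comps_disjoint[OF m[OF lk(1)] b' lk(2)] S by simp
      then show False using blockD(2)[OF decomp_block[OF d[OF lk(1)] b']] supp_subset[of E b'] by blast
    qed
    then have "comps E (f l) = {b}" using lk(2) by blast
    then show ?thesis using comps_sum[OF m[OF lk(1)]] by (intro ext) simp
  qed
  have f0: "f l = (\<lambda>_. 0)" if l: "l < k" "l \<notin> {i, j}" for l
  proof
    fix X
    interpret l: rank_matroid E "f l" by (rule m[OF l(1)])
    have "supp E (f l) = {}" using zero[OF l] S unfolding supp_def[of E "f l"] by auto
    then show "f l X = 0" using l.restrict_supp[of "{}" X] l.outside[of X] by (cases "X \<subseteq> E") simp_all
  qed
  have "\<rho> X = 2 * b X" if X: "X \<subseteq> E" for X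
  proof -
    have "\<rho> X = (\<Sum>l<k. if l \<in> {i, j} then b X else 0)"
      unfolding tuples_sum[OF f X] using fb f0 by (intro sum.cong) auto
    also have "\<dots> = (\<Sum>l\<in>{..<k} \<inter> {i, j}. b X)" by (subst sum.inter_restrict) simp_all
    also have "{..<k} \<inter> {i, j} = {i, j}" using ij by auto
    finally show ?thesis using ij(3) by simp
  qed
  moreover have "f = (\<lambda>m\<in>{..<k}. if m \<in> {i, j} then b else (\<lambda>_. 0))"
  proof
    fix l show "f l = (\<lambda>m\<in>{..<k}. if m \<in> {i, j} then b else (\<lambda>_. 0)) l"
      using fb[of l] f0[of l] f unfolding tuples_def by (cases "l < k") (auto simp: PiE_def extensional_def)
  qed
  ultimately show ?thesis using blk S unfolding half_def by blast
qed

lemma half_unique: "half E \<rho> C \<Longrightarrow> half E \<rho> D \<Longrightarrow> C = D"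
proof
  fix X assume C: "half E \<rho> C" and D: "half E \<rho> D"
  show "C X = D X"
  proof (cases "X \<subseteq> E")
    case True
    then have "2 * C X = 2 * D X" using C D unfolding half_def by metis
    then show ?thesis by simp
  next
    case False
    then show ?thesis using C D block_outside unfolding half_def by metis
  qed
qed

lemma card_with_repeats:
  assumes E: "finite E" and conn: "conn E \<rho>" and two: "\<And>e. e \<in> E \<Longrightarrow> \<rho> {e} \<le> 2"
  shows "card {f \<in> tuples E \<rho> k. repeats E k f} = (if \<exists>C. half E \<rho> C then k choose 2 else 0)"
proof (cases "\<exists>C. half E \<rho> C")
  case False
  have "{f \<in> tuples E \<rho> k. repeats E k f} = {}"
    using repeats_half[OF E conn two] False unfolding repeats_def by blast
  then have "card {f \<in> tuples E \<rho> k. repeats E k f} = 0" by (simp only: card.empty)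
  then show ?thesis using False by simp
next
  case True
  then obtain C where C: "half E \<rho> C" by auto
  then have blk: "block E C" and CE: "supp E C = E" and C2: "\<And>X. X \<subseteq> E \<Longrightarrow> \<rho> X = 2 * C X"
    unfolding half_def by auto
  have Cm: "rank_matroid E C" by (rule blockD(1)[OF blk])
  obtain e where e: "e \<in> E" using blockD(2)[OF blk] CE by auto
  have C0: "C \<noteq> (\<lambda>_. 0)" using blockD(2)[OF blk] unfolding supp_def by auto
  let ?g = "\<lambda>S. \<lambda>m\<in>{..<k}. if m \<in> S then C else (\<lambda>_. 0)"
  let ?P = "{S. S \<subseteq> {..<k} \<and> card S = 2}"
  have compsC: "comps E C = {C}"
    using E blk by (intro comps_unique[OF Cm]) (simp add: decomp_def)
  have "{f \<in> tuples E \<rho> k. repeats E k f} = ?g ` ?P"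
  proof
    show "{f \<in> tuples E \<rho> k. repeats E k f} \<subseteq> ?g ` ?P"
    proof
      fix f assume "f \<in> {f \<in> tuples E \<rho> k. repeats E k f}"
      then obtain i j b where f: "f \<in> tuples E \<rho> k" "i < k" "j < k" "i \<noteq> j" "b \<in> comps E (f i)" "b \<in> comps E (f j)"
        unfolding repeats_def by blast
      have h: "half E \<rho> b" "f = (\<lambda>m\<in>{..<k}. if m \<in> {i, j} then b else (\<lambda>_. 0))"
        using repeats_half[OF E conn two f] by blast+
      have "b = C" by (rule half_unique[OF h(1) C])
      then have "f = ?g {i, j}" using h(2) by (simp only:)
      moreover have "{i, j} \<in> ?P" using f by simp
      ultimately show "f \<in> ?g ` ?P" by blast
    qed
    show "?g ` ?P \<subseteq> {f \<in> tuples E \<rho> k. repeats E k f}"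
    proof
      fix f assume "f \<in> ?g ` ?P"
      then obtain S where S: "S \<subseteq> {..<k}" "card S = 2" "f = ?g S" by auto
      obtain i j where ij: "S = {i, j}" "i \<noteq> j" using S(2) unfolding card_2_iff by auto
      have "matroid_rank E (\<lambda>_. 0)" unfolding matroid_rank_def by simp
      then have "f \<in> {..<k} \<rightarrow>\<^sub>E {r. matroid_rank E r}"
        using Cm unfolding S(3) rank_matroid_def by (intro PiE_I) auto
      moreover have "\<rho> X = (\<Sum>m<k. f m X)" if X: "X \<subseteq> E" for X
      proof -
        have "(\<Sum>m<k. f m X) = (\<Sum>m<k. if m \<in> S then C X else 0)"
          unfolding S(3) by (intro sum.cong) auto
        also have "\<dots> = (\<Sum>m\<in>{..<k} \<inter> S. C X)" by (subst sum.inter_restrict) simp_all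
        also have "{..<k} \<inter> S = S" using S(1) by auto
        finally show ?thesis using C2[OF X] S(2) by simp
      qed
      ultimately have "f \<in> tuples E \<rho> k" unfolding tuples_def by simp
      moreover have "repeats E k f"
      proof -
        have "i < k" "j < k" using ij S(1) by auto
        moreover from this have "f i = C" "f j = C" using ij S(3) by simp_all
        moreover from this have "comps E (f i) \<inter> comps E (f j) \<noteq> {}" using compsC by simp
        ultimately show ?thesis using ij(2) unfolding repeats_def by blast
      qed
      ultimately show "f \<in> {f \<in> tuples E \<rho> k. repeats E k f}" by simp
    qed
  qed
  moreover have "inj_on ?g ?P"
  proof (rule inj_onI)
    \<comment> \<open>As \<open>C\<close> is not the zero function, the two positions can be read
      off the tuple.\<close>
    have rec: "S = {m. m < k \<and> ?g S m = C}" if "S \<in> ?P" for S using that C0 by auto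
    fix S S' assume S: "S \<in> ?P" "S' \<in> ?P" and eq: "?g S = ?g S'"
    show "S = S'" using rec[OF S(1)] rec[OF S(2)] unfolding eq by metis
  qed
  ultimately have "card {f \<in> tuples E \<rho> k. repeats E k f} = card ?P" by (simp add: card_image)
  also have "\<dots> = k choose 2" using n_subsets[of "{..<k}" 2] by simp
  finally show ?thesis using True by simp
qed

lemma decomp_count_eq:
  assumes E: "finite E" and conn: "conn E \<rho>" and two: "\<And>e. e \<in> E \<Longrightarrow> \<rho> {e} \<le> 2"
  shows "matroid_decomp_count E \<rho> k = (\<Sum>B | decomp E \<rho> B. card (proper_colourings B (meets E B) k))
           + (if \<exists>C. half E \<rho> C then k choose 2 else 0)"
proof -
  have "tuples E \<rho> k = {f \<in> tuples E \<rho> k. \<not> repeats E k f} \<union> {f \<in> tuples E \<rho> k. repeats E k f}" by auto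
  then have "card (tuples E \<rho> k) = card {f \<in> tuples E \<rho> k. \<not> repeats E k f} + card {f \<in> tuples E \<rho> k. repeats E k f}"
    using finite_tuples[OF E, of \<rho> k] by (subst card_Un_disjoint[symmetric]) auto
  moreover have "card {f \<in> tuples E \<rho> k. repeats E k f} = (if \<exists>C. half E \<rho> C then k choose 2 else 0)"
    by (rule card_with_repeats[OF E conn]) (rule two)
  ultimately show ?thesis unfolding decomp_count_tuples card_without_repeats[OF E] by simp
qed

text \<open>The increments of a doubled block are 0 or 2, so the two blocks at \<open>e\<close>
  would span it from the same sets and coincide. Hence \<open>k choose 2\<close> never occurs
  together with a contribution from decompositions.\<close>

lemma half_no_decomp:
  assumes C: "half E \<rho> C" and B: "decomp E \<rho> B" shows False
proof -
  have blk: "block E C" and CE: "supp E C = E" and C2: "\<And>X. X \<subseteq> E \<Longrightarrow> \<rho> X = 2 * C X"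
    using C unfolding half_def by auto
  interpret C: rank_matroid E C by (rule blockD(1)[OF blk])
  obtain e where e: "e \<in> E" using blockD(2)[OF blk] CE by auto
  have "\<rho> {e} = 2" using C2[of "{e}"] C.supp_rank[of e] e CE by simp
  then have "card (blocks_at E B e) = 2" using card_at[OF B e] by simp
  then obtain b c where b: "blocks_at E B e = {b, c}" "b \<noteq> c" unfolding card_2_iff by auto
  have bB: "block E b" "block E c" "e \<in> supp E b" "e \<in> supp E c"
    using atD[OF b(1)] decomp_block[OF B] by auto
  have "spans b e Y = spans c e Y" if "Y \<subseteq> E - {e}" for Y
  proof -
    have Y: "Y \<subseteq> E" "insert e Y \<subseteq> E" using that e by auto
    have "2 * (C (insert e Y) - C Y) = (if spans b e Y then 0 else 1) + (if spans c e Y then 0 else 1)"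
      using increment_pair[OF B e Y(1) b] C2[OF Y(1)] C2[OF Y(2)] by simp
    then show ?thesis by (auto split: if_splits) presburger+
  qed
  then have "b = c" by (rule block_eqI2[OF bB])
  then show False using b(2) by simp
qed

section \<open>Colourings of graphs\<close>

text \<open>The neighbours of \<open>v\<close> must show the same number \<open>d\<close> of colours
  in every colouring. This holds when they are pairwise adjacent, as for an edge, a triangle or a
  path built up suitably.\<close>

lemma card_colourings_insert:
  assumes V: "finite V" "v \<notin> V" and sym: "\<And>u. Adj u v \<longleftrightarrow> Adj v u" and irr: "\<not> Adj v v"
    and d: "\<And>c. c \<in> proper_colourings V Adj k \<Longrightarrow> card (c ` {u \<in> V. Adj v u}) = d"
  shows "card (proper_colourings (insert v V) Adj k) = card (proper_colourings V Adj k) * (k - d)"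
proof -
  let ?N = "{u \<in> V. Adj v u}" and ?P = "proper_colourings V Adj k"
  let ?S = "SIGMA c:?P. {..<k} - c ` ?N"
  have rng: "c u < k" if "c \<in> ?P" "u \<in> V" for c u
    using that unfolding proper_colourings_def by (auto simp: PiE_def Pi_def)
  have fP: "finite ?P"
    unfolding proper_colourings_def using V by (intro finite_subset[OF _ finite_PiE[of V "\<lambda>_. {..<k}"]]) auto
  have "bij_betw (\<lambda>(c, x). c(v := x)) ?S (proper_colourings (insert v V) Adj k)"
  proof (rule bij_betw_byWitness[where f' = "\<lambda>c. (restrict c V, c v)"])
    show "\<forall>a\<in>?S. (restrict ((\<lambda>(c, x). c(v := x)) a) V, ((\<lambda>(c, x). c(v := x)) a) v) = a"
    proof
      fix a assume "a \<in> ?S"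
      then obtain c x where a: "a = (c, x)" "c \<in> ?P" by auto
      have "restrict (c(v := x)) V = c"
        using a(2) V(2) unfolding proper_colourings_def by (auto simp: fun_eq_iff PiE_def extensional_def restrict_def)
      then show "(restrict ((\<lambda>(c, x). c(v := x)) a) V, ((\<lambda>(c, x). c(v := x)) a) v) = a" unfolding a(1) by simp
    qed
    show "\<forall>c\<in>proper_colourings (insert v V) Adj k. (\<lambda>(c, x). c(v := x)) (restrict c V, c v) = c"
      using V(2) unfolding proper_colourings_def
      by (auto simp: fun_eq_iff PiE_def extensional_def restrict_def)
    show "(\<lambda>(c, x). c(v := x)) ` ?S \<subseteq> proper_colourings (insert v V) Adj k"
    proof
      fix c' assume "c' \<in> (\<lambda>(c, x). c(v := x)) ` ?S"
      then obtain c x where c: "c \<in> ?P" "x < k" "x \<notin> c ` ?N" "c' = c(v := x)" by auto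
      have cP: "c \<in> V \<rightarrow>\<^sub>E {..<k}" "\<And>u w. u \<in> V \<Longrightarrow> w \<in> V \<Longrightarrow> Adj u w \<Longrightarrow> c u \<noteq> c w"
        using c(1) unfolding proper_colourings_def by auto
      have "c' \<in> insert v V \<rightarrow>\<^sub>E {..<k}"
        using cP(1) c(2) unfolding c(4) by (auto simp: PiE_def extensional_def)
      moreover have "c' u \<noteq> c' w" if uw: "u \<in> insert v V" "w \<in> insert v V" "Adj u w" for u w
      proof -
        consider "u = v" "w \<in> V" | "w = v" "u \<in> V" | "u \<in> V" "w \<in> V" using uw irr by auto
        then show ?thesis
        proof cases
          case 1
          then have "w \<in> ?N" "w \<noteq> v" using uw V(2) by auto
          then show ?thesis using c(3) 1 unfolding c(4) by auto
        next
          case 2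
          then have "u \<in> ?N" "u \<noteq> v" using uw sym V(2) by auto
          then show ?thesis using c(3) 2 unfolding c(4) by auto
        next
          case 3
          then show ?thesis using cP(2) uw V(2) unfolding c(4) by auto
        qed
      qed
      ultimately show "c' \<in> proper_colourings (insert v V) Adj k" unfolding proper_colourings_def by blast
    qed
    show "(\<lambda>c. (restrict c V, c v)) ` proper_colourings (insert v V) Adj k \<subseteq> ?S"
    proof
      fix a assume "a \<in> (\<lambda>c. (restrict c V, c v)) ` proper_colourings (insert v V) Adj k"
      then obtain c where c': "c \<in> proper_colourings (insert v V) Adj k" and a: "a = (restrict c V, c v)" by blast
      then have c: "\<And>u. u \<in> insert v V \<Longrightarrow> c u < k"
        "\<And>u w. u \<in> insert v V \<Longrightarrow> w \<in> insert v V \<Longrightarrow> Adj u w \<Longrightarrow> c u \<noteq> c w"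
        unfolding proper_colourings_def by blast+
      have "restrict c V \<in> ?P" using c unfolding proper_colourings_def by simp
      moreover have "c v \<notin> restrict c V ` ?N" using c(2)[of v] by auto
      moreover have "c v < k" using c(1) by simp
      ultimately show "a \<in> ?S" unfolding a by simp
    qed
  qed
  then have "card (proper_colourings (insert v V) Adj k) = card ?S" by (rule bij_betw_same_card[symmetric])
  also have "\<dots> = (\<Sum>c\<in>?P. card ({..<k} - c ` ?N))" using fP by (intro card_SigmaI) auto
  also have "\<dots> = (\<Sum>c\<in>?P. k - d)"
  proof (rule sum.cong)
    fix c assume c: "c \<in> ?P"
    have "c ` ?N \<subseteq> {..<k}" using rng[OF c] by auto
    then show "card ({..<k} - c ` ?N) = k - d" using d[OF c] V by (subst card_Diff_subset) auto
  qed simp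
  finally show ?thesis by simp
qed

lemma card_colourings_empty: "card (proper_colourings {} Adj k) = 1"
  unfolding proper_colourings_def by simp

section \<open>Small graphs: an edge and a third vertex\<close>

context
  fixes Adj :: "'v \<Rightarrow> 'v \<Rightarrow> bool"
  assumes sym: "\<And>u v. Adj u v \<longleftrightarrow> Adj v u" and irr: "\<And>v. \<not> Adj v v"
begin

lemma card_colourings_edge:
  assumes "Adj x y" shows "card (proper_colourings {x, y} Adj k) = k * (k - 1)"
proof -
  have "x \<noteq> y" using assms irr by auto
  have "card (proper_colourings {y} Adj k) = card (proper_colourings {} Adj k) * (k - 0)"
    using irr sym by (intro card_colourings_insert) auto
  moreover have "card (proper_colourings {x, y} Adj k) = card (proper_colourings {y} Adj k) * (k - 1)"
  proof (rule card_colourings_insert[OF _ _ sym irr])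
    have "{u \<in> {y}. Adj x u} = {y}" using assms by auto
    then show "card (c ` {u \<in> {y}. Adj x u}) = 1" for c :: "'v \<Rightarrow> nat" by simp
  qed (use \<open>x \<noteq> y\<close> in auto)
  ultimately show ?thesis by (simp add: card_colourings_empty)
qed

lemma card_colourings_third:
  assumes "Adj x y" "z \<noteq> x" "z \<noteq> y" and d: "d = (if Adj z x then 1 else 0) + (if Adj z y then 1 else 0)"
  shows "card (proper_colourings {x, y, z} Adj k) = k * (k - 1) * (k - d)"
proof -
  have xy: "x \<noteq> y" using assms irr by auto
  have "card (proper_colourings (insert z {x, y}) Adj k) = card (proper_colourings {x, y} Adj k) * (k - d)"
  proof (rule card_colourings_insert[OF _ _ sym irr])
    fix c assume "c \<in> proper_colourings {x, y} Adj k"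
    then have "c x \<noteq> c y" using assms(1) unfolding proper_colourings_def by auto
    moreover have "{u \<in> {x, y}. Adj z u} = (if Adj z x then {x} else {}) \<union> (if Adj z y then {y} else {})" by auto
    ultimately show "card (c ` {u \<in> {x, y}. Adj z u}) = d" unfolding d by simp
  qed (use assms in auto)
  moreover have "insert z {x, y} = {x, y, z}" by auto
  ultimately show ?thesis by (simp add: card_colourings_edge[OF assms(1)])
qed

end

text \<open>The vertices of the overlap graph are set functions, whereas the final graph has to live
  on natural numbers.\<close>

lemma graph_to_nat:
  fixes V :: "'v set"
  assumes g: "graph V Adj"
  shows "\<exists>(V' :: nat set) Adj'. graph V' Adj' \<and> (\<forall>k. card (proper_colourings V' Adj' k) = card (proper_colourings V Adj k))"
proof -
  have V: "finite V" and adj: "\<And>u v. Adj u v \<Longrightarrow> u \<in> V \<and> v \<in> V \<and> Adj v u \<and> u \<noteq> v" using g unfolding graph_def by auto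
  obtain h :: "'v \<Rightarrow> nat" where h: "inj_on h V" using finite_imp_inj_to_nat_seg[OF V] by blast
  let ?V = "h ` V" and ?A = "\<lambda>a b. \<exists>u v. a = h u \<and> b = h v \<and> Adj u v"
  let ?g = "the_inv_into V h"
  have gh: "?g (h u) = u" if "u \<in> V" for u using the_inv_into_f_f[OF h that] .
  have hu: "Adj u v" if "?A (h u) (h v)" "u \<in> V" "v \<in> V" for u v
    using that adj h unfolding inj_on_def by metis
  have "graph ?V ?A"
    unfolding graph_def
  proof (intro conjI allI impI)
    show "finite ?V" using V by simp
    fix a b assume "?A a b"
    then obtain u v where uv: "a = h u" "b = h v" "Adj u v" by auto
    note a = adj[OF uv(3)]
    show "a \<in> ?V" "b \<in> ?V" using uv a by auto
    show "?A b a" using uv a by blast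
    show "a \<noteq> b" using uv a h unfolding inj_on_def by auto
  qed
  moreover have "card (proper_colourings ?V ?A k) = card (proper_colourings V Adj k)" for k
  proof (rule bij_betw_same_card)
    show "bij_betw (\<lambda>c. \<lambda>u\<in>V. c (h u)) (proper_colourings ?V ?A k) (proper_colourings V Adj k)"
    proof (rule bij_betw_byWitness[where f' = "\<lambda>c. \<lambda>a\<in>?V. c (?g a)"])
      show "\<forall>c\<in>proper_colourings ?V ?A k. (\<lambda>a\<in>?V. (\<lambda>u\<in>V. c (h u)) (?g a)) = c"
        unfolding proper_colourings_def using gh by (auto simp: fun_eq_iff PiE_def extensional_def)
      show "\<forall>c\<in>proper_colourings V Adj k. (\<lambda>u\<in>V. (\<lambda>a\<in>?V. c (?g a)) (h u)) = c"
        unfolding proper_colourings_def using gh by (auto simp: fun_eq_iff PiE_def extensional_def)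
      show "(\<lambda>c. \<lambda>u\<in>V. c (h u)) ` proper_colourings ?V ?A k \<subseteq> proper_colourings V Adj k"
      proof
        fix c' assume "c' \<in> (\<lambda>c. \<lambda>u\<in>V. c (h u)) ` proper_colourings ?V ?A k"
        then obtain c where c: "c \<in> proper_colourings ?V ?A k" "c' = (\<lambda>u\<in>V. c (h u))" by blast
        have "c (h u) < k" if "u \<in> V" for u using c(1) that unfolding proper_colourings_def by blast
        moreover have "c (h u) \<noteq> c (h v)" if "u \<in> V" "v \<in> V" "Adj u v" for u v
          using c(1) that unfolding proper_colourings_def by blast
        ultimately show "c' \<in> proper_colourings V Adj k"
          unfolding c(2) proper_colourings_def by simp
      qed
      show "(\<lambda>c. \<lambda>a\<in>?V. c (?g a)) ` proper_colourings V Adj k \<subseteq> proper_colourings ?V ?A k"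
      proof
        fix c' assume "c' \<in> (\<lambda>c. \<lambda>a\<in>?V. c (?g a)) ` proper_colourings V Adj k"
        then obtain c where cP: "c \<in> proper_colourings V Adj k" and c3: "c' = (\<lambda>a\<in>?V. c (?g a))" by blast
        then have c: "c \<in> V \<rightarrow>\<^sub>E {..<k}" "\<forall>u\<in>V. \<forall>v\<in>V. Adj u v \<longrightarrow> c u \<noteq> c v" "c' = (\<lambda>a\<in>?V. c (?g a))"
          unfolding proper_colourings_def by simp_all
        have c'h: "c' (h u) = c u" if "u \<in> V" for u using gh that unfolding c(3) by simp
        have "c' \<in> ?V \<rightarrow>\<^sub>E {..<k}"
        proof (rule PiE_I)
          show "c' a \<in> {..<k}" if "a \<in> ?V" for a using that c'h c(1) by (auto simp: PiE_def Pi_def)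
          show "c' a = undefined" if "a \<notin> ?V" for a using that unfolding c(3) by simp
        qed
        moreover have "c' a \<noteq> c' b" if "a \<in> ?V" "b \<in> ?V" "?A a b" for a b
          using that c'h c(2) adj by metis
        ultimately show "c' \<in> proper_colourings ?V ?A k" unfolding proper_colourings_def by blast
      qed
    qed
  qed
  ultimately show ?thesis by blast
qed

lemma graph_disjoint_union:
  fixes V1 V2 :: "nat set"
  assumes g1: "graph V1 A1" and g2: "graph V2 A2"
  shows "\<exists>(V :: nat set) A. graph V A \<and> (\<forall>k. card (proper_colourings V A k)
           = card (proper_colourings V1 A1 k) * card (proper_colourings V2 A2 k))"
proof -
  let ?V = "V1 <+> V2"
  let ?A = "\<lambda>a b. (\<exists>u v. a = Inl u \<and> b = Inl v \<and> A1 u v) \<or> (\<exists>u v. a = Inr u \<and> b = Inr v \<and> A2 u v)"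
  have a1: "\<And>u v. A1 u v \<Longrightarrow> u \<in> V1 \<and> v \<in> V1 \<and> A1 v u \<and> u \<noteq> v"
    and a2: "\<And>u v. A2 u v \<Longrightarrow> u \<in> V2 \<and> v \<in> V2 \<and> A2 v u \<and> u \<noteq> v"
    and fin: "finite V1" "finite V2" using g1 g2 unfolding graph_def by auto
  have "graph ?V ?A" unfolding graph_def using fin a1 a2 by (auto simp: Plus_def)
  moreover have "card (proper_colourings ?V ?A k) = card (proper_colourings V1 A1 k) * card (proper_colourings V2 A2 k)" for k
  proof -
    have "bij_betw (\<lambda>c. (\<lambda>u\<in>V1. c (Inl u), \<lambda>u\<in>V2. c (Inr u))) (proper_colourings ?V ?A k)
        (proper_colourings V1 A1 k \<times> proper_colourings V2 A2 k)"
    proof (rule bij_betw_byWitness[where f' = "\<lambda>(c, d). \<lambda>a\<in>?V. case a of Inl u \<Rightarrow> c u | Inr u \<Rightarrow> d u"])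
      show "\<forall>c\<in>proper_colourings ?V ?A k. (\<lambda>(c, d). \<lambda>a\<in>?V. case a of Inl u \<Rightarrow> c u | Inr u \<Rightarrow> d u)
          (\<lambda>u\<in>V1. c (Inl u), \<lambda>u\<in>V2. c (Inr u)) = c"
        unfolding proper_colourings_def
        by (auto simp: fun_eq_iff PiE_def extensional_def Plus_def split: sum.split)
      show "\<forall>p\<in>proper_colourings V1 A1 k \<times> proper_colourings V2 A2 k.
          (\<lambda>c. (\<lambda>u\<in>V1. c (Inl u), \<lambda>u\<in>V2. c (Inr u)))
            ((\<lambda>(c, d). \<lambda>a\<in>?V. case a of Inl u \<Rightarrow> c u | Inr u \<Rightarrow> d u) p) = p"
        unfolding proper_colourings_def by (auto simp: fun_eq_iff PiE_def extensional_def Plus_def)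
      show "(\<lambda>c. (\<lambda>u\<in>V1. c (Inl u), \<lambda>u\<in>V2. c (Inr u))) ` proper_colourings ?V ?A k
          \<subseteq> proper_colourings V1 A1 k \<times> proper_colourings V2 A2 k"
        unfolding proper_colourings_def by (auto simp: PiE_def Pi_def Plus_def)
      show "(\<lambda>(c, d). \<lambda>a\<in>?V. case a of Inl u \<Rightarrow> c u | Inr u \<Rightarrow> d u) `
          (proper_colourings V1 A1 k \<times> proper_colourings V2 A2 k) \<subseteq> proper_colourings ?V ?A k"
        unfolding proper_colourings_def by (auto simp: PiE_def Pi_def Plus_def extensional_def)
    qed
    then have "card (proper_colourings ?V ?A k) = card (proper_colourings V1 A1 k \<times> proper_colourings V2 A2 k)"
      by (rule bij_betw_same_card)
    then show ?thesis by (simp only: card_cartesian_product)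
  qed
  ultimately show ?thesis using graph_to_nat[of ?V ?A] by metis
qed

section \<open>Colouring counts as polynomials\<close>

lemma binomial_poly:
  "\<exists>p :: rat poly. \<forall>k. poly p (of_nat k) = of_nat (k choose j)"
proof -
  let ?p = "smult (1 / fact j) (\<Prod>i<j. [:- of_nat i, 1:]) :: rat poly"
  have "poly ?p (of_nat k) = of_nat (k choose j)" for k
    by (simp add: binomial_gbinomial gbinomial_prod_rev poly_prod atLeast0LessThan field_simps)
  then show ?thesis by blast
qed

text \<open>Sorting the colourings by their image expands the count in the basis \<open>k choose j\<close>.\<close>

lemma chromatic_poly_exists:
  assumes V: "finite V"
  shows "\<exists>p :: rat poly. \<forall>k. poly p (of_nat k) = of_nat (card (proper_colourings V Adj k))"
proof -
  define s where "s j = card {c \<in> proper_colourings V Adj j. c ` V = {..<j}}" for j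
  have fC: "finite (proper_colourings V Adj k)" for k
    unfolding proper_colourings_def using V by (intro finite_subset[OF _ finite_PiE[of V "\<lambda>_. {..<k}"]]) auto
  \<comment> \<open>Only the number of colours used matters: relabelling matches the colourings with
    image \<open>A\<close> with those with image \<open>{..<card A}\<close>.\<close>
  have onto: "card {c \<in> proper_colourings V Adj k. c ` V = A} = s (card A)" if A: "A \<subseteq> {..<k}" for A k
  proof -
    have fA: "finite A" using A finite_subset by auto
    obtain h where h: "bij_betw h {..<card A} A" using ex_bij_betw_nat_finite[OF fA] by (auto simp: atLeast0LessThan)
    let ?g = "the_inv_into {..<card A} h"
    have g: "bij_betw ?g A {..<card A}" by (rule bij_betw_the_inv_into[OF h])
    have gh: "?g (h x) = x" if "x < card A" for x
      using h that unfolding bij_betw_def by (simp add: the_inv_into_f_f)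
    have hg: "h (?g a) = a" if "a \<in> A" for a
      using h that unfolding bij_betw_def by (simp add: f_the_inv_into_f)
    have himg: "h ` {..<card A} = A" "?g ` A = {..<card A}" using h g unfolding bij_betw_def by auto
    have "bij_betw (\<lambda>c. \<lambda>v\<in>V. h (c v)) {c \<in> proper_colourings V Adj (card A). c ` V = {..<card A}}
        {c \<in> proper_colourings V Adj k. c ` V = A}"
    proof (rule bij_betw_byWitness[where f' = "\<lambda>c. \<lambda>v\<in>V. ?g (c v)"])
      show "\<forall>c\<in>{c \<in> proper_colourings V Adj (card A). c ` V = {..<card A}}. (\<lambda>v\<in>V. ?g ((\<lambda>v\<in>V. h (c v)) v)) = c"
        unfolding proper_colourings_def using gh by (auto simp: fun_eq_iff PiE_def extensional_def Pi_def)
      show "\<forall>c\<in>{c \<in> proper_colourings V Adj k. c ` V = A}. (\<lambda>v\<in>V. h ((\<lambda>v\<in>V. ?g (c v)) v)) = c"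
        unfolding proper_colourings_def using hg by (auto simp: fun_eq_iff PiE_def extensional_def)
      show "(\<lambda>c. \<lambda>v\<in>V. h (c v)) ` {c \<in> proper_colourings V Adj (card A). c ` V = {..<card A}}
          \<subseteq> {c \<in> proper_colourings V Adj k. c ` V = A}"
      proof
        fix c' assume "c' \<in> (\<lambda>c. \<lambda>v\<in>V. h (c v)) ` {c \<in> proper_colourings V Adj (card A). c ` V = {..<card A}}"
        then obtain c where c: "\<forall>u\<in>V. \<forall>v\<in>V. Adj u v \<longrightarrow> c u \<noteq> c v" "c ` V = {..<card A}" "c' = (\<lambda>v\<in>V. h (c v))"
          unfolding proper_colourings_def by auto
        have img: "c' ` V = A" using himg(1) c(2) unfolding c(3) by (simp add: image_image[symmetric])
        have "c' u \<noteq> c' v" if "u \<in> V" "v \<in> V" "Adj u v" for u v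
        proof
          assume "c' u = c' v"
          then have "h (c u) = h (c v)" using that c(3) by simp
          moreover have "c u < card A" "c v < card A" using that c(2) by auto
          ultimately have "c u = c v" using gh by metis
          then show False using c(1) that by auto
        qed
        moreover have "c' \<in> V \<rightarrow>\<^sub>E {..<k}"
        proof (rule PiE_I)
          show "c' v \<in> {..<k}" if "v \<in> V" for v using img A that by blast
        qed (simp add: c(3))
        ultimately show "c' \<in> {c \<in> proper_colourings V Adj k. c ` V = A}"
          using img unfolding proper_colourings_def by blast
      qed
      show "(\<lambda>c. \<lambda>v\<in>V. ?g (c v)) ` {c \<in> proper_colourings V Adj k. c ` V = A}
          \<subseteq> {c \<in> proper_colourings V Adj (card A). c ` V = {..<card A}}"
      proof
        fix c' assume "c' \<in> (\<lambda>c. \<lambda>v\<in>V. ?g (c v)) ` {c \<in> proper_colourings V Adj k. c ` V = A}"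
        then obtain c where c: "\<forall>u\<in>V. \<forall>v\<in>V. Adj u v \<longrightarrow> c u \<noteq> c v" "c ` V = A" "c' = (\<lambda>v\<in>V. ?g (c v))"
          unfolding proper_colourings_def by auto
        have img: "c' ` V = {..<card A}" using himg(2) c(2) unfolding c(3) by (simp add: image_image[symmetric])
        have "c' u \<noteq> c' v" if "u \<in> V" "v \<in> V" "Adj u v" for u v
        proof
          assume "c' u = c' v"
          then have "?g (c u) = ?g (c v)" using that c(3) by simp
          moreover have "c u \<in> A" "c v \<in> A" using that c(2) by auto
          ultimately have "c u = c v" using hg by metis
          then show False using c(1) that by auto
        qed
        moreover have "c' \<in> V \<rightarrow>\<^sub>E {..<card A}"
        proof (rule PiE_I)
          show "c' v \<in> {..<card A}" if "v \<in> V" for v using img that by blast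
        qed (simp add: c(3))
        ultimately show "c' \<in> {c \<in> proper_colourings V Adj (card A). c ` V = {..<card A}}"
          using img unfolding proper_colourings_def by blast
      qed
    qed
    then show ?thesis unfolding s_def by (rule bij_betw_same_card[symmetric])
  qed
  have sz: "s j = 0" if "j > card V" for j
  proof -
    have "c ` V \<noteq> {..<j}" for c :: "'a \<Rightarrow> nat"
      using card_image_le[OF V, of c] that by (metis card_lessThan not_le)
    then show ?thesis unfolding s_def by simp
  qed
  have count: "card (proper_colourings V Adj k) = (\<Sum>j\<le>card V. (k choose j) * s j)" for k
  proof -
    have "proper_colourings V Adj k = (\<Union>A\<in>Pow {..<k}. {c \<in> proper_colourings V Adj k. c ` V = A})"
      unfolding proper_colourings_def by (auto simp: PiE_def Pi_def)
    then have "card (proper_colourings V Adj k) = card (\<Union>A\<in>Pow {..<k}. {c \<in> proper_colourings V Adj k. c ` V = A})"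
      by simp
    also have "\<dots> = (\<Sum>A\<in>Pow {..<k}. card {c \<in> proper_colourings V Adj k. c ` V = A})"
      using fC by (intro card_UN_disjoint) auto
    also have "\<dots> = (\<Sum>A\<in>Pow {..<k}. s (card A))" using onto by (intro sum.cong) auto
    also have "\<dots> = (\<Sum>j\<in>{..k}. \<Sum>A\<in>{A \<in> Pow {..<k}. card A = j}. s (card A))"
    proof (rule sum.group[symmetric])
      show "card ` Pow {..<k} \<subseteq> {..k}" using card_mono[of "{..<k}"] by fastforce
    qed simp_all
    also have "\<dots> = (\<Sum>j\<in>{..k}. (k choose j) * s j)"
    proof (rule sum.cong)
      fix j
      have "(\<Sum>A\<in>{A \<in> Pow {..<k}. card A = j}. s (card A)) = (\<Sum>A\<in>{A \<in> Pow {..<k}. card A = j}. s j)"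
        by (rule sum.cong) auto
      also have "\<dots> = card {A. A \<subseteq> {..<k} \<and> card A = j} * s j" by simp
      finally show "(\<Sum>A\<in>{A \<in> Pow {..<k}. card A = j}. s (card A)) = (k choose j) * s j"
        using n_subsets[of "{..<k}" j] by simp
    qed simp
    \<comment> \<open>The range must become independent of \<open>k\<close>. Enlarging it is
      harmless as \<open>k choose j\<close> vanishes for \<open>j > k\<close>, and shrinking it as
      \<open>s j\<close> vanishes for \<open>j > card V\<close>.\<close>
    also have "\<dots> = (\<Sum>j\<in>{..max k (card V)}. (k choose j) * s j)"
      by (rule sum.mono_neutral_left) auto
    also have "\<dots> = (\<Sum>j\<le>card V. (k choose j) * s j)"
      using sz by (intro sum.mono_neutral_right) auto
    finally show ?thesis .
  qed
  obtain b :: "nat \<Rightarrow> rat poly" where b: "\<And>j k. poly (b j) (of_nat k) = of_nat (k choose j)"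
    using binomial_poly by metis
  have "poly (\<Sum>j\<le>card V. smult (of_nat (s j)) (b j)) (of_nat k) = of_nat (card (proper_colourings V Adj k))" for k
    unfolding count by (simp add: poly_sum b mult.commute)
  then show ?thesis by blast
qed

lemma poly_eq_at_positive_nats:
  fixes p q :: "rat poly"
  assumes "\<And>k. k \<ge> 1 \<Longrightarrow> poly p (of_nat k) = poly q (of_nat k)" shows "p = q"
proof (rule ccontr)
  assume "p \<noteq> q"
  then have "finite {x. poly (p - q) x = 0}" by (intro poly_roots_finite) simp
  moreover have "(of_nat :: nat \<Rightarrow> rat) ` {1..} \<subseteq> {x. poly (p - q) x = 0}" using assms by auto
  moreover have "infinite ((of_nat :: nat \<Rightarrow> rat) ` {1..})"
    using infinite_Ici[of "1::nat"] by (simp add: finite_image_iff inj_on_def)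
  ultimately show False using finite_subset by blast
qed

section \<open>The chromatic polynomial of a 2-polymatroid\<close>

text \<open>Stated for counts and not for polynomials, so that separators multiply directly.
  Polynomials enter only in the final theorem.\<close>

definition graph_like :: "'a set \<Rightarrow> ('a set \<Rightarrow> int) \<Rightarrow> bool" where
  "graph_like E \<rho> \<longleftrightarrow> (\<exists>(V :: nat set) Adj (s :: rat). graph V Adj \<and>
     (\<forall>k\<ge>1. of_nat (matroid_decomp_count E \<rho> k) = s * of_nat (card (proper_colourings V Adj k))))"

lemma graph_likeI:
  fixes V :: "'v set" and s :: rat
  assumes "graph V Adj" "\<And>k. k \<ge> 1 \<Longrightarrow> of_nat (matroid_decomp_count E \<rho> k) = s * of_nat (card (proper_colourings V Adj k))"
  shows "graph_like E \<rho>"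
  using graph_to_nat[OF assms(1)] assms(2) unfolding graph_like_def by metis

lemma graph_like_zero:
  assumes E: "finite E" and zero: "\<And>X. X \<subseteq> E \<Longrightarrow> \<rho> X = 0"
  shows "graph_like E \<rho>"
proof (rule graph_likeI[where V = "{} :: nat set" and Adj = "\<lambda>_ _. False" and s = 1])
  show "graph ({} :: nat set) (\<lambda>_ _. False)" unfolding graph_def by simp
  fix k :: nat
  let ?z = "\<lambda>i\<in>{..<k}. (\<lambda>_. 0) :: 'a set \<Rightarrow> int"
  have "tuples E \<rho> k = {?z}"
  proof
    show "tuples E \<rho> k \<subseteq> {?z}"
    proof
      fix f assume f: "f \<in> tuples E \<rho> k"
      have "f i X = 0" if i: "i < k" for i X
      proof (cases "X \<subseteq> E")
        case True
        have "\<forall>i\<in>{..<k}. 0 \<le> f i X" using rank_matroid.nonneg[OF tuples_matroid[OF E f] True] by auto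
        moreover have "(\<Sum>i<k. f i X) = 0" using tuples_sum[OF f True] zero[OF True] by simp
        ultimately have "\<forall>i\<in>{..<k}. f i X = 0" by (subst (asm) sum_nonneg_eq_0_iff) auto
        then show ?thesis using i by simp
      qed (use rank_matroid.outside[OF tuples_matroid[OF E f i]] in simp)
      then have "f i = ?z i" for i
        using f unfolding tuples_def by (cases "i < k") (auto simp: PiE_def extensional_def)
      then show "f \<in> {?z}" by auto
    qed
    have "matroid_rank E (\<lambda>_. 0)" unfolding matroid_rank_def by simp
    then show "{?z} \<subseteq> tuples E \<rho> k" using zero unfolding tuples_def by auto
  qed
  then show "of_nat (matroid_decomp_count E \<rho> k) = (1 :: rat) * of_nat (card (proper_colourings ({} :: nat set) (\<lambda>_ _. False) k))"
    unfolding decomp_count_tuples by (simp add: card_colourings_empty)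
qed

lemma graph_meets:
  assumes "finite B" shows "graph B (meets E B)"
  using assms unfolding graph_def meets_def by auto

lemma meets_sym: "meets E B u v \<longleftrightarrow> meets E B v u" and meets_irrefl: "\<not> meets E B v v"
  unfolding meets_def by auto

lemma (in tight_decomp) graph_like_tight:
  assumes E: "finite E" shows "graph_like E \<rho>"
proof -
  have count: "matroid_decomp_count E \<rho> k = (\<Sum>B | decomp E \<rho> B. card (proper_colourings B (meets E B) k))
           + (if \<exists>C. half E \<rho> C then k choose 2 else 0)" for k
    by (rule decomp_count_eq[OF E conn]) (simp add: two)
  have count0: "matroid_decomp_count E \<rho> k = (\<Sum>B | decomp E \<rho> B. card (proper_colourings B (meets E B) k))"
    if "decomp E \<rho> B" for B k
    unfolding count by (subst if_not_P) (use half_no_decomp[OF _ that] in blast, simp)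
  have c2: "card (proper_colourings B (meets E B) k) = k * (k - 1)" if B: "decomp E \<rho> B" "full E B" for B k
  proof -
    obtain x y where xy: "B = {x, y}" "meets E B x y" using full_pair[OF B] by blast
    have "card (proper_colourings {x, y} (meets E B) k) = k * (k - 1)"
      by (rule card_colourings_edge, rule meets_sym, rule meets_irrefl, rule xy(2))
    then show ?thesis unfolding xy(1)[symmetric] .
  qed
  let ?A = "\<lambda>u v :: nat. {u, v} = {0, 1}" and ?P = "\<lambda>u v :: nat. {u, v} = {0, 1} \<or> {u, v} = {0, 2}"
  have A: "?A u v \<longleftrightarrow> ?A v u" "\<not> ?A u u" and P: "?P u v \<longleftrightarrow> ?P v u" "\<not> ?P u u" for u v :: nat
    by (auto simp: doubleton_eq_iff)
  show ?thesis
  proof (cases rule: decomp_cases)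
    case 1
    let ?s = "of_nat (card {B. decomp E \<rho> B}) + (if \<exists>C. half E \<rho> C then 1 / 2 else 0) :: rat"
    have gen: "a * (2 * c) + (if h then c else 0) = (a + (if h then 1 / 2 else 0)) * (2 * c)" for a c :: rat and h :: bool
      by (cases h) (simp_all add: distrib_right)
    show ?thesis
    proof (rule graph_likeI[where V = "{0, 1} :: nat set" and Adj = ?A and s = ?s])
      show "graph ({0, 1} :: nat set) ?A" unfolding graph_def by (auto simp: doubleton_eq_iff)
      fix k :: nat
      define m where "m = k * (k - 1)"
      have edge: "card (proper_colourings ({0, 1} :: nat set) ?A k) = m"
        unfolding m_def by (rule card_colourings_edge, rule A, rule A) simp
      \<comment> \<open>Evenness makes the division in \<open>choose_two\<close> exact.\<close>
      have "even m" unfolding m_def by (cases k) auto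
      then have "2 * (k choose 2) = m" unfolding choose_two m_def by simp
      then have m2: "rat_of_nat m = 2 * of_nat (k choose 2)" by auto
      have "(\<Sum>B | decomp E \<rho> B. card (proper_colourings B (meets E B) k)) = card {B. decomp E \<rho> B} * m"
        using c2 1 unfolding m_def by simp
      then have "rat_of_nat (matroid_decomp_count E \<rho> k)
          = of_nat (card {B. decomp E \<rho> B}) * of_nat m + (if \<exists>C. half E \<rho> C then of_nat (k choose 2) else 0)"
        unfolding count by (cases "\<exists>C. half E \<rho> C") (simp_all only: if_True if_False of_nat_add of_nat_mult of_nat_0)
      then show "rat_of_nat (matroid_decomp_count E \<rho> k) = ?s * of_nat (card (proper_colourings ({0, 1} :: nat set) ?A k))"
        unfolding edge m2 gen .
    qed
  next
    case (2 B)
    have "{B. decomp E \<rho> B} = {B}" by (intro equalityI subsetI; metis 2 mem_Collect_eq singletonD singletonI)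
    then have "matroid_decomp_count E \<rho> k = card (proper_colourings B (meets E B) k)" for k
      unfolding count0[OF 2(1)] by simp
    then show ?thesis using graph_likeI[OF graph_meets[OF decomp_finite(2)[OF 2(1)]], of E \<rho> 1 E] by simp
  next
    case (3 B B')
    have "{B. decomp E \<rho> B} = {B, B'}"
      by (intro equalityI subsetI; metis 3(1,2,6) mem_Collect_eq insertE insertCI singletonD)
    then have cnt: "matroid_decomp_count E \<rho> k = card (proper_colourings B (meets E B) k) + k * (k - 1)" for k
      unfolding count0[OF 3(1)] using 3(3) c2[OF 3(2,4)] by simp
    show ?thesis
    proof (cases "triangle B")
      case True
      then obtain x y z where B: "B = {x, y, z}" "meets E B x y" "meets E B y z" "meets E B x z"
        unfolding triangle_def by auto
      have ne: "z \<noteq> x" "z \<noteq> y" using B(3,4) unfolding meets_def by auto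
      have "card (proper_colourings {x, y, z} (meets E B) k) = k * (k - 1) * (k - 2)" for k
        by (rule card_colourings_third, rule meets_sym, rule meets_irrefl, rule B(2), rule ne, rule ne)
          (use B(3,4) in \<open>simp add: meets_sym[of E B z]\<close>)
      \<comment> \<open>For \<open>k \<le> 1\<close> both sides vanish, so the truncated
        subtractions do no harm.\<close>
      then have "matroid_decomp_count E \<rho> k = k * (k - 1) * (k - 1)" for k
        unfolding cnt B(1)[symmetric] by (cases k; cases "k - 1") (auto simp: algebra_simps)
      moreover have "card (proper_colourings ({0, 1, 2} :: nat set) ?P k) = k * (k - 1) * (k - 1)" for k
        by (rule card_colourings_third, rule P, rule P) (auto simp: doubleton_eq_iff)
      moreover have "graph ({0, 1, 2} :: nat set) ?P" unfolding graph_def by (auto simp: doubleton_eq_iff)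
      ultimately show ?thesis using graph_likeI[of "{0, 1, 2} :: nat set" ?P E \<rho> 1] by simp
    next
      case False
      then obtain x y z where B: "B = {x, y, z}" "y \<noteq> z" "meets E B x y" "meets E B x z" "\<not> meets E B y z"
        using 3(5) unfolding path3_def by auto
      have ne: "z \<noteq> x" "z \<noteq> y" using B(2,4) unfolding meets_def by auto
      have "card (proper_colourings {x, y, z} (meets E B) k) = k * (k - 1) * (k - 1)" for k
        by (rule card_colourings_third, rule meets_sym, rule meets_irrefl, rule B(3), rule ne, rule ne)
          (use B(4,5) in \<open>simp add: meets_sym[of E B z]\<close>)
      then have "matroid_decomp_count E \<rho> k = k * (k - 1) * (k - 0)" for k
        unfolding cnt B(1)[symmetric] by (cases k) (auto simp: algebra_simps)
      moreover have "card (proper_colourings ({0, 1, 2} :: nat set) ?A k) = k * (k - 1) * (k - 0)" for k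
        by (rule card_colourings_third, rule A, rule A) (auto simp: doubleton_eq_iff)
      moreover have "graph ({0, 1, 2} :: nat set) ?A" unfolding graph_def by (auto simp: doubleton_eq_iff)
      ultimately show ?thesis using graph_likeI[of "{0, 1, 2} :: nat set" ?A E \<rho> 1] by simp
    qed
  qed
qed

text \<open>Parity at \<open>e\<close> excludes \<open>half\<close>. When \<open>\<rho>\<close> has
  no decomposition, the factor 0 is taken with the empty graph.\<close>

lemma graph_like_rank_one:
  assumes E: "finite E" and conn: "conn E \<rho>" and two: "\<And>e. e \<in> E \<Longrightarrow> \<rho> {e} \<in> {1, 2}"
    and e: "e \<in> E" "\<rho> {e} = 1"
  shows "graph_like E \<rho>"
proof -
  have nh: "\<not> (\<exists>C. half E \<rho> C)"
  proof
    assume "\<exists>C. half E \<rho> C"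
    then obtain C where "\<rho> {e} = 2 * C {e}" using e(1) unfolding half_def by auto
    then show False using e(2) by presburger
  qed
  have "\<rho> {x} \<le> 2" if "x \<in> E" for x using two[OF that] by auto
  then have count: "matroid_decomp_count E \<rho> k = (\<Sum>B | decomp E \<rho> B. card (proper_colourings B (meets E B) k))" for k
    using decomp_count_eq[OF E conn, of k] nh by simp
  show ?thesis
  proof (cases "\<exists>B. decomp E \<rho> B")
    case True
    then obtain B where B: "decomp E \<rho> B" by auto
    then have "{B. decomp E \<rho> B} = {B}" using decomp_unique_of_rank_one[OF conn two B _ e] by blast
    then have "matroid_decomp_count E \<rho> k = card (proper_colourings B (meets E B) k)" for k
      unfolding count by simp
    then show ?thesis using graph_likeI[OF graph_meets[OF decomp_finite(2)[OF B]], of E \<rho> 1 E] by simp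
  next
    case False
    then have "{B. decomp E \<rho> B} = {}" by blast
    then have "matroid_decomp_count E \<rho> k = 0" for k unfolding count by (simp only: sum.empty)
    then show ?thesis
      using graph_likeI[of "{} :: nat set" "\<lambda>_ _. False" E \<rho> 0] unfolding graph_def by simp
  qed
qed

text \<open>By subadditivity each matroid of a tuple has a nonnegative slack across
  \<open>A\<close>. The slacks sum to 0 because \<open>\<rho>\<close> splits, so \<open>A\<close>
  separates every matroid of the tuple.\<close>

lemma card_tuples_separator:
  assumes E: "finite E" and A: "A \<subseteq> E" and sep: "\<And>X. X \<subseteq> E \<Longrightarrow> \<rho> X = \<rho> (X \<inter> A) + \<rho> (X - A)"
  shows "card (tuples E \<rho> k) = card (tuples A \<rho> k) * card (tuples (E - A) \<rho> k)"
proof -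
  let ?r = "\<lambda>D f. \<lambda>i\<in>{..<k}. minor D {} (f i)"
  let ?u = "\<lambda>(f, g). \<lambda>i\<in>{..<k}. \<lambda>X. if X \<subseteq> E then f i (X \<inter> A) + g i (X - A) else 0"
  have fin: "finite A" "finite (E - A)" using E A finite_subset by auto
  have split: "f i X = f i (X \<inter> A) + f i (X - A)" if f: "f \<in> tuples E \<rho> k" and i: "i < k" and X: "X \<subseteq> E" for f i X
  proof -
    have XA: "X \<inter> A \<subseteq> E" "X - A \<subseteq> E" using X by auto
    have m: "rank_matroid E (f i)" if "i < k" for i using tuples_matroid[OF E f that] .
    have "0 \<le> f i (X \<inter> A) + f i (X - A) - f i X" if "i < k" for i
    proof -
      have "(X \<inter> A) \<union> (X - A) = X" by auto
      then show ?thesis using rank_matroid.Un_le[OF m[OF that] XA] by simp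
    qed
    moreover have "(\<Sum>i<k. f i (X \<inter> A) + f i (X - A) - f i X) = 0"
      using tuples_sum[OF f X] tuples_sum[OF f XA(1)] tuples_sum[OF f XA(2)] sep[OF X]
      by (simp add: sum.distrib sum_subtractf)
    ultimately have "\<forall>i\<in>{..<k}. f i (X \<inter> A) + f i (X - A) - f i X = 0"
      by (subst (asm) sum_nonneg_eq_0_iff) auto
    then show ?thesis using i by simp
  qed
  have restr: "?r D f \<in> tuples D \<rho> k" if f: "f \<in> tuples E \<rho> k" and D: "D \<subseteq> E" for f D
  proof -
    have m: "rank_matroid E (f i)" if "i < k" for i using tuples_matroid[OF E f that] .
    have "matroid_rank D (minor D {} (f i))" if "i < k" for i
      using rank_matroid.minor_matroid[OF m[OF that] D] unfolding rank_matroid_def by simp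
    moreover have "\<rho> X = (\<Sum>i<k. ?r D f i X)" if X: "X \<subseteq> D" for X
    proof -
      have "(\<Sum>i<k. ?r D f i X) = (\<Sum>i<k. f i X)"
        using X rank_matroid.empty[OF m] by (intro sum.cong) (auto simp: minor_def)
      then show ?thesis using tuples_sum[OF f, of X] X D by simp
    qed
    ultimately show ?thesis unfolding tuples_def by auto
  qed
  have "bij_betw (\<lambda>f. (?r A f, ?r (E - A) f)) (tuples E \<rho> k) (tuples A \<rho> k \<times> tuples (E - A) \<rho> k)"
  proof (rule bij_betw_byWitness[where f' = ?u])
    show "\<forall>f\<in>tuples E \<rho> k. ?u (?r A f, ?r (E - A) f) = f"
    proof
      fix f assume f: "f \<in> tuples E \<rho> k"
      have "?u (?r A f, ?r (E - A) f) i X = f i X" for i X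
      proof (cases "i < k")
        case True
        interpret m: rank_matroid E "f i" by (rule tuples_matroid[OF E f True])
        show ?thesis
        proof (cases "X \<subseteq> E")
          case X: True
          then have "X \<inter> A \<subseteq> A" "X - A \<subseteq> E - A" by auto
          then show ?thesis using True X split[OF f True X] by (simp add: minor_def)
        next
          case False
          then show ?thesis using True m.outside by simp
        qed
      next
        case False
        then show ?thesis using f unfolding tuples_def by (auto simp: PiE_def extensional_def)
      qed
      then show "?u (?r A f, ?r (E - A) f) = f" by (intro ext)
    qed
    show "\<forall>p\<in>tuples A \<rho> k \<times> tuples (E - A) \<rho> k. (\<lambda>f. (?r A f, ?r (E - A) f)) (?u p) = p"
    proof
      fix p assume "p \<in> tuples A \<rho> k \<times> tuples (E - A) \<rho> k"
      then obtain f g where p: "p = (f, g)" "f \<in> tuples A \<rho> k" "g \<in> tuples (E - A) \<rho> k" by auto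
      have mf: "rank_matroid A (f i)" and mg: "rank_matroid (E - A) (g i)" if "i < k" for i
        using tuples_matroid[OF fin(1) p(2) that] tuples_matroid[OF fin(2) p(3) that] .
      define h where "h = ?u p"
      have h: "h i X = f i (X \<inter> A) + g i (X - A)" if "i < k" "X \<subseteq> E" for i X
        using that unfolding h_def p(1) by simp
      have zero: "f i {} = 0" "g i {} = 0" if "i < k" for i
        using rank_matroid.empty[OF mf[OF that]] rank_matroid.empty[OF mg[OF that]] .
      have "?r A h i X = f i X" for i X
      proof (cases "i < k")
        case True
        show ?thesis
        proof (cases "X \<subseteq> A")
          case X: True
          then have XA: "X \<inter> A = X" "X - A = {}" "X \<subseteq> E" using A by auto
          have "?r A h i X = h i X - h i {}" using True X by (simp add: minor_def)
          then show ?thesis using h[OF True XA(3)] h[OF True, of "{}"] zero[OF True] unfolding XA(1,2) by simp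
        next
          case False
          then show ?thesis using True rank_matroid.outside[OF mf[OF True]] by (simp add: minor_def)
        qed
      next
        case False
        then show ?thesis using p(2) unfolding tuples_def by (auto simp: PiE_def extensional_def)
      qed
      moreover have "?r (E - A) h i X = g i X" for i X
      proof (cases "i < k")
        case True
        show ?thesis
        proof (cases "X \<subseteq> E - A")
          case X: True
          then have XA: "X \<inter> A = {}" "X - A = X" "X \<subseteq> E" by auto
          have "?r (E - A) h i X = h i X - h i {}" using True X by (simp add: minor_def)
          then show ?thesis using h[OF True XA(3)] h[OF True, of "{}"] zero[OF True] unfolding XA(1,2) by simp
        next
          case False
          then show ?thesis using True rank_matroid.outside[OF mg[OF True]] by (simp add: minor_def)
        qed
      next
        case False
        then show ?thesis using p(3) unfolding tuples_def by (auto simp: PiE_def extensional_def)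
      qed
      ultimately have "?r A h = f" "?r (E - A) h = g" by (intro ext; blast)+
      then show "(\<lambda>f. (?r A f, ?r (E - A) f)) (?u p) = p" unfolding h_def p(1) by simp
    qed
    show "(\<lambda>f. (?r A f, ?r (E - A) f)) ` tuples E \<rho> k \<subseteq> tuples A \<rho> k \<times> tuples (E - A) \<rho> k"
      using restr A by auto
    show "?u ` (tuples A \<rho> k \<times> tuples (E - A) \<rho> k) \<subseteq> tuples E \<rho> k"
    proof
      fix h assume "h \<in> ?u ` (tuples A \<rho> k \<times> tuples (E - A) \<rho> k)"
      then obtain f g where fg: "f \<in> tuples A \<rho> k" "g \<in> tuples (E - A) \<rho> k" "h = ?u (f, g)" by auto
      have "matroid_rank E (h i)" if i: "i < k" for i
      proof -
        interpret f: rank_matroid A "f i" by (rule tuples_matroid[OF fin(1) fg(1) i])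
        interpret g: rank_matroid "E - A" "g i" by (rule tuples_matroid[OF fin(2) fg(2) i])
        have h: "h i X = f i (X \<inter> A) + g i (X - A)" if "X \<subseteq> E" for X using that i unfolding fg(3) by simp
        have h0: "h i X = 0" if "\<not> X \<subseteq> E" for X using that i unfolding fg(3) by simp
        have s: "X \<inter> A \<subseteq> A" "X - A \<subseteq> E - A" if "X \<subseteq> E" for X using that by auto
        show ?thesis
          unfolding matroid_rank_def
        proof (intro conjI allI impI)
          fix X assume X: "X \<subseteq> E"
          show "0 \<le> h i X" using f.nonneg[OF s(1)[OF X]] g.nonneg[OF s(2)[OF X]] h[OF X] by simp
          have "finite X" using X E finite_subset by auto
          then have "card X = card (X \<inter> A) + card (X - A)" by (simp add: card_Int_Diff)
          then show "h i X \<le> int (card X)" using f.le_card[OF s(1)[OF X]] g.le_card[OF s(2)[OF X]] h[OF X] by simp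
        next
          fix X Y assume XY: "X \<subseteq> Y \<and> Y \<subseteq> E"
          then have X: "X \<subseteq> E" by auto
          have "X \<inter> A \<subseteq> Y \<inter> A" "X - A \<subseteq> Y - A" using XY by auto
          then show "h i X \<le> h i Y"
            using f.mono[OF _ s(1)] g.mono[OF _ s(2)] h[OF X] h[of Y] XY by (simp add: add_mono)
        next
          fix X Y assume XY: "X \<subseteq> E \<and> Y \<subseteq> E"
          have "(X \<union> Y) \<inter> A = (X \<inter> A) \<union> (Y \<inter> A)" "(X \<inter> Y) \<inter> A = (X \<inter> A) \<inter> (Y \<inter> A)"
            "(X \<union> Y) - A = (X - A) \<union> (Y - A)" "(X \<inter> Y) - A = (X - A) \<inter> (Y - A)" by auto
          moreover have "X \<union> Y \<subseteq> E" "X \<inter> Y \<subseteq> E" using XY by auto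
          ultimately show "h i (X \<union> Y) + h i (X \<inter> Y) \<le> h i X + h i Y"
            using f.submod[OF s(1) s(1), of X Y] g.submod[OF s(2) s(2), of X Y] XY h by simp
        next
          fix X assume "\<not> X \<subseteq> E"
          then show "h i X = 0" by (rule h0)
        qed
      qed
      then have "h \<in> {..<k} \<rightarrow>\<^sub>E {r. matroid_rank E r}" using fg(3) by (intro PiE_I) auto
      moreover have "\<rho> X = (\<Sum>i<k. h i X)" if X: "X \<subseteq> E" for X
      proof -
        have XA: "X \<inter> A \<subseteq> A" "X - A \<subseteq> E - A" using X by auto
        have "(\<Sum>i<k. h i X) = (\<Sum>i<k. f i (X \<inter> A) + g i (X - A))" using X unfolding fg(3) by simp
        then show ?thesis
          using sep[OF X] tuples_sum[OF fg(1) XA(1)] tuples_sum[OF fg(2) XA(2)] by (simp add: sum.distrib)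
      qed
      ultimately show "h \<in> tuples E \<rho> k" unfolding tuples_def by simp
    qed
  qed
  then have "card (tuples E \<rho> k) = card (tuples A \<rho> k \<times> tuples (E - A) \<rho> k)"
    by (rule bij_betw_same_card)
  then show ?thesis by (simp only: card_cartesian_product)
qed

section \<open>Induction over separators\<close>

lemma two_polymatroid_subset: "two_polymatroid E \<rho> \<Longrightarrow> A \<subseteq> E \<Longrightarrow> two_polymatroid A \<rho>"
  unfolding two_polymatroid_def polymatroid_def using finite_subset by (meson order_trans subsetD)

lemma graph_like_two_polymatroid:
  assumes "two_polymatroid E \<rho>" shows "graph_like E \<rho>"
proof -
  have "finite E" using assms unfolding two_polymatroid_def polymatroid_def by simp
  then show ?thesis using assms
  proof (induction E rule: finite_psubset_induct)
    case (psubset E)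
    have p: "finite E" "\<rho> {} = 0" "\<And>X Y. X \<subseteq> Y \<Longrightarrow> Y \<subseteq> E \<Longrightarrow> \<rho> X \<le> \<rho> Y"
      "\<And>X Y. X \<subseteq> E \<Longrightarrow> Y \<subseteq> E \<Longrightarrow> \<rho> (X \<union> Y) + \<rho> (X \<inter> Y) \<le> \<rho> X + \<rho> Y"
      "\<And>e. e \<in> E \<Longrightarrow> \<rho> {e} \<le> 2"
      using psubset.prems unfolding two_polymatroid_def polymatroid_def by auto
    show ?case
    proof (cases "conn E \<rho>")
      case False
      then obtain A where A: "A \<subseteq> E" "\<forall>X\<subseteq>E. \<rho> X = \<rho> (X \<inter> A) + \<rho> (X - A)" "A \<noteq> {}" "A \<noteq> E"
        unfolding conn_def by auto
      have "A \<subset> E" "E - A \<subset> E" using A by auto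
      then have "graph_like A \<rho>" "graph_like (E - A) \<rho>"
        using psubset.IH two_polymatroid_subset[OF psubset.prems] by auto
      then obtain V1 A1 s1 V2 A2 s2 where g: "graph (V1 :: nat set) A1" "graph (V2 :: nat set) A2"
        and c1: "\<forall>k\<ge>1. of_nat (matroid_decomp_count A \<rho> k) = (s1 :: rat) * of_nat (card (proper_colourings V1 A1 k))"
        and c2: "\<forall>k\<ge>1. of_nat (matroid_decomp_count (E - A) \<rho> k) = (s2 :: rat) * of_nat (card (proper_colourings V2 A2 k))"
        unfolding graph_like_def by blast
      obtain V :: "nat set" and Adj where V: "graph V Adj"
        "\<And>k. card (proper_colourings V Adj k) = card (proper_colourings V1 A1 k) * card (proper_colourings V2 A2 k)"
        using graph_disjoint_union[OF g] by auto
      have "matroid_decomp_count E \<rho> k = matroid_decomp_count A \<rho> k * matroid_decomp_count (E - A) \<rho> k" for k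
        unfolding decomp_count_tuples using card_tuples_separator[OF p(1) A(1)] A(2) by blast
      then show ?thesis using V c1 c2 by (intro graph_likeI[of V Adj E \<rho> "s1 * s2"]) simp_all
    next
      case conn: True
      show ?thesis
      proof (cases "\<exists>e\<in>E. \<rho> {e} \<le> 0")
        case True
        then obtain e where e': "e \<in> E" "\<rho> {e} \<le> 0" by blast
        then have e: "e \<in> E" "\<rho> {e} = 0" using p(3)[of "{}" "{e}"] p(2) by simp_all
        \<comment> \<open>An element of rank 0 is a separator by itself, so connectivity leaves only
          \<open>E = {e}\<close> and \<open>\<rho>\<close> vanishes.\<close>
        have "\<rho> X = \<rho> (X \<inter> {e}) + \<rho> (X - {e})" if X: "X \<subseteq> E" for X
        proof (cases "e \<in> X")
          case True
          then have "(X - {e}) \<union> {e} = X" "(X - {e}) \<inter> {e} = {}" "X \<inter> {e} = {e}" by auto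
          then have "\<rho> X \<le> \<rho> (X - {e})" using p(4)[of "X - {e}" "{e}"] X e p(2) by auto
          moreover have "\<rho> (X - {e}) \<le> \<rho> X" using p(3) X by auto
          ultimately show ?thesis using e \<open>X \<inter> {e} = {e}\<close> by simp
        next
          case False
          then show ?thesis using p(2) by simp
        qed
        then have "E = {e}" using conn e(1) unfolding conn_def by (metis empty_iff empty_subsetI insert_subset singletonI)
        then have "\<rho> X = 0" if "X \<subseteq> E" for X using that e(2) p(2) by (metis subset_singleton_iff)
        then show ?thesis by (rule graph_like_zero[OF p(1)])
      next
        case False
        then have two: "\<rho> {e} \<in> {1, 2}" if "e \<in> E" for e using p(5)[OF that] that by force
        consider "E = {}" | e where "e \<in> E" "\<rho> {e} = 1" | "E \<noteq> {}" "\<And>e. e \<in> E \<Longrightarrow> \<rho> {e} = 2"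
          using two by blast
        then show ?thesis
        proof cases
          case 1
          then show ?thesis using p(1,2) by (intro graph_like_zero) simp_all
        next
          case (2 e)
          then show ?thesis using graph_like_rank_one[OF p(1) conn two] by blast
        next
          case 3
          interpret tight_decomp E \<rho> by standard (use conn 3 in auto)
          show ?thesis by (rule graph_like_tight[OF p(1)])
        qed
      qed
    qed
  qed
qed

theorem theorem3p3:
  fixes E :: "'a set" and \<rho> :: "'a set \<Rightarrow> int"
  assumes "two_polymatroid E \<rho>"
  shows "\<exists>(V :: nat set) Adj (s :: rat). graph V Adj \<and> poly_chrom E \<rho> = smult s (graph_chrom V Adj)"
proof -
  obtain V :: "nat set" and Adj and s :: rat where g: "graph V Adj"
    and count: "\<And>k. k \<ge> 1 \<Longrightarrow> of_nat (matroid_decomp_count E \<rho> k) = s * of_nat (card (proper_colourings V Adj k))"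
    using graph_like_two_polymatroid[OF assms] unfolding graph_like_def by blast
  obtain p :: "rat poly" where p: "\<And>k. poly p (of_nat k) = of_nat (card (proper_colourings V Adj k))"
    using chromatic_poly_exists[of V Adj] g unfolding graph_def by auto
  \<comment> \<open>A polynomial is determined by its values at the positive integers, which
    evaluates both definite descriptions. For \<open>poly_chrom\<close>, the existence of the
    polynomial comes from the graph as well.\<close>
  have "graph_chrom V Adj = p"
    unfolding graph_chrom_def using p by (intro the_equality poly_eq_at_positive_nats) auto
  moreover have "poly_chrom E \<rho> = smult s p"
    unfolding poly_chrom_def using p count by (intro the_equality poly_eq_at_positive_nats) auto
  ultimately show ?thesis using g by blast
qed

end
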